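(* Fix $p\in(0,1/2]$. For integers $n,d\ge 2$ let $\tilde X_1,\dots,\tilde X_n$ be i.i.d. standard Gaussian vectors $\mathcal N(0,I_d)$ in $\mathbb R^d$, let $\tilde t_p=\tilde t_{p,d}$ be the threshold with $\mathbb P(\langle \tilde X_1,\tilde X_2\rangle\ge \tilde t_p)=p$, and let $$\tilde{\mathcal E}=\tilde{\mathcal E}(n,d,p)=\{\langle \tilde X_i,\tilde X_j\rangle\ge \tilde t_p\ \text{for all } 1\le i\ne j\le n\}$$ be the event that the Gaussian random geometric graph on $n$ vertices with edge probability $p$ is the complete graph. (1) (Lower bound) There exists a constant $C>0$ such that for all $n,d\ge2$, $$\mathbb P(\tilde{\mathcal E})\ge\exp\left(-C\min\left(n^2,\,n\sqrt{d\log n},\,nd\right)\right).$$ (2) (Upper bound) There exist a constant $c>0$ and a sequence $\varepsilon_n\to0$ (as $n\to\infty$) such that for all $n,d\ge2$, $$\mathbb P(\tilde{\mathcal E})\le\exp\left(-c\min\left(n^2,\,n\sqrt{d\log\left(\max\left(\frac{n^{1-\varepsilon_n}}{d^{3/4}},\,e\right)\right)},\,nd\right)\right).$$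
   Context: The Gaussian random geometric graph with parameters $n,p$ in dimension $d$ has vertex set $\{1,\dots,n\}$, and $i\neq j$ are joined by an edge iff $\langle \tilde X_i,\tilde X_j\rangle\ge \tilde t_p$, where $\tilde X_1,\dots,\tilde X_n$ are i.i.d. $\mathcal N(0,I_d)$. Constants may depend on $p$ but not on $n$ and $d$; $\log$ is the natural logarithm. *)

theory Defs
  imports "HOL-Probability.Probability"
begin

text \<open>The dimension \<open>d\<close> and the number of vectors \<open>n\<close> are quantified inside the statement, so a
  vector of $\mathbb{R}^d$ is a function on the index set \<open>{1..d}\<close>, and a sample is a family of
  such vectors indexed by \<open>{1..n}\<close>.\<close>

definition std_gaussian :: "nat \<Rightarrow> (nat \<Rightarrow> real) measure" where
  "std_gaussian d = PiM {1..d} (\<lambda>_. density lborel std_normal_density)"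

text \<open>The joint law of \<open>n\<close> i.i.d. standard Gaussian vectors; the \<open>i\<close>-th vector is the \<open>i\<close>-th
  coordinate of the outer product.\<close>

definition gaussian_sample :: "nat \<Rightarrow> nat \<Rightarrow> (nat \<Rightarrow> nat \<Rightarrow> real) measure" where
  "gaussian_sample n d = PiM {1..n} (\<lambda>_. std_gaussian d)"

definition ip :: "nat \<Rightarrow> (nat \<Rightarrow> real) \<Rightarrow> (nat \<Rightarrow> real) \<Rightarrow> real" where
  "ip d x y = (\<Sum>k\<in>{1..d}. x k * y k)"

text \<open>For \<open>d \<ge> 1\<close> the inner product of two independent standard Gaussian vectors has a positive
  density on the punctured line, so for \<open>0 < p < 1\<close> exactly one \<open>t\<close> satisfies this predicate.\<close>

definition is_threshold :: "nat \<Rightarrow> real \<Rightarrow> real \<Rightarrow> bool" where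
  "is_threshold d p t \<longleftrightarrow> \<P>(X in gaussian_sample 2 d. ip d (X 1) (X 2) \<ge> t) = p"

definition complete_event :: "nat \<Rightarrow> nat \<Rightarrow> real \<Rightarrow> (nat \<Rightarrow> nat \<Rightarrow> real) set" where
  "complete_event n d t =
     {X \<in> space (gaussian_sample n d).
        \<forall>i\<in>{1..n}. \<forall>j\<in>{1..n}. i \<noteq> j \<longrightarrow> ip d (X i) (X j) \<ge> t}"

end

theory Submission
  imports Defs
begin

text \<open>
  Upper bound. Only \<open>t \<ge> 0\<close> is used. Split the vectors into two halves of \<open>N\<close> vectors and let \<open>A\<close> be the
  set of all \<open>x\<close> with \<open>ip d x y \<ge> 0\<close> for the \<open>y\<close> of the first half revealed so far. If \<open>A\<close> has Gaussian
  measure at least \<open>exp (- r)\<close>, then, outside an event of probability \<open>exp (- r)\<close>, a new vector \<open>y\<close> cuts off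
  at least a fraction \<open>\<delta> = exp (- C * r\<^sup>2 / d)\<close> of \<open>A\<close>. Hence the expectation of the \<open>N\<close>-th power of the
  final measure of \<open>A\<close>, which bounds the probability of the clique, is at most about
  \<open>(exp (- r) + exp (- \<delta> * N)) ^ N\<close>. The choice \<open>r = sqrt d\<close> gives the bound with \<open>min (n\<^sup>2) (n * sqrt d)\<close>, and
  \<open>r\<close> of order \<open>min (sqrt (d * ln (n / d powr (3/4)))) d\<close> the one for larger \<open>n\<close>; the correction
  \<open>\<epsilon>\<close> can be taken to be \<open>0\<close>. The claim about the fraction is a reverse
  hypercontractivity statement for the product kernel with factors \<open>1 - \<rho> * \<xi> x * \<xi> y\<close>, where \<open>\<xi>\<close> is a
  truncation of the identity and \<open>\<rho>\<close> has order \<open>r / d\<close>: it has to put mass on every pair of large sets, but it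
  is small on pairs with nonnegative inner product.

  Lower bound. All coordinates bounded below by a constant gives \<open>n * d\<close>. Shifting all vectors by \<open>a\<close> in
  the first coordinate costs \<open>n * a\<^sup>2 / 2\<close>, and the remaining inner products have to exceed about \<open>- a\<^sup>2 / 2\<close>:
  for \<open>a\<^sup>2\<close> of order \<open>sqrt (d * ln n)\<close> this follows from a union bound, for \<open>a\<^sup>2\<close> of order \<open>n \<ge> c * sqrt d\<close>
  it costs a constant factor per pair. For \<open>n < c * sqrt d\<close> each vector is shifted along the sum of the
  previous ones.
\<close>

section \<open>A two-function inequality for a bounded sub-Gaussian variable\<close>

text \<open>Each kernel factor is, up to truncation, the Mehler kernel of correlation -\<rho> cut
  after its linear term. The logarithm of the product is about - \<rho> * ip d x y minus a
  second-order term of size \<rho>^2 * d. So on pairs with nonnegative inner product the kernel is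
  exponentially small only through the second-order term, whereas the reverse inequality guarantees
  a mean of order exp (- 16 * \<rho> * r) on sets of measure exp (- 2 * r). The two are incompatible
  once \<rho> * d is a large multiple of r, which is what fixes \<rho>. The mass must then sit on
  violating pairs. Turning mass into probability needs the second moment of the kernel, at the price
  exp (100 * \<rho>^2 * d); all exponents are of order r^2 / d, hence the form of \<delta>.
  Truncation keeps the factors positive and bounded, but detaches the kernel from the true inner
  product; restricting to typical vectors repairs this. In the lower bound the difficulty is to meet
  many slab conditions at once with only a constant factor lost per condition. Such events are
  symmetric, and a translate of a symmetric event by u costs no more than exp (- |u|^2 / 2).\<close>

lemma prob_integrable_bounded:
  fixes f :: "'a \<Rightarrow> real"
  assumes "prob_space M" "f \<in> borel_measurable M" "\<And>x. x \<in> space M \<Longrightarrow> \<bar>f x\<bar> \<le> C"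
  shows "integrable M f"
proof -
  interpret prob_space M by fact
  show ?thesis
    by (rule integrable_const_bound[of _ C]) (use assms in \<open>auto intro!: AE_I2\<close>)
qed

text \<open>Weighted AM-GM applied pointwise after dividing by the two integrals. If one integral
  vanishes, that function is zero almost everywhere and so is the product.\<close>

lemma Holder_powr_integral:
  fixes X Y :: "'a \<Rightarrow> real"
  assumes a: "0 < a" "a < 1"
    and [measurable]: "integrable M X" "integrable M Y"
    and nn: "\<And>x. x \<in> space M \<Longrightarrow> 0 \<le> X x" "\<And>x. x \<in> space M \<Longrightarrow> 0 \<le> Y x"
  shows "integrable M (\<lambda>x. X x powr a * Y x powr (1 - a))"
    "(\<integral>x. X x powr a * Y x powr (1 - a) \<partial>M) \<le> (\<integral>x. X x \<partial>M) powr a * (\<integral>x. Y x \<partial>M) powr (1 - a)"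
proof -
  have [measurable]: "X \<in> borel_measurable M" "Y \<in> borel_measurable M"
    using assms by auto
  have young: "u powr a * v powr (1 - a) \<le> a * u + (1 - a) * v" if "0 \<le> u" "0 \<le> v" for u v :: real
    using Youngs_inequality_0[of a "1 - a" u v] a that
    by (cases "u = 0 \<or> v = 0") auto
  show int: "integrable M (\<lambda>x. X x powr a * Y x powr (1 - a))"
  proof (rule Bochner_Integration.integrable_bound[of _ "\<lambda>x. a * X x + (1 - a) * Y x"])
    show "AE x in M. norm (X x powr a * Y x powr (1 - a)) \<le> norm (a * X x + (1 - a) * Y x)"
    proof (rule AE_I2)
      fix x assume "x \<in> space M"
      then show "norm (X x powr a * Y x powr (1 - a)) \<le> norm (a * X x + (1 - a) * Y x)"
        using young[of "X x" "Y x"] nn[of x] by (auto simp: abs_mult)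
    qed
  qed (use assms in auto)
  define A where "A = (\<integral>x. X x \<partial>M)"
  define B where "B = (\<integral>x. Y x \<partial>M)"
  have AB: "0 \<le> A" "0 \<le> B" unfolding A_def B_def using nn by (auto intro!: integral_nonneg_AE AE_I2)
  have "(\<integral>x. X x powr a * Y x powr (1 - a) \<partial>M) \<le> A powr a * B powr (1 - a)"
  proof (cases "A = 0 \<or> B = 0")
    case True
    then have "AE x in M. X x powr a * Y x powr (1 - a) = 0"
    proof
      assume "A = 0"
      then have "AE x in M. X x = 0"
        using integral_nonneg_eq_0_iff_AE[of M X] assms nn by (auto simp: A_def intro!: AE_I2)
      then show ?thesis by eventually_elim auto
    next
      assume "B = 0"
      then have "AE x in M. Y x = 0"
        using integral_nonneg_eq_0_iff_AE[of M Y] assms nn by (auto simp: B_def intro!: AE_I2)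
      then show ?thesis by eventually_elim auto
    qed
    then have "(\<integral>x. X x powr a * Y x powr (1 - a) \<partial>M) = 0"
      by (intro integral_eq_zero_AE)
    then show ?thesis by simp
  next
    case False
    then have pos: "0 < A" "0 < B" using AB by auto
    have "(\<integral>x. X x powr a * Y x powr (1 - a) \<partial>M)
        \<le> (\<integral>x. A powr a * B powr (1 - a) * (a * (X x / A) + (1 - a) * (Y x / B)) \<partial>M)"
    proof (rule integral_mono_AE)
      show "AE x in M. X x powr a * Y x powr (1 - a)
          \<le> A powr a * B powr (1 - a) * (a * (X x / A) + (1 - a) * (Y x / B))"
      proof (rule AE_I2)
        fix x assume x: "x \<in> space M"
        have "X x powr a * Y x powr (1 - a) = (A * (X x / A)) powr a * (B * (Y x / B)) powr (1 - a)"
          using pos by simp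
        also have "\<dots> = A powr a * B powr (1 - a) * ((X x / A) powr a * (Y x / B) powr (1 - a))"
          using pos nn[OF x] by (simp add: powr_mult powr_divide)
        also have "\<dots> \<le> A powr a * B powr (1 - a) * (a * (X x / A) + (1 - a) * (Y x / B))"
          by (intro mult_left_mono young) (use pos nn[OF x] in auto)
        finally show "X x powr a * Y x powr (1 - a)
          \<le> A powr a * B powr (1 - a) * (a * (X x / A) + (1 - a) * (Y x / B))" .
      qed
    qed (use assms int in auto)
    also have "\<dots> = A powr a * B powr (1 - a) * (a * (A / A) + (1 - a) * (B / B))"
      using assms by (simp add: A_def B_def)
    also have "\<dots> = A powr a * B powr (1 - a)"
      using pos by simp
    finally show ?thesis .
  qed
  then show "(\<integral>x. X x powr a * Y x powr (1 - a) \<partial>M) \<le> (\<integral>x. X x \<partial>M) powr a * (\<integral>x. Y x \<partial>M) powr (1 - a)"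
    by (simp add: A_def B_def)
qed

section \<open>One-function inequalities for a truncated sub-Gaussian variable\<close>

lemma exp_neg_le_quadratic:
  fixes z :: real
  assumes "\<bar>z\<bar> \<le> 1/4"
  shows "exp (- z) \<le> 1 - z + z\<^sup>2"
proof -
  have "exp (-z) \<le> 1 + (-z) + (-z)\<^sup>2"
  proof (cases "0 \<le> -z")
    case True then show ?thesis using exp_bound[of "-z"] assms by auto
  next
    case False
    then have z: "0 < z" by simp
    have "exp z * (1 - z + z\<^sup>2) \<ge> (1 + z) * (1 - z + z\<^sup>2)"
    proof (rule mult_right_mono)
      show "0 \<le> 1 - z + z\<^sup>2" using assms z by (intro add_nonneg_nonneg) auto
    qed (rule exp_ge_add_one_self)
    also have "(1 + z) * (1 - z + z\<^sup>2) = 1 + z ^ 3" by (simp add: power2_eq_square power3_eq_cube algebra_simps)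
    finally have "1 \<le> exp z * (1 - z + z\<^sup>2)" using z by (smt (verit) zero_less_power)
    then show ?thesis by (simp add: exp_minus field_simps)
  qed
  then show ?thesis by simp
qed

text \<open>Collects what the inequalities use of a truncated Gaussian: a sub-Gaussian moment
  generating function and a bounded exponential moment of the square. The bound
  \<open>\<rho> * B\<^sup>2 \<le> 1/16\<close> keeps the factor 1 - \<rho> * \<xi> x * \<xi> y
  within 1/16 of 1 and makes second-order expansions of the exponential tilts legitimate.\<close>

locale truncated_subgaussian = prob_space M for M :: "'a measure" +
  fixes \<xi> :: "'a \<Rightarrow> real" and \<rho> B :: real
  assumes meas_xi [measurable]: "\<xi> \<in> borel_measurable M"
    and rho_pos: "0 < \<rho>" and rho_lt: "\<rho> \<le> 1/16"
    and xi_bound: "\<And>x. \<bar>\<xi> x\<bar> \<le> B"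
    and rho_B: "\<rho> * B\<^sup>2 \<le> 1/16"
    and mgf: "\<And>t. (\<integral>x. exp (t * \<xi> x) \<partial>M) \<le> exp (t\<^sup>2 / 2)"
    and mgf_sq: "(\<integral>x. exp ((\<xi> x)\<^sup>2 / 4) \<partial>M) \<le> 3/2"
begin

lemma B_nonneg: "0 \<le> B"
  using xi_bound[of undefined] by linarith

lemma xi_sq_le: "(\<xi> x)\<^sup>2 \<le> B\<^sup>2"
  using xi_bound[of x] B_nonneg by (metis abs_ge_zero power2_abs power_mono)

lemma integrable_unit:
  fixes f :: "'a \<Rightarrow> real" and w :: "real \<Rightarrow> real" and C :: real
  assumes [measurable]: "f \<in> borel_measurable M" "w \<in> borel_measurable borel"
    and "\<And>x. 0 \<le> f x \<and> f x \<le> 1" and "\<And>z. \<bar>z\<bar> \<le> B \<Longrightarrow> \<bar>w z\<bar> \<le> C"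
  shows "integrable M (\<lambda>x. w (\<xi> x) * f x)"
proof (rule prob_integrable_bounded[of _ _ C])
  fix x
  have "\<bar>w (\<xi> x)\<bar> * \<bar>f x\<bar> \<le> C * 1"
    by (intro mult_mono) (use assms(3)[of x] assms(4)[OF xi_bound[of x]] in auto)
  then show "\<bar>w (\<xi> x) * f x\<bar> \<le> C" by (simp add: abs_mult)
qed (use prob_space_axioms in auto)

lemma integrable_xi:
  fixes f :: "'a \<Rightarrow> real"
  assumes [measurable]: "f \<in> borel_measurable M" and f: "\<And>x. 0 \<le> f x \<and> f x \<le> 1"
  shows "integrable M f" "integrable M (\<lambda>x. \<xi> x * f x)" "integrable M (\<lambda>x. (\<xi> x)\<^sup>2 * f x)"
    "integrable M (\<lambda>x. exp (t * \<xi> x) * f x)" "integrable M (\<lambda>x. exp (t * (\<xi> x)\<^sup>2) * f x)"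
    "integrable M (\<lambda>x. exp (t * \<xi> x))" "integrable M (\<lambda>x. exp (t * (\<xi> x)\<^sup>2))"
proof -
  note * = integrable_unit[OF assms(1) _ f]
  have e: "\<bar>exp (t * z)\<bar> \<le> exp (\<bar>t\<bar> * B)" if "\<bar>z\<bar> \<le> B" for z
  proof -
    have "t * z \<le> \<bar>t\<bar> * \<bar>z\<bar>" by (metis abs_ge_self abs_mult)
    also have "\<dots> \<le> \<bar>t\<bar> * B" using that by (intro mult_left_mono) auto
    finally show ?thesis by simp
  qed
  have sq: "\<bar>z\<^sup>2\<bar> \<le> B\<^sup>2" if "\<bar>z\<bar> \<le> B" for z
    using that B_nonneg by (metis abs_ge_zero abs_power2 power2_abs power_mono)
  have e2: "\<bar>exp (t * z\<^sup>2)\<bar> \<le> exp (\<bar>t\<bar> * B\<^sup>2)" if "\<bar>z\<bar> \<le> B" for z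
  proof -
    have "t * z\<^sup>2 \<le> \<bar>t\<bar> * \<bar>z\<^sup>2\<bar>" by (metis abs_ge_self abs_mult)
    also have "\<dots> \<le> \<bar>t\<bar> * B\<^sup>2" using sq[OF that] by (intro mult_left_mono) auto
    finally show ?thesis by simp
  qed
  have "integrable M (\<lambda>x. 1 * f x)" by (rule *[where w="\<lambda>_. 1" and C=1]) auto
  then show "integrable M f" by simp
  show "integrable M (\<lambda>x. \<xi> x * f x)" by (rule *[where w="\<lambda>z. z" and C=B]) auto
  show "integrable M (\<lambda>x. (\<xi> x)\<^sup>2 * f x)" by (rule *[where w="\<lambda>z. z\<^sup>2", OF _ sq]) auto
  show "integrable M (\<lambda>x. exp (t * \<xi> x) * f x)"
    by (rule *[where w="\<lambda>z. exp (t * z)", OF _ e]) auto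
  show "integrable M (\<lambda>x. exp (t * (\<xi> x)\<^sup>2) * f x)"
    by (rule *[where w="\<lambda>z. exp (t * z\<^sup>2)", OF _ e2]) auto
  show "integrable M (\<lambda>x. exp (t * \<xi> x))"
    using integrable_unit[of "\<lambda>_. 1" "\<lambda>z. exp (t * z)", OF _ _ _ e] by simp
  show "integrable M (\<lambda>x. exp (t * (\<xi> x)\<^sup>2))"
    using integrable_unit[of "\<lambda>_. 1" "\<lambda>z. exp (t * z\<^sup>2)", OF _ _ _ e2] by simp
qed

lemma moment_bounds:
  fixes f :: "'a \<Rightarrow> real"
  assumes [measurable]: "f \<in> borel_measurable M" and f: "\<And>x. 0 \<le> f x \<and> f x \<le> 1"
  shows "\<bar>\<integral>x. \<xi> x * f x \<partial>M\<bar> \<le> B * (\<integral>x. f x \<partial>M)"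
    "(\<integral>x. (\<xi> x)\<^sup>2 * f x \<partial>M) \<le> B\<^sup>2 * (\<integral>x. f x \<partial>M)"
    "0 \<le> (\<integral>x. (\<xi> x)\<^sup>2 * f x \<partial>M)" "0 \<le> (\<integral>x. f x \<partial>M)"
proof -
  note i = integrable_xi[of f, OF _ f, simplified]
  have "\<bar>\<integral>x. \<xi> x * f x \<partial>M\<bar> \<le> (\<integral>x. \<bar>\<xi> x * f x\<bar> \<partial>M)" by (rule integral_abs_bound)
  also have "\<dots> \<le> (\<integral>x. B * f x \<partial>M)"
    by (intro integral_mono integrable_abs)
      (use i f xi_bound in \<open>auto simp: abs_mult intro!: mult_mono B_nonneg\<close>)
  finally show "\<bar>\<integral>x. \<xi> x * f x \<partial>M\<bar> \<le> B * (\<integral>x. f x \<partial>M)" by simp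
  have "(\<integral>x. (\<xi> x)\<^sup>2 * f x \<partial>M) \<le> (\<integral>x. B\<^sup>2 * f x \<partial>M)"
    by (intro integral_mono) (use i f xi_sq_le in \<open>auto intro!: mult_right_mono\<close>)
  then show "(\<integral>x. (\<xi> x)\<^sup>2 * f x \<partial>M) \<le> B\<^sup>2 * (\<integral>x. f x \<partial>M)" by simp
  show "0 \<le> (\<integral>x. (\<xi> x)\<^sup>2 * f x \<partial>M)" "0 \<le> (\<integral>x. f x \<partial>M)"
    using f by (auto intro!: integral_nonneg_AE AE_I2)
qed

lemma powr_unit: "0 \<le> u \<and> u \<le> 1 \<Longrightarrow> 0 < s \<Longrightarrow> 0 \<le> u powr s \<and> u powr s \<le> (1::real)"
  by (auto intro: powr_le1)

text \<open>Hoelder with the exponential weight of the tilt \<open>\<tau>\<close> that is optimal for Gaussian \<open>\<xi>\<close>.\<close>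

lemma reverse_one_function:
  assumes [measurable]: "f \<in> borel_measurable M" and f: "\<And>x. 0 \<le> f x \<and> f x \<le> 1"
  defines "s \<equiv> 1 + 4 * \<rho>"
  shows "((\<integral>x. f x \<partial>M) powr s)\<^sup>2 + \<rho> * (\<integral>x. \<xi> x * f x powr s \<partial>M)\<^sup>2 \<le> (\<integral>x. f x powr s \<partial>M)\<^sup>2"
proof -
  define k where "k = 4 * \<rho>"
  have k: "0 < k" "s = 1 + k" "k * B\<^sup>2 \<le> 1/4" using rho_pos rho_B by (auto simp: k_def s_def)
  define F where "F x = f x powr s" for x
  have [measurable]: "F \<in> borel_measurable M" unfolding F_def by measurable
  have F: "0 \<le> F x \<and> F x \<le> 1" for x
    unfolding F_def by (rule powr_unit) (use f k in auto)
  define Q where "Q = (\<integral>x. F x \<partial>M)"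
  define m1 where "m1 = (\<integral>x. \<xi> x * F x \<partial>M)"
  define I where "I = (\<integral>x. f x \<partial>M)"
  note iF = integrable_xi[of F, OF _ F, simplified]
  have m1: "\<bar>m1\<bar> \<le> B * Q" and Q0: "0 \<le> Q" and I0: "0 \<le> I"
    using moment_bounds[of F, OF _ F] moment_bounds[of f, OF _ f] by (auto simp: Q_def m1_def I_def)
  \<comment> \<open>The mean of \<open>\<xi>\<close> under the probability with density
    \<open>F\<close> / \<open>Q\<close> (and 0 if \<open>Q\<close> = 0, where \<open>m1\<close>
    vanishes too). A tilt by \<open>\<tau>\<close> = k * m gains about k * m^2 in the first Hoelder
    factor, while the moment generating function costs only k * m^2 / 2 in the second; the surplus
    pays for \<rho> * m1^2.\<close>
  define m where "m = m1 / Q"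
  have mQ: "m * Q = m1" using m1 Q0 by (cases "Q = 0") (auto simp: m_def)
  have mB: "\<bar>m\<bar> \<le> B"
    using m1 Q0 B_nonneg by (cases "Q = 0") (auto simp: m_def field_simps)
  have m2: "m\<^sup>2 \<le> B\<^sup>2" using mB B_nonneg by (metis abs_ge_zero power2_abs power_mono)
  then have km: "k * m\<^sup>2 \<le> 1/4" using k by (smt (verit) mult_left_mono)
  define \<tau> where "\<tau> = k * m"
  define a where "a = 1 / s"
  have a: "0 < a" "a < 1" "1 - a = k / s" "s * a = 1" using k by (auto simp: a_def field_simps)
  have "I = (\<integral>x. (exp (- \<tau> * \<xi> x) * F x) powr a * (exp (\<tau> / k * \<xi> x)) powr (1 - a) \<partial>M)"
  proof -
    have "f x = (exp (- \<tau> * \<xi> x) * F x) powr a * (exp (\<tau> / k * \<xi> x)) powr (1 - a)" for x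
    proof -
      have "F x powr a = f x" unfolding F_def using a f[of x] by (simp add: powr_powr)
      moreover have "exp (- \<tau> * \<xi> x) powr a * (exp (\<tau> / k * \<xi> x)) powr (1 - a) = 1"
      proof -
        have "- \<tau> * \<xi> x * a + \<tau> / k * \<xi> x * (k / s) = 0" using k by (simp add: a_def)
        then show ?thesis unfolding exp_powr_real a(3) exp_add[symmetric] by simp
      qed
      ultimately show ?thesis using F[of x] by (simp add: powr_mult mult_ac)
    qed
    then show ?thesis unfolding I_def by (intro Bochner_Integration.integral_cong refl)
  qed
  also have "\<dots> \<le> (\<integral>x. exp (- \<tau> * \<xi> x) * F x \<partial>M) powr a * (\<integral>x. exp (\<tau> / k * \<xi> x) \<partial>M) powr (1 - a)"
    by (rule Holder_powr_integral) (use a iF(4)[of "-\<tau>"] iF(6)[of "\<tau> / k"] F in auto)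
  also have "\<dots> \<le> (Q * (1 - 3/4 * (k * m\<^sup>2))) powr a * (exp ((\<tau> / k)\<^sup>2 / 2)) powr (1 - a)"
  proof (intro mult_mono powr_mono2)
    have "(\<integral>x. exp (- \<tau> * \<xi> x) * F x \<partial>M) \<le> (\<integral>x. (1 + \<tau>\<^sup>2 * B\<^sup>2) * F x - \<tau> * (\<xi> x * F x) \<partial>M)"
    proof (rule integral_mono)
      fix x
      have "\<bar>\<tau> * \<xi> x\<bar> \<le> k * B * B"
        unfolding \<tau>_def abs_mult using mB xi_bound[of x] k B_nonneg by (intro mult_mono) auto
      then have "exp (- (\<tau> * \<xi> x)) \<le> 1 - \<tau> * \<xi> x + (\<tau> * \<xi> x)\<^sup>2"
        using k(3) by (intro exp_neg_le_quadratic) (simp add: power2_eq_square)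
      also have "(\<tau> * \<xi> x)\<^sup>2 \<le> \<tau>\<^sup>2 * B\<^sup>2"
        unfolding power_mult_distrib by (intro mult_left_mono xi_sq_le) auto
      finally have "exp (- (\<tau> * \<xi> x)) * F x \<le> (1 - \<tau> * \<xi> x + \<tau>\<^sup>2 * B\<^sup>2) * F x"
        using F[of x] by (intro mult_right_mono) auto
      then show "exp (- \<tau> * \<xi> x) * F x \<le> (1 + \<tau>\<^sup>2 * B\<^sup>2) * F x - \<tau> * (\<xi> x * F x)"
        by (simp add: algebra_simps)
    qed (use iF(1,2) iF(4)[of "-\<tau>"] in auto)
    also have "\<dots> = (1 + \<tau>\<^sup>2 * B\<^sup>2) * Q - \<tau> * m1"
      using iF(1,2) by (simp add: Q_def m1_def)
    also have "\<dots> = Q * (1 + k * m\<^sup>2 * (k * B\<^sup>2) - k * m\<^sup>2)"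
      unfolding mQ[symmetric] by (simp add: \<tau>_def power2_eq_square algebra_simps)
    \<comment> \<open>The quadratic error of the tilt is at most a quarter of the linear gain,
      because k * B^2 \<le> 1/4.\<close>
    also have "\<dots> \<le> Q * (1 + k * m\<^sup>2 * (1/4) - k * m\<^sup>2)"
      by (intro mult_left_mono diff_right_mono add_left_mono) (use k Q0 in auto)
    finally show "(\<integral>x. exp (- \<tau> * \<xi> x) * F x \<partial>M) \<le> Q * (1 - 3/4 * (k * m\<^sup>2))"
      by (simp add: algebra_simps)
    show "(\<integral>x. exp (\<tau> / k * \<xi> x) \<partial>M) \<le> exp ((\<tau> / k)\<^sup>2 / 2)" by (rule mgf)
  qed (use a F in \<open>auto intro!: integral_nonneg_AE AE_I2\<close>)
  finally have I1: "I \<le> (Q * (1 - 3/4 * (k * m\<^sup>2))) powr a * (exp ((\<tau> / k)\<^sup>2 / 2)) powr (1 - a)" .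
  have q: "0 \<le> 1 - 3/4 * (k * m\<^sup>2)" using km by auto
  have "I powr s \<le> ((Q * (1 - 3/4 * (k * m\<^sup>2))) powr a * (exp ((\<tau> / k)\<^sup>2 / 2)) powr (1 - a)) powr s"
    by (rule powr_mono2[OF _ I0 I1]) (use k in auto)
  also have "\<dots> = Q * (1 - 3/4 * (k * m\<^sup>2)) * exp (k * m\<^sup>2 / 2)"
  proof -
    have "(1 - a) * s = k" "a * s = 1" using k by (auto simp: a_def field_simps)
    then have "((Q * (1 - 3/4 * (k * m\<^sup>2))) powr a) powr s = Q * (1 - 3/4 * (k * m\<^sup>2))"
      "((exp ((\<tau> / k)\<^sup>2 / 2)) powr (1 - a)) powr s = exp (k * m\<^sup>2 / 2)"
      using q Q0 k by (simp_all only: powr_powr exp_powr_real) (simp_all add: \<tau>_def mult.commute)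
    then show ?thesis by (simp only: powr_mult)
  qed
  also have "\<dots> \<le> Q * exp (- (3/4 * (k * m\<^sup>2))) * exp (k * m\<^sup>2 / 2)"
    using exp_ge_add_one_self[of "- (3/4 * (k * m\<^sup>2))"] Q0 by (intro mult_right_mono mult_left_mono) auto
  also have "\<dots> = Q * exp (- (k * m\<^sup>2 / 4))" by (simp add: exp_add[symmetric])
  finally have "(I powr s)\<^sup>2 \<le> (Q * exp (- (k * m\<^sup>2 / 4)))\<^sup>2"
    by (intro power_mono) auto
  also have "\<dots> = Q\<^sup>2 * exp (- (k * m\<^sup>2 / 2))"
    by (simp add: power_mult_distrib exp_double[symmetric])
  also have "\<dots> \<le> Q\<^sup>2 * (1 - k * m\<^sup>2 / 4)"
  proof (rule mult_left_mono)
    define w where "w = k * m\<^sup>2 / 2"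
    have w: "0 \<le> w" "w \<le> 1/8" using km k by (auto simp: w_def)
    have "exp (- w) \<le> 1 - w + w\<^sup>2" by (rule exp_neg_le_quadratic) (use w in auto)
    also have "w\<^sup>2 \<le> w / 2" using w mult_left_mono[of w "1/2" w] by (simp add: power2_eq_square)
    finally show "exp (- (k * m\<^sup>2 / 2)) \<le> 1 - k * m\<^sup>2 / 4" by (simp add: w_def)
  qed simp
  also have "\<dots> = Q\<^sup>2 - \<rho> * m1\<^sup>2" unfolding mQ[symmetric] by (simp add: k_def power_mult_distrib algebra_simps)
  finally show ?thesis by (simp add: I_def Q_def m1_def F_def)
qed

text \<open>The left side lists the moments that occur in the squared factor 1 - 2 * \<rho> * \<xi>
  x * \<xi> y + \<rho>^2 * (\<xi> x)^2 * (\<xi> y)^2. Hoelder against exp (k * w) with k = 8 *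
  \<rho> is used twice: w = m * \<xi> controls the mean, w = \<xi>^2 / 4 the second moment. The
  error factor has to be 1 + O(\<rho>^2), since it is raised to the power d later.\<close>

lemma forward_one_function:
  assumes [measurable]: "f \<in> borel_measurable M" and f: "\<And>x. 0 \<le> f x \<and> f x \<le> 1"
  defines "\<sigma> \<equiv> 1 - 8 * \<rho>"
  shows "(\<integral>x. f x powr \<sigma> \<partial>M)\<^sup>2 + 2 * \<rho> * (\<integral>x. \<xi> x * f x powr \<sigma> \<partial>M)\<^sup>2
      + \<rho>\<^sup>2 * (\<integral>x. (\<xi> x)\<^sup>2 * f x powr \<sigma> \<partial>M)\<^sup>2
    \<le> (1 + 100 * \<rho>\<^sup>2) * ((\<integral>x. f x \<partial>M) powr \<sigma>)\<^sup>2"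
proof -
  define k where "k = 8 * \<rho>"
  have k: "0 < k" "k \<le> 1/2" "\<sigma> = 1 - k" "k * B\<^sup>2 \<le> 1/2"
    using rho_pos rho_B rho_lt by (auto simp: k_def \<sigma>_def)
  have \<sigma>: "0 < \<sigma>" "\<sigma> < 1" using k by auto
  define F where "F x = f x powr \<sigma>" for x
  have [measurable]: "F \<in> borel_measurable M" unfolding F_def by measurable
  have F: "0 \<le> F x \<and> F x \<le> 1" for x
    unfolding F_def by (rule powr_unit) (use f \<sigma> in auto)
  define Q where "Q = (\<integral>x. F x \<partial>M)"
  define m1 where "m1 = (\<integral>x. \<xi> x * F x \<partial>M)"
  define m2 where "m2 = (\<integral>x. (\<xi> x)\<^sup>2 * F x \<partial>M)"
  define N where "N = (\<integral>x. f x \<partial>M) powr \<sigma>"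
  note iF = integrable_xi[of F, OF _ F, simplified]
  note if' = integrable_xi[of f, OF _ f, simplified]
  have m1: "\<bar>m1\<bar> \<le> B * Q" and m2: "m2 \<le> B\<^sup>2 * Q" "0 \<le> m2" and Q0: "0 \<le> Q" and N0: "0 \<le> N"
    using moment_bounds[of F, OF _ F] by (auto simp: Q_def m1_def m2_def N_def)
  show ?thesis
  proof (cases "Q = 0")
    case True
    then have "m1 = 0" "m2 = 0" using m1 m2 by auto
    then show ?thesis using True by (simp add: Q_def[symmetric] m1_def[symmetric] m2_def[symmetric] F_def[symmetric])
  next
    case False
    then have Qp: "0 < Q" using Q0 by simp
    define m where "m = m1 / Q"
    define v where "v = m2 / Q"
    have m1': "m1 = m * Q" and m2': "m2 = v * Q" using Qp by (auto simp: m_def v_def)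
    have v: "0 \<le> v" "v \<le> B\<^sup>2" using m2 Qp by (auto simp: v_def field_simps)
    have mv: "m\<^sup>2 \<le> v"
    proof -
      have "0 \<le> (\<integral>x. (\<xi> x - m)\<^sup>2 * F x \<partial>M)" using F by (auto intro!: integral_nonneg_AE AE_I2)
      also have "\<dots> = (\<integral>x. (\<xi> x)\<^sup>2 * F x - 2 * m * (\<xi> x * F x) + m\<^sup>2 * F x \<partial>M)"
        by (intro Bochner_Integration.integral_cong) (auto simp: power2_eq_square algebra_simps)
      also have "\<dots> = m2 - 2 * m * m1 + m\<^sup>2 * Q"
        using iF by (simp add: m1_def m2_def Q_def)
      also have "\<dots> = (v - m\<^sup>2) * Q" unfolding m1' m2' by (simp add: power2_eq_square algebra_simps)
      finally show ?thesis using Qp by (simp add: zero_le_mult_iff)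
    qed
    have holder: "(\<integral>x. exp (k * w (\<xi> x)) * F x \<partial>M) \<le> N * (\<integral>x. exp (w (\<xi> x)) \<partial>M) powr k"
      if "integrable M (\<lambda>x. exp (w (\<xi> x)))" for w
    proof -
      have "(\<integral>x. exp (k * w (\<xi> x)) * F x \<partial>M) = (\<integral>x. f x powr \<sigma> * exp (w (\<xi> x)) powr (1 - \<sigma>) \<partial>M)"
        by (intro Bochner_Integration.integral_cong) (auto simp: F_def k(3) exp_powr_real mult_ac)
      also have "\<dots> \<le> (\<integral>x. f x \<partial>M) powr \<sigma> * (\<integral>x. exp (w (\<xi> x)) \<partial>M) powr (1 - \<sigma>)"
        by (rule Holder_powr_integral) (use \<sigma> f if' that in auto)
      finally show ?thesis by (simp add: N_def k(3))
    qed
    define z where "z = k * m\<^sup>2"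
    have z: "0 \<le> z" "z \<le> 1/2"
      using order_trans[OF mult_left_mono[OF order_trans[OF mv v(2)] less_imp_le[OF k(1)]] k(4)] k
      by (auto simp: z_def)
    have linear: "Q * (1 + z) \<le> N * exp (z / 2)"
    proof -
      have "Q * (1 + z) = Q + k * m * m1" by (simp add: z_def m1' power2_eq_square algebra_simps)
      also have "\<dots> = (\<integral>x. F x + k * m * (\<xi> x * F x) \<partial>M)" using iF by (simp add: Q_def m1_def)
      also have "\<dots> \<le> (\<integral>x. exp (k * (m * \<xi> x)) * F x \<partial>M)"
      proof (rule integral_mono)
        fix x
        show "F x + k * m * (\<xi> x * F x) \<le> exp (k * (m * \<xi> x)) * F x"
          using mult_right_mono[OF exp_ge_add_one_self[of "k * (m * \<xi> x)"], of "F x"] F[of x]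
          by (simp add: algebra_simps)
      qed (use iF iF(4)[of "k * m"] in \<open>auto simp: mult.assoc\<close>)
      also have "\<dots> \<le> N * (\<integral>x. exp (m * \<xi> x) \<partial>M) powr k"
        by (rule holder[of "\<lambda>u. m * u"]) (use iF in auto)
      also have "\<dots> \<le> N * exp (m\<^sup>2 / 2) powr k"
        using k N0 by (intro mult_left_mono powr_mono2 mgf) (auto intro!: integral_nonneg_AE AE_I2)
      finally show ?thesis by (simp add: exp_powr_real z_def mult_ac)
    qed
    \<comment> \<open>The choice k = 8 * \<rho> makes z / 4 equal to the required 2 * \<rho> * m^2.
      The gain 1 + z beats the cost exp (z / 2) after squaring, as z \<le> 1/2.\<close>
    have lin2: "Q\<^sup>2 * (1 + 2 * \<rho> * m\<^sup>2) \<le> N\<^sup>2"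
    proof -
      have "(Q * (1 + z))\<^sup>2 \<le> (N * exp (z / 2))\<^sup>2"
        by (rule power_mono[OF linear]) (use Q0 z in auto)
      then have "Q\<^sup>2 * (1 + z)\<^sup>2 \<le> N\<^sup>2 * exp z"
        by (simp add: power_mult_distrib exp_double[symmetric])
      then have "Q\<^sup>2 * ((1 + z)\<^sup>2 * exp (- z)) \<le> N\<^sup>2"
        by (simp add: exp_minus field_simps)
      moreover have "1 + z / 4 \<le> (1 + z)\<^sup>2 * exp (- z)"
      proof -
        have "0 \<le> z * (3/4 - z - z * z)" using z mult_mono[of z "1/2" z "1/2"] by (intro mult_nonneg_nonneg) auto
        then have "1 + z / 4 \<le> (1 + z)\<^sup>2 * (1 - z)" by (simp add: power2_eq_square algebra_simps)
        also have "\<dots> \<le> (1 + z)\<^sup>2 * exp (- z)"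
          using exp_ge_add_one_self[of "- z"] by (intro mult_left_mono) auto
        finally show ?thesis .
      qed
      ultimately have "Q\<^sup>2 * (1 + z / 4) \<le> N\<^sup>2"
        by (meson mult_left_mono order_trans zero_le_power2)
      then show ?thesis by (simp add: z_def k_def mult.assoc)
    qed
    have "Q\<^sup>2 * (1 + 2 * \<rho> * m\<^sup>2 + \<rho>\<^sup>2 * v\<^sup>2) \<le> (1 + 100 * \<rho>\<^sup>2) * N\<^sup>2"
    \<comment> \<open>For v \<le> 10 the quadratic term is at most 100 * \<rho>^2, which is the
      origin of the error factor, and \<open>lin2\<close> takes care of the mean. For v > 10 the
      weight \<xi>^2 / 4 gains y / 4 with y = 8 * \<rho> * v against a cost of k / 2 \<le> y / 20,
      and this gain alone covers both terms.\<close>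
    proof (cases "v \<le> 10")
      case True
      have "v\<^sup>2 \<le> 100" using True v power_mono[of v 10 2] by auto
      then have "\<rho>\<^sup>2 * v\<^sup>2 \<le> \<rho>\<^sup>2 * 100" by (intro mult_left_mono) auto
      moreover have "0 \<le> (2 * \<rho> * m\<^sup>2) * (100 * \<rho>\<^sup>2)" using rho_pos by auto
      ultimately have "1 + 2 * \<rho> * m\<^sup>2 + \<rho>\<^sup>2 * v\<^sup>2 \<le> (1 + 2 * \<rho> * m\<^sup>2) * (1 + 100 * \<rho>\<^sup>2)"
        by (simp add: algebra_simps)
      then have "Q\<^sup>2 * (1 + 2 * \<rho> * m\<^sup>2 + \<rho>\<^sup>2 * v\<^sup>2) \<le> Q\<^sup>2 * ((1 + 2 * \<rho> * m\<^sup>2) * (1 + 100 * \<rho>\<^sup>2))"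
        by (intro mult_left_mono) auto
      also have "\<dots> = (1 + 100 * \<rho>\<^sup>2) * (Q\<^sup>2 * (1 + 2 * \<rho> * m\<^sup>2))" by simp
      also have "\<dots> \<le> (1 + 100 * \<rho>\<^sup>2) * N\<^sup>2" by (intro mult_left_mono lin2) auto
      finally show ?thesis .
    next
      case False
      define y where "y = k * v"
      have y: "0 \<le> y" "y \<le> 1/2" "k / 2 \<le> y / 20"
        using order_trans[OF mult_left_mono[OF v(2) less_imp_le[OF k(1)]] k(4)] k v False
        by (auto simp: y_def)
      have "Q * (1 + y / 4) = Q + k / 4 * m2" by (simp add: y_def m2' algebra_simps)
      also have "\<dots> = (\<integral>x. F x + k / 4 * ((\<xi> x)\<^sup>2 * F x) \<partial>M)" using iF by (simp add: Q_def m2_def)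
      also have "\<dots> \<le> (\<integral>x. exp (k * (1/4 * (\<xi> x)\<^sup>2)) * F x \<partial>M)"
      proof (rule integral_mono)
        fix x
        show "F x + k / 4 * ((\<xi> x)\<^sup>2 * F x) \<le> exp (k * (1/4 * (\<xi> x)\<^sup>2)) * F x"
          using mult_right_mono[OF exp_ge_add_one_self[of "k * (1/4 * (\<xi> x)\<^sup>2)"], of "F x"] F[of x]
          by (simp add: algebra_simps)
      qed (use iF iF(5)[of "k/4"] in auto)
      also have "\<dots> \<le> N * (\<integral>x. exp (1/4 * (\<xi> x)\<^sup>2) \<partial>M) powr k"
        by (rule holder[of "\<lambda>u. 1/4 * u\<^sup>2"]) (use iF(7)[of "1/4"] in auto)
      also have "\<dots> \<le> N * (exp (1/2)) powr k"
      proof (intro mult_left_mono powr_mono2)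
        show "(\<integral>x. exp (1/4 * (\<xi> x)\<^sup>2) \<partial>M) \<le> exp (1/2)"
          using mgf_sq exp_ge_add_one_self[of "1/2::real"] by simp
      qed (use k N0 in \<open>auto intro!: integral_nonneg_AE AE_I2\<close>)
      also have "\<dots> \<le> N * exp (y / 20)" using N0 y by (intro mult_left_mono) (auto simp: exp_powr_real)
      finally have "(Q * (1 + y / 4))\<^sup>2 \<le> (N * exp (y / 20))\<^sup>2"
        by (intro power_mono) (use Q0 y in auto)
      then have "Q\<^sup>2 * (1 + y / 4)\<^sup>2 \<le> N\<^sup>2 * exp (y / 10)"
        by (simp add: power_mult_distrib exp_double[symmetric])
      then have "Q\<^sup>2 * ((1 + y / 4)\<^sup>2 * exp (- (y / 10))) \<le> N\<^sup>2"
        by (simp add: exp_minus field_simps)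
      moreover have "1 + 3 * y / 8 \<le> (1 + y / 4)\<^sup>2 * exp (- (y / 10))"
      proof -
        have "0 \<le> y * (1/40 + y / 80 - y * y / 160)"
          using y mult_mono[of y "1/2" y "1/2"] by (intro mult_nonneg_nonneg) auto
        moreover have "(1 + y / 4)\<^sup>2 * (1 - y / 10) - (1 + 3 * y / 8) = y * (1/40 + y / 80 - y * y / 160)"
          by (simp add: power2_eq_square field_simps)
        ultimately have "1 + 3 * y / 8 \<le> (1 + y / 4)\<^sup>2 * (1 - y / 10)" by linarith
        also have "\<dots> \<le> (1 + y / 4)\<^sup>2 * exp (- (y / 10))"
          using exp_ge_add_one_self[of "- (y / 10)"] by (intro mult_left_mono) auto
        finally show ?thesis .
      qed
      ultimately have "Q\<^sup>2 * (1 + 3 * y / 8) \<le> N\<^sup>2"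
        by (meson mult_left_mono order_trans zero_le_power2)
      \<comment> \<open>Here 3 * y / 8 = 3 * \<rho> * v. Two units go to the mean, since m^2 \<le>
        v, and one to the square, since \<rho> * v \<le> 1.\<close>
      moreover have "1 + 2 * \<rho> * m\<^sup>2 + \<rho>\<^sup>2 * v\<^sup>2 \<le> 1 + 3 * y / 8"
      proof -
        have "\<rho> * v \<le> 1/16" using v rho_B rho_pos by (smt (verit) mult_left_mono)
        then have "(\<rho> * v) * (\<rho> * v) \<le> (\<rho> * v) * 1" using rho_pos v by (intro mult_left_mono) auto
        moreover have "\<rho> * m\<^sup>2 \<le> \<rho> * v" using mv rho_pos by (intro mult_left_mono) auto
        ultimately show ?thesis by (simp add: y_def k_def power2_eq_square algebra_simps)
      qed
      ultimately have "Q\<^sup>2 * (1 + 2 * \<rho> * m\<^sup>2 + \<rho>\<^sup>2 * v\<^sup>2) \<le> N\<^sup>2"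
        by (meson mult_left_mono order_trans zero_le_power2)
      also have "N\<^sup>2 \<le> (1 + 100 * \<rho>\<^sup>2) * N\<^sup>2" by (simp add: algebra_simps)
      finally show ?thesis .
    qed
    then have "Q\<^sup>2 + 2 * \<rho> * m1\<^sup>2 + \<rho>\<^sup>2 * m2\<^sup>2 \<le> (1 + 100 * \<rho>\<^sup>2) * N\<^sup>2"
      unfolding m1' m2' by (simp add: algebra_simps power_mult_distrib)
    then show ?thesis by (simp add: Q_def m1_def m2_def F_def N_def)
  qed
qed

end

section \<open>From one function to two, and from one coordinate to products\<close>

lemma dot3_le:
  fixes a b c P :: real
  assumes "a\<^sup>2 + b\<^sup>2 + c\<^sup>2 \<le> P\<^sup>2" "a'\<^sup>2 + b'\<^sup>2 + c'\<^sup>2 \<le> P'\<^sup>2" "0 \<le> P" "0 \<le> P'"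
  shows "a * a' + b * b' + c * c' \<le> P * P'"
proof (rule power2_le_imp_le)
  have "(a * a' + b * b' + c * c')\<^sup>2 + (a * b' - b * a')\<^sup>2 + (a * c' - c * a')\<^sup>2 + (b * c' - c * b')\<^sup>2
      = (a\<^sup>2 + b\<^sup>2 + c\<^sup>2) * (a'\<^sup>2 + b'\<^sup>2 + c'\<^sup>2)"
    by (simp add: power2_eq_square algebra_simps)
  then have "(a * a' + b * b' + c * c')\<^sup>2 \<le> (a\<^sup>2 + b\<^sup>2 + c\<^sup>2) * (a'\<^sup>2 + b'\<^sup>2 + c'\<^sup>2)"
    by (smt (verit) zero_le_power2)
  also have "\<dots> \<le> P\<^sup>2 * P'\<^sup>2" by (intro mult_mono assms) auto
  finally show "(a * a' + b * b' + c * c')\<^sup>2 \<le> (P * P')\<^sup>2" by (simp add: power_mult_distrib)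
qed (use assms in auto)

text \<open>Splits coordinate i off both variables and moves its two integrals innermost, so that a
  one-coordinate inequality can be applied with all other coordinates frozen. Nonnegative integrals
  spare every integrability condition in the induction.\<close>

lemma (in product_sigma_finite) nn_integral_PiM_insert_pair:
  assumes I: "finite I" "i \<notin> I"
    and [measurable]: "(\<lambda>(x, y). \<Phi> x y) \<in> borel_measurable (PiM (insert i I) M \<Otimes>\<^sub>M PiM (insert i I) M)"
  shows "(\<integral>\<^sup>+x. \<integral>\<^sup>+y. \<Phi> x y \<partial>PiM (insert i I) M \<partial>PiM (insert i I) M)
    = (\<integral>\<^sup>+x. \<integral>\<^sup>+y. \<integral>\<^sup>+u. \<integral>\<^sup>+v. \<Phi> (x(i := u)) (y(i := v)) \<partial>M i \<partial>M i \<partial>PiM I M \<partial>PiM I M)"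
proof -
  interpret I: finite_product_sigma_finite M I by standard fact
  interpret J: finite_product_sigma_finite M "insert i I" by standard (use I in auto)
  interpret P: pair_sigma_finite "PiM I M" "M i"
    by (simp add: pair_sigma_finite_def I.sigma_finite_measure_axioms sigma_finite_measures)
  have "(\<integral>\<^sup>+x. \<integral>\<^sup>+y. \<Phi> x y \<partial>PiM (insert i I) M \<partial>PiM (insert i I) M)
      = (\<integral>\<^sup>+x. \<integral>\<^sup>+u. \<integral>\<^sup>+y. \<Phi> (x(i := u)) y \<partial>PiM (insert i I) M \<partial>M i \<partial>PiM I M)"
    by (rule product_nn_integral_insert[OF I]) measurable
  also have "\<dots> = (\<integral>\<^sup>+x. \<integral>\<^sup>+u. \<integral>\<^sup>+y. \<integral>\<^sup>+v. \<Phi> (x(i := u)) (y(i := v)) \<partial>M i \<partial>PiM I M \<partial>M i \<partial>PiM I M)"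
  proof (intro nn_integral_cong)
    fix x u assume x: "x \<in> space (PiM I M)" "u \<in> space (M i)"
    then have xu: "x(i := u) \<in> space (PiM (insert i I) M)" by (auto simp: space_PiM PiE_def extensional_def)
    show "(\<integral>\<^sup>+y. \<Phi> (x(i := u)) y \<partial>PiM (insert i I) M) = (\<integral>\<^sup>+y. \<integral>\<^sup>+v. \<Phi> (x(i := u)) (y(i := v)) \<partial>M i \<partial>PiM I M)"
      by (rule product_nn_integral_insert[OF I])
        (use measurable_Pair2[OF assms(3) xu] in simp)
  qed
  also have "\<dots> = (\<integral>\<^sup>+x. \<integral>\<^sup>+y. \<integral>\<^sup>+u. \<integral>\<^sup>+v. \<Phi> (x(i := u)) (y(i := v)) \<partial>M i \<partial>M i \<partial>PiM I M \<partial>PiM I M)"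
  proof (intro nn_integral_cong)
    fix x assume x: "x \<in> space (PiM I M)"
    have [measurable]: "(\<lambda>u. x(i := u)) \<in> measurable (M i) (PiM (insert i I) M)"
      using x by measurable
    have [measurable]: "(\<lambda>w. (snd w)(i := fst w)) \<in> measurable (M i \<Otimes>\<^sub>M PiM I M) (PiM (insert i I) M)"
      by measurable
    have m: "(\<lambda>(y, u). \<integral>\<^sup>+v. \<Phi> (x(i := u)) (y(i := v)) \<partial>M i) \<in> borel_measurable (PiM I M \<Otimes>\<^sub>M M i)"
    proof -
      have "(\<lambda>w. \<Phi> (x(i := snd (fst w))) ((fst (fst w))(i := snd w))) \<in> borel_measurable ((PiM I M \<Otimes>\<^sub>M M i) \<Otimes>\<^sub>M M i)"
        by (rule measurable_compose[OF _ assms(3), of "\<lambda>w. (x(i := snd (fst w)), (fst (fst w))(i := snd w))", simplified])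
          measurable
      then show ?thesis
        unfolding split_beta'
        by (intro sigma_finite_measure.borel_measurable_nn_integral[OF sigma_finite_measures]) (simp add: split_beta')
    qed
    show "(\<integral>\<^sup>+u. \<integral>\<^sup>+y. \<integral>\<^sup>+v. \<Phi> (x(i := u)) (y(i := v)) \<partial>M i \<partial>PiM I M \<partial>M i)
       = (\<integral>\<^sup>+y. \<integral>\<^sup>+u. \<integral>\<^sup>+v. \<Phi> (x(i := u)) (y(i := v)) \<partial>M i \<partial>M i \<partial>PiM I M)"
      by (rule P.Fubini'[OF m])
  qed
  finally show ?thesis .
qed

lemma (in sigma_finite_measure) nn_integral_pair_multc:
  assumes [measurable]: "(\<lambda>w. \<Phi> (fst w) (snd w)) \<in> borel_measurable (M \<Otimes>\<^sub>M M)"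
  shows "(\<integral>\<^sup>+x. \<integral>\<^sup>+y. \<Phi> x y * c \<partial>M \<partial>M) = (\<integral>\<^sup>+x. \<integral>\<^sup>+y. \<Phi> x y \<partial>M \<partial>M) * c"
proof -
  have m: "(\<lambda>x. \<integral>\<^sup>+y. \<Phi> x y \<partial>M) \<in> borel_measurable M"
    using borel_measurable_nn_integral[of "\<lambda>x y. \<Phi> x y" M] by (simp add: split_beta')
  have "(\<integral>\<^sup>+x. \<integral>\<^sup>+y. \<Phi> x y * c \<partial>M \<partial>M) = (\<integral>\<^sup>+x. (\<integral>\<^sup>+y. \<Phi> x y \<partial>M) * c \<partial>M)"
  proof (intro nn_integral_cong nn_integral_multc)
    fix x assume "x \<in> space M"
    then show "\<Phi> x \<in> borel_measurable M"
      using measurable_Pair2[OF assms, of x] by simp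
  qed
  also have "\<dots> = (\<integral>\<^sup>+x. \<integral>\<^sup>+y. \<Phi> x y \<partial>M \<partial>M) * c" by (rule nn_integral_multc[OF m])
  finally show ?thesis .
qed

context truncated_subgaussian
begin

text \<open>To first order the Mehler kernel of correlation -\<rho>: pairs with a negative product
  get more weight.\<close>

definition kern :: "'a \<Rightarrow> 'a \<Rightarrow> real" where "kern x y = 1 - \<rho> * \<xi> x * \<xi> y"

lemma measurable_kern [measurable (raw)]:
  assumes [measurable]: "a \<in> measurable N M" "b \<in> measurable N M"
  shows "(\<lambda>w. kern (a w) (b w)) \<in> borel_measurable N"
  unfolding kern_def by measurable

lemma kern_bounds: "15/16 \<le> kern x y" "kern x y \<le> 17/16"
proof -
  have "\<bar>\<rho> * \<xi> x * \<xi> y\<bar> = \<rho> * (\<bar>\<xi> x\<bar> * \<bar>\<xi> y\<bar>)" using rho_pos by (simp add: abs_mult)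
  also have "\<dots> \<le> \<rho> * (B * B)"
    using rho_pos xi_bound B_nonneg by (intro mult_left_mono mult_mono) auto
  finally have "\<bar>\<rho> * \<xi> x * \<xi> y\<bar> \<le> 1/16" using rho_B by (simp add: power2_eq_square)
  then show "15/16 \<le> kern x y" "kern x y \<le> 17/16" unfolding kern_def by auto
qed

lemma kern_nonneg [simp]: "0 \<le> kern x y" using kern_bounds(1)[of x y] by simp

text \<open>The kernel and its square are finite sums of products of a function of x and a function
  of y, so the double integrals are bilinear in the moments of orders 0, 1 and 2.\<close>

lemma kern_integral:
  fixes F G :: "'a \<Rightarrow> real"
  assumes [measurable]: "F \<in> borel_measurable M" "G \<in> borel_measurable M"
    and F: "\<And>x. 0 \<le> F x \<and> F x \<le> 1" and G: "\<And>x. 0 \<le> G x \<and> G x \<le> 1"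
  shows "(\<integral>\<^sup>+x. \<integral>\<^sup>+y. ennreal (F x * G y * kern x y) \<partial>M \<partial>M)
    = ennreal ((\<integral>x. F x \<partial>M) * (\<integral>x. G x \<partial>M) - \<rho> * (\<integral>x. \<xi> x * F x \<partial>M) * (\<integral>x. \<xi> x * G x \<partial>M))"
    "(\<integral>\<^sup>+x. \<integral>\<^sup>+y. ennreal (F x * G y * (kern x y)\<^sup>2) \<partial>M \<partial>M)
    = ennreal ((\<integral>x. F x \<partial>M) * (\<integral>x. G x \<partial>M) - 2 * \<rho> * (\<integral>x. \<xi> x * F x \<partial>M) * (\<integral>x. \<xi> x * G x \<partial>M)
        + \<rho>\<^sup>2 * (\<integral>x. (\<xi> x)\<^sup>2 * F x \<partial>M) * (\<integral>x. (\<xi> x)\<^sup>2 * G x \<partial>M))"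
proof -
  note iF = integrable_xi[of F, OF _ F, simplified] and iG = integrable_xi[of G, OF _ G, simplified]
  have nn: "0 \<le> F x * G y * kern x y" for x y using F[of x] G[of y] by simp
  have eq: "F x * G y * kern x y = F x * G y - \<rho> * \<xi> x * F x * (\<xi> y * G y)" for x y
    by (simp add: kern_def algebra_simps)
  have i1: "integrable M (\<lambda>y. F x * G y * kern x y)" for x
    unfolding eq by (intro Bochner_Integration.integrable_diff integrable_mult_right iG)
  have e1: "(\<integral>y. F x * G y * kern x y \<partial>M)
      = F x * (\<integral>x. G x \<partial>M) - \<rho> * (\<integral>x. \<xi> x * G x \<partial>M) * (\<xi> x * F x)" for x
    unfolding eq using iG by simp
  have i2: "integrable M (\<lambda>x. \<integral>y. F x * G y * kern x y \<partial>M)"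
    unfolding e1 by (intro Bochner_Integration.integrable_diff integrable_mult_right integrable_mult_left iF)
  have "(\<integral>\<^sup>+x. \<integral>\<^sup>+y. ennreal (F x * G y * kern x y) \<partial>M \<partial>M)
      = (\<integral>\<^sup>+x. ennreal (\<integral>y. F x * G y * kern x y \<partial>M) \<partial>M)"
    by (intro nn_integral_cong nn_integral_eq_integral[OF i1] AE_I2 nn)
  also have "\<dots> = ennreal (\<integral>x. (\<integral>y. F x * G y * kern x y \<partial>M) \<partial>M)"
    by (intro nn_integral_eq_integral[OF i2] AE_I2 integral_nonneg_AE nn)
  finally have eq1: "(\<integral>\<^sup>+x. \<integral>\<^sup>+y. ennreal (F x * G y * kern x y) \<partial>M \<partial>M)
      = ennreal (\<integral>x. (\<integral>y. F x * G y * kern x y \<partial>M) \<partial>M)" .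
  show "(\<integral>\<^sup>+x. \<integral>\<^sup>+y. ennreal (F x * G y * kern x y) \<partial>M \<partial>M)
    = ennreal ((\<integral>x. F x \<partial>M) * (\<integral>x. G x \<partial>M) - \<rho> * (\<integral>x. \<xi> x * F x \<partial>M) * (\<integral>x. \<xi> x * G x \<partial>M))"
  proof -
    have "(\<integral>x. (\<integral>y. F x * G y * kern x y \<partial>M) \<partial>M)
      = (\<integral>x. F x \<partial>M) * (\<integral>x. G x \<partial>M) - \<rho> * (\<integral>x. \<xi> x * G x \<partial>M) * (\<integral>x. \<xi> x * F x \<partial>M)"
      unfolding e1 using iF by simp
    then show ?thesis unfolding eq1 by (simp add: mult.commute mult.left_commute)
  qed
  have nn: "0 \<le> F x * G y * (kern x y)\<^sup>2" for x y using F[of x] G[of y] by simp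
  have eq: "F x * G y * (kern x y)\<^sup>2 = F x * G y - 2 * \<rho> * \<xi> x * F x * (\<xi> y * G y)
      + \<rho>\<^sup>2 * (\<xi> x)\<^sup>2 * F x * ((\<xi> y)\<^sup>2 * G y)" for x y
    by (simp add: kern_def power2_eq_square algebra_simps)
  have i1: "integrable M (\<lambda>y. F x * G y * (kern x y)\<^sup>2)" for x
    unfolding eq
    by (intro Bochner_Integration.integrable_diff Bochner_Integration.integrable_add integrable_mult_right iG)
  have e1: "(\<integral>y. F x * G y * (kern x y)\<^sup>2 \<partial>M)
      = F x * (\<integral>x. G x \<partial>M) - 2 * \<rho> * (\<integral>x. \<xi> x * G x \<partial>M) * (\<xi> x * F x)
        + \<rho>\<^sup>2 * (\<integral>x. (\<xi> x)\<^sup>2 * G x \<partial>M) * ((\<xi> x)\<^sup>2 * F x)" for x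
    unfolding eq using iG by simp
  have i2: "integrable M (\<lambda>x. \<integral>y. F x * G y * (kern x y)\<^sup>2 \<partial>M)"
    unfolding e1
    by (intro Bochner_Integration.integrable_diff Bochner_Integration.integrable_add integrable_mult_right integrable_mult_left iF)
  have "(\<integral>\<^sup>+x. \<integral>\<^sup>+y. ennreal (F x * G y * (kern x y)\<^sup>2) \<partial>M \<partial>M)
      = (\<integral>\<^sup>+x. ennreal (\<integral>y. F x * G y * (kern x y)\<^sup>2 \<partial>M) \<partial>M)"
    by (intro nn_integral_cong nn_integral_eq_integral[OF i1] AE_I2 nn)
  also have "\<dots> = ennreal (\<integral>x. (\<integral>y. F x * G y * (kern x y)\<^sup>2 \<partial>M) \<partial>M)"
    by (intro nn_integral_eq_integral[OF i2] AE_I2 integral_nonneg_AE nn)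
  finally have eq1: "(\<integral>\<^sup>+x. \<integral>\<^sup>+y. ennreal (F x * G y * (kern x y)\<^sup>2) \<partial>M \<partial>M)
      = ennreal (\<integral>x. (\<integral>y. F x * G y * (kern x y)\<^sup>2 \<partial>M) \<partial>M)" .
  show "(\<integral>\<^sup>+x. \<integral>\<^sup>+y. ennreal (F x * G y * (kern x y)\<^sup>2) \<partial>M \<partial>M)
    = ennreal ((\<integral>x. F x \<partial>M) * (\<integral>x. G x \<partial>M) - 2 * \<rho> * (\<integral>x. \<xi> x * F x \<partial>M) * (\<integral>x. \<xi> x * G x \<partial>M)
        + \<rho>\<^sup>2 * (\<integral>x. (\<xi> x)\<^sup>2 * F x \<partial>M) * (\<integral>x. (\<xi> x)\<^sup>2 * G x \<partial>M))"
  proof -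
    have "(\<integral>x. (\<integral>y. F x * G y * (kern x y)\<^sup>2 \<partial>M) \<partial>M)
      = (\<integral>x. F x \<partial>M) * (\<integral>x. G x \<partial>M) - 2 * \<rho> * (\<integral>x. \<xi> x * G x \<partial>M) * (\<integral>x. \<xi> x * F x \<partial>M)
        + \<rho>\<^sup>2 * (\<integral>x. (\<xi> x)\<^sup>2 * G x \<partial>M) * (\<integral>x. (\<xi> x)\<^sup>2 * F x \<partial>M)"
      unfolding e1 using iF by simp
    then show ?thesis unfolding eq1 by (simp add: mult.commute mult.left_commute)
  qed
qed

text \<open>The one-function inequality says that the vector (I, sqrt \<rho> * m) has length at most
  Q. Cauchy-Schwarz for the vectors of f and g then gives I * I' + \<rho> * m * m' \<le> Q * Q',
  whatever the signs of m and m'.\<close>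

lemma reverse_two_functions:
  fixes f g :: "'a \<Rightarrow> real"
  assumes [measurable]: "f \<in> borel_measurable M" "g \<in> borel_measurable M"
    and f: "\<And>x. 0 \<le> f x \<and> f x \<le> 1" and g: "\<And>x. 0 \<le> g x \<and> g x \<le> 1"
    and s: "s = 1 + 4 * \<rho>"
  shows "ennreal ((\<integral>x. f x \<partial>M) powr s * (\<integral>x. g x \<partial>M) powr s)
    \<le> (\<integral>\<^sup>+x. \<integral>\<^sup>+y. ennreal (f x powr s * g y powr s * kern x y) \<partial>M \<partial>M)"
proof -
  have s0: "0 < s" using s rho_pos by simp
  have F: "0 \<le> f x powr s \<and> f x powr s \<le> 1" and G: "0 \<le> g x powr s \<and> g x powr s \<le> 1" for x
    using powr_unit[OF f s0] powr_unit[OF g s0] by auto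
  define r where "r = sqrt \<rho>"
  have r: "r * r = \<rho>" using rho_pos by (simp add: r_def)
  define Q Q' where "Q = (\<integral>x. f x powr s \<partial>M)" and "Q' = (\<integral>x. g x powr s \<partial>M)"
  define m m' where "m = (\<integral>x. \<xi> x * f x powr s \<partial>M)" and "m' = (\<integral>x. \<xi> x * g x powr s \<partial>M)"
  define I I' where "I = (\<integral>x. f x \<partial>M) powr s" and "I' = (\<integral>x. g x \<partial>M) powr s"
  have "I\<^sup>2 + (r * m)\<^sup>2 + 0\<^sup>2 \<le> Q\<^sup>2" "I'\<^sup>2 + (r * m')\<^sup>2 + 0\<^sup>2 \<le> Q'\<^sup>2"
    using reverse_one_function[of f, OF _ f] reverse_one_function[of g, OF _ g]
    by (simp_all add: I_def I'_def Q_def Q'_def m_def m'_def s r power_mult_distrib power2_eq_square[of r])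
  then have "I * I' + (r * m) * (r * m') + 0 * 0 \<le> Q * Q'"
    by (rule dot3_le) (auto simp: Q_def Q'_def intro!: integral_nonneg_AE)
  also have "(r * m) * (r * m') = \<rho> * m * m'" by (simp add: r[symmetric])
  finally show ?thesis
    by (subst kern_integral) (use F G in \<open>auto simp: I_def I'_def Q_def Q'_def m_def m'_def intro!: ennreal_leI\<close>)
qed

text \<open>Cauchy-Schwarz again, now with three components. Negating the middle component of one
  vector produces the minus sign of the mixed term.\<close>

lemma forward_two_functions:
  fixes f g :: "'a \<Rightarrow> real"
  assumes [measurable]: "f \<in> borel_measurable M" "g \<in> borel_measurable M"
    and f: "\<And>x. 0 \<le> f x \<and> f x \<le> 1" and g: "\<And>x. 0 \<le> g x \<and> g x \<le> 1"
    and s: "s = 1 - 8 * \<rho>"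
  shows "(\<integral>\<^sup>+x. \<integral>\<^sup>+y. ennreal (f x powr s * g y powr s * (kern x y)\<^sup>2) \<partial>M \<partial>M)
    \<le> ennreal ((1 + 100 * \<rho>\<^sup>2) * ((\<integral>x. f x \<partial>M) powr s * (\<integral>x. g x \<partial>M) powr s))"
proof -
  have s0: "0 < s" using s rho_lt by simp
  have F: "0 \<le> f x powr s \<and> f x powr s \<le> 1" and G: "0 \<le> g x powr s \<and> g x powr s \<le> 1" for x
    using powr_unit[OF f s0] powr_unit[OF g s0] by auto
  define r where "r = sqrt (2 * \<rho>)"
  have r: "r * r = 2 * \<rho>" using rho_pos by (simp add: r_def)
  define c where "c = sqrt (1 + 100 * \<rho>\<^sup>2)"
  have c: "c * c = 1 + 100 * \<rho>\<^sup>2" "0 \<le> c" by (simp_all add: c_def)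
  define Q Q' where "Q = (\<integral>x. f x powr s \<partial>M)" and "Q' = (\<integral>x. g x powr s \<partial>M)"
  define m m' where "m = (\<integral>x. \<xi> x * f x powr s \<partial>M)" and "m' = (\<integral>x. \<xi> x * g x powr s \<partial>M)"
  define v v' where "v = (\<integral>x. (\<xi> x)\<^sup>2 * f x powr s \<partial>M)" and "v' = (\<integral>x. (\<xi> x)\<^sup>2 * g x powr s \<partial>M)"
  define I I' where "I = (\<integral>x. f x \<partial>M) powr s" and "I' = (\<integral>x. g x \<partial>M) powr s"
  have "Q\<^sup>2 + (- r * m)\<^sup>2 + (\<rho> * v)\<^sup>2 \<le> (c * I)\<^sup>2" "Q'\<^sup>2 + (r * m')\<^sup>2 + (\<rho> * v')\<^sup>2 \<le> (c * I')\<^sup>2"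
    using forward_one_function[of f, OF _ f] forward_one_function[of g, OF _ g]
    by (simp_all add: I_def I'_def Q_def Q'_def m_def m'_def v_def v'_def s r c power_mult_distrib
       power2_eq_square[of r] power2_eq_square[of c])
  then have "Q * Q' + (- r * m) * (r * m') + (\<rho> * v) * (\<rho> * v') \<le> (c * I) * (c * I')"
    by (rule dot3_le) (use c in \<open>auto simp: I_def I'_def\<close>)
  also have "(- r * m) * (r * m') = - (2 * \<rho> * m * m')" by (simp add: r[symmetric])
  also have "(c * I) * (c * I') = (1 + 100 * \<rho>\<^sup>2) * (I * I')" by (simp add: c(1)[symmetric])
  finally have "Q * Q' - 2 * \<rho> * m * m' + \<rho>\<^sup>2 * v * v' \<le> (1 + 100 * \<rho>\<^sup>2) * (I * I')"
    by (simp add: power2_eq_square mult_ac)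
  then show ?thesis
    by (subst kern_integral) (use F G in \<open>auto simp: I_def I'_def Q_def Q'_def m_def m'_def v_def v'_def intro!: ennreal_leI\<close>)
qed

lemma expectation_unit:
  fixes f :: "'a \<Rightarrow> real"
  assumes "\<And>x. 0 \<le> f x \<and> f x \<le> 1"
  shows "0 \<le> (\<integral>x. f x \<partial>M) \<and> (\<integral>x. f x \<partial>M) \<le> 1"
proof
  show "0 \<le> (\<integral>x. f x \<partial>M)" using assms by (auto intro!: integral_nonneg_AE)
  show "(\<integral>x. f x \<partial>M) \<le> 1"
  proof (cases "integrable M f")
    case True
    then show ?thesis using integral_le_const[of f 1] assms by auto
  qed (simp add: not_integrable_integral_eq)
qed

end

sublocale truncated_subgaussian \<subseteq> P: product_sigma_finite "\<lambda>_ :: nat. M"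
  by standard

context truncated_subgaussian
begin

definition pkern :: "nat set \<Rightarrow> (nat \<Rightarrow> 'a) \<Rightarrow> (nat \<Rightarrow> 'a) \<Rightarrow> real" where
  "pkern I x y = (\<Prod>k\<in>I. kern (x k) (y k))"

lemma pkern_nonneg [simp]: "0 \<le> pkern I x y"
  unfolding pkern_def by (intro prod_nonneg) auto

lemma pkern_insert:
  assumes "finite I" "i \<notin> I"
  shows "pkern (insert i I) (x(i := u)) (y(i := v)) = kern u v * pkern I x y"
proof -
  have "(\<Prod>k\<in>I. kern ((x(i := u)) k) ((y(i := v)) k)) = (\<Prod>k\<in>I. kern (x k) (y k))"
    by (rule prod.cong) (use assms in auto)
  then show ?thesis unfolding pkern_def using assms by simp
qed

lemma measurable_pkern [measurable (raw)]:
  assumes [measurable]: "a \<in> measurable N (PiM I (\<lambda>_. M))" "b \<in> measurable N (PiM I (\<lambda>_. M))"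
  shows "(\<lambda>w. pkern I (a w) (b w)) \<in> borel_measurable N"
  unfolding pkern_def by measurable

lemma marginal:
  fixes f :: "(nat \<Rightarrow> 'a) \<Rightarrow> real"
  assumes I: "finite I" "i \<notin> I"
    and [measurable]: "f \<in> borel_measurable (PiM (insert i I) (\<lambda>_. M))"
    and f: "\<And>x. 0 \<le> f x \<and> f x \<le> 1"
  shows "(\<lambda>x. \<integral>u. f (x(i := u)) \<partial>M) \<in> borel_measurable (PiM I (\<lambda>_. M))"
    "(\<integral>x. (\<integral>u. f (x(i := u)) \<partial>M) \<partial>PiM I (\<lambda>_. M)) = (\<integral>x. f x \<partial>PiM (insert i I) (\<lambda>_. M))"
proof -
  show "(\<lambda>x. \<integral>u. f (x(i := u)) \<partial>M) \<in> borel_measurable (PiM I (\<lambda>_. M))" by measurable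
  have "integrable (PiM (insert i I) (\<lambda>_. M)) f"
    by (rule prob_integrable_bounded[of _ _ 1]) (use f in \<open>auto intro!: prob_space_PiM prob_space_axioms\<close>)
  then show "(\<integral>x. (\<integral>u. f (x(i := u)) \<partial>M) \<partial>PiM I (\<lambda>_. M)) = (\<integral>x. f x \<partial>PiM (insert i I) (\<lambda>_. M))"
    by (rule P.product_integral_insert[OF I, symmetric])
qed

text \<open>Tensorization by induction on the coordinates. The left side involves only the integrals
  of f and g, and these are unchanged when a coordinate is integrated out. So the induction
  hypothesis applies to the marginals \<open>F\<close>, \<open>G\<close>, and the one-coordinate
  inequality bounds F(x)^s * G(y)^s by the inner double integral. This is why the inequality is
  phrased with f^s under the integral.\<close>

lemma reverse_product:
  fixes f g :: "(nat \<Rightarrow> 'a) \<Rightarrow> real"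
  assumes "finite I" and s: "s = 1 + 4 * \<rho>"
    and "f \<in> borel_measurable (PiM I (\<lambda>_. M))" "g \<in> borel_measurable (PiM I (\<lambda>_. M))"
    and "\<And>x. 0 \<le> f x \<and> f x \<le> 1" "\<And>x. 0 \<le> g x \<and> g x \<le> 1"
  shows "ennreal ((\<integral>x. f x \<partial>PiM I (\<lambda>_. M)) powr s * (\<integral>x. g x \<partial>PiM I (\<lambda>_. M)) powr s)
    \<le> (\<integral>\<^sup>+x. \<integral>\<^sup>+y. ennreal (f x powr s * g y powr s * pkern I x y) \<partial>PiM I (\<lambda>_. M) \<partial>PiM I (\<lambda>_. M))"
  using assms(1,3-)
proof (induction I arbitrary: f g rule: finite_induct)
  case empty
  then show ?case
    by (simp add: PiM_empty nn_integral_count_space_finite lebesgue_integral_count_space_finite pkern_def)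
next
  case (insert i I)
  note [measurable] = insert.prems(1,2)
  note f = insert.prems(3) and g = insert.prems(4)
  define F G where "F x = (\<integral>u. f (x(i := u)) \<partial>M)" and "G x = (\<integral>u. g (x(i := u)) \<partial>M)" for x
  have [measurable]: "F \<in> borel_measurable (PiM I (\<lambda>_. M))" "G \<in> borel_measurable (PiM I (\<lambda>_. M))"
    unfolding F_def G_def
    by (rule marginal(1)[OF insert.hyps(1,2) insert.prems(1,3)], rule marginal(1)[OF insert.hyps(1,2) insert.prems(2,4)])
  have FG: "0 \<le> F x \<and> F x \<le> 1" "0 \<le> G x \<and> G x \<le> 1" for x
    unfolding F_def G_def by (intro expectation_unit f g)+
  have "ennreal ((\<integral>x. f x \<partial>PiM (insert i I) (\<lambda>_. M)) powr s * (\<integral>x. g x \<partial>PiM (insert i I) (\<lambda>_. M)) powr s)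
      = ennreal ((\<integral>x. F x \<partial>PiM I (\<lambda>_. M)) powr s * (\<integral>x. G x \<partial>PiM I (\<lambda>_. M)) powr s)"
    unfolding F_def G_def
    by (simp only: marginal(2)[OF insert.hyps(1,2) insert.prems(1,3)] marginal(2)[OF insert.hyps(1,2) insert.prems(2,4)])
  also have "\<dots> \<le> (\<integral>\<^sup>+x. \<integral>\<^sup>+y. ennreal (F x powr s * G y powr s * pkern I x y) \<partial>PiM I (\<lambda>_. M) \<partial>PiM I (\<lambda>_. M))"
    by (rule insert.IH; (rule FG | measurable))
  also have "\<dots> \<le> (\<integral>\<^sup>+x. \<integral>\<^sup>+y. \<integral>\<^sup>+u. \<integral>\<^sup>+v. ennreal (f (x(i := u)) powr s * g (y(i := v)) powr s
      * pkern (insert i I) (x(i := u)) (y(i := v))) \<partial>M \<partial>M \<partial>PiM I (\<lambda>_. M) \<partial>PiM I (\<lambda>_. M))"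
  proof (intro nn_integral_mono)
    fix x y assume x: "x \<in> space (PiM I (\<lambda>_. M))" and y: "y \<in> space (PiM I (\<lambda>_. M))"
    have fg [measurable]: "(\<lambda>u. f (x(i := u))) \<in> borel_measurable M" "(\<lambda>u. g (y(i := u))) \<in> borel_measurable M"
      using x y by measurable
    have "ennreal (F x powr s * G y powr s * pkern I x y) = ennreal (F x powr s * G y powr s) * ennreal (pkern I x y)"
      by (simp add: ennreal_mult)
    also have "\<dots> \<le> (\<integral>\<^sup>+u. \<integral>\<^sup>+v. ennreal (f (x(i := u)) powr s * g (y(i := v)) powr s * kern u v) \<partial>M \<partial>M) * ennreal (pkern I x y)"
      unfolding F_def G_def
      by (rule mult_right_mono[OF reverse_two_functions[OF fg f g s]]) simp
    also have "\<dots> = (\<integral>\<^sup>+u. \<integral>\<^sup>+v. ennreal (f (x(i := u)) powr s * g (y(i := v)) powr s * kern u v) * ennreal (pkern I x y) \<partial>M \<partial>M)"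
      by (rule nn_integral_pair_multc[symmetric] nn_integral_pair_multc) measurable
    also have "\<dots> = (\<integral>\<^sup>+u. \<integral>\<^sup>+v. ennreal (f (x(i := u)) powr s * g (y(i := v)) powr s
      * pkern (insert i I) (x(i := u)) (y(i := v))) \<partial>M \<partial>M)"
      unfolding pkern_insert[OF insert.hyps(1,2)]
      by (intro nn_integral_cong) (simp add: ennreal_mult[symmetric] mult_ac)
    finally show "ennreal (F x powr s * G y powr s * pkern I x y) \<le> \<dots>" .
  qed
  also have "\<dots> = (\<integral>\<^sup>+x. \<integral>\<^sup>+y. ennreal (f x powr s * g y powr s * pkern (insert i I) x y)
      \<partial>PiM (insert i I) (\<lambda>_. M) \<partial>PiM (insert i I) (\<lambda>_. M))"
    by (rule P.nn_integral_PiM_insert_pair[symmetric, OF insert.hyps(1,2)]) (simp add: split_beta')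
  finally show ?case .
qed

text \<open>The same induction with all inequalities turned around: the innermost coordinate is
  estimated before the induction hypothesis is applied, and every coordinate contributes one error
  factor.\<close>

lemma forward_product:
  fixes f g :: "(nat \<Rightarrow> 'a) \<Rightarrow> real"
  assumes "finite I" and s: "s = 1 - 8 * \<rho>"
    and "f \<in> borel_measurable (PiM I (\<lambda>_. M))" "g \<in> borel_measurable (PiM I (\<lambda>_. M))"
    and "\<And>x. 0 \<le> f x \<and> f x \<le> 1" "\<And>x. 0 \<le> g x \<and> g x \<le> 1"
  shows "(\<integral>\<^sup>+x. \<integral>\<^sup>+y. ennreal (f x powr s * g y powr s * (pkern I x y)\<^sup>2) \<partial>PiM I (\<lambda>_. M) \<partial>PiM I (\<lambda>_. M))
    \<le> ennreal ((1 + 100 * \<rho>\<^sup>2) ^ card I *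
        ((\<integral>x. f x \<partial>PiM I (\<lambda>_. M)) powr s * (\<integral>x. g x \<partial>PiM I (\<lambda>_. M)) powr s))"
  using assms(1,3-)
proof (induction I arbitrary: f g rule: finite_induct)
  case empty
  then show ?case
    by (simp add: PiM_empty nn_integral_count_space_finite lebesgue_integral_count_space_finite pkern_def)
next
  case (insert i I)
  note [measurable] = insert.prems(1,2)
  note f = insert.prems(3) and g = insert.prems(4)
  define c where "c = 1 + 100 * \<rho>\<^sup>2"
  have c: "0 \<le> c" by (simp add: c_def)
  define F G where "F x = (\<integral>u. f (x(i := u)) \<partial>M)" and "G x = (\<integral>u. g (x(i := u)) \<partial>M)" for x
  have [measurable]: "F \<in> borel_measurable (PiM I (\<lambda>_. M))" "G \<in> borel_measurable (PiM I (\<lambda>_. M))"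
    unfolding F_def G_def
    by (rule marginal(1)[OF insert.hyps(1,2) insert.prems(1,3)], rule marginal(1)[OF insert.hyps(1,2) insert.prems(2,4)])
  have FG: "0 \<le> F x \<and> F x \<le> 1" "0 \<le> G x \<and> G x \<le> 1" for x
    unfolding F_def G_def by (intro expectation_unit f g)+
  have "(\<integral>\<^sup>+x. \<integral>\<^sup>+y. ennreal (f x powr s * g y powr s * (pkern (insert i I) x y)\<^sup>2)
      \<partial>PiM (insert i I) (\<lambda>_. M) \<partial>PiM (insert i I) (\<lambda>_. M))
    = (\<integral>\<^sup>+x. \<integral>\<^sup>+y. \<integral>\<^sup>+u. \<integral>\<^sup>+v. ennreal (f (x(i := u)) powr s * g (y(i := v)) powr s
      * (pkern (insert i I) (x(i := u)) (y(i := v)))\<^sup>2) \<partial>M \<partial>M \<partial>PiM I (\<lambda>_. M) \<partial>PiM I (\<lambda>_. M))"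
    by (rule P.nn_integral_PiM_insert_pair[OF insert.hyps(1,2)]) (simp add: split_beta')
  also have "\<dots> \<le> (\<integral>\<^sup>+x. \<integral>\<^sup>+y. ennreal c * ennreal (F x powr s * G y powr s * (pkern I x y)\<^sup>2) \<partial>PiM I (\<lambda>_. M) \<partial>PiM I (\<lambda>_. M))"
  proof (intro nn_integral_mono)
    fix x y assume x: "x \<in> space (PiM I (\<lambda>_. M))" and y: "y \<in> space (PiM I (\<lambda>_. M))"
    have fg [measurable]: "(\<lambda>u. f (x(i := u))) \<in> borel_measurable M" "(\<lambda>u. g (y(i := u))) \<in> borel_measurable M"
      using x y by measurable
    have "(\<integral>\<^sup>+u. \<integral>\<^sup>+v. ennreal (f (x(i := u)) powr s * g (y(i := v)) powr s
      * (pkern (insert i I) (x(i := u)) (y(i := v)))\<^sup>2) \<partial>M \<partial>M)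
      = (\<integral>\<^sup>+u. \<integral>\<^sup>+v. ennreal (f (x(i := u)) powr s * g (y(i := v)) powr s * (kern u v)\<^sup>2) * ennreal ((pkern I x y)\<^sup>2) \<partial>M \<partial>M)"
      unfolding pkern_insert[OF insert.hyps(1,2)]
      by (intro nn_integral_cong) (simp add: ennreal_mult[symmetric] power_mult_distrib mult_ac)
    also have "\<dots> = (\<integral>\<^sup>+u. \<integral>\<^sup>+v. ennreal (f (x(i := u)) powr s * g (y(i := v)) powr s * (kern u v)\<^sup>2) \<partial>M \<partial>M) * ennreal ((pkern I x y)\<^sup>2)"
      by (rule nn_integral_pair_multc[symmetric] nn_integral_pair_multc) measurable
    also have "\<dots> \<le> ennreal (c * (F x powr s * G y powr s)) * ennreal ((pkern I x y)\<^sup>2)"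
      unfolding F_def G_def c_def
      by (rule mult_right_mono[OF forward_two_functions[OF fg f g s]]) simp
    also have "\<dots> = ennreal c * ennreal (F x powr s * G y powr s * (pkern I x y)\<^sup>2)"
      using c by (simp add: ennreal_mult mult_ac)
    finally show "(\<integral>\<^sup>+u. \<integral>\<^sup>+v. ennreal (f (x(i := u)) powr s * g (y(i := v)) powr s
      * (pkern (insert i I) (x(i := u)) (y(i := v)))\<^sup>2) \<partial>M \<partial>M) \<le> \<dots>" .
  qed
  also have "\<dots> = (\<integral>\<^sup>+x. \<integral>\<^sup>+y. ennreal (F x powr s * G y powr s * (pkern I x y)\<^sup>2) \<partial>PiM I (\<lambda>_. M) \<partial>PiM I (\<lambda>_. M)) * ennreal c"
  proof -
    interpret Q: prob_space "PiM I (\<lambda>_. M)" by (rule prob_space_PiM) (rule prob_space_axioms)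
    show ?thesis unfolding mult.commute[of "ennreal c"]
      by (rule Q.nn_integral_pair_multc) measurable
  qed
  also have "\<dots> \<le> ennreal (c ^ card I *
      ((\<integral>x. F x \<partial>PiM I (\<lambda>_. M)) powr s * (\<integral>x. G x \<partial>PiM I (\<lambda>_. M)) powr s)) * ennreal c"
    unfolding c_def by (rule mult_right_mono[OF insert.IH]; (rule FG | simp only: zero_le | measurable))
  also have "\<dots> = ennreal (c ^ card (insert i I) *
      ((\<integral>x. f x \<partial>PiM (insert i I) (\<lambda>_. M)) powr s * (\<integral>x. g x \<partial>PiM (insert i I) (\<lambda>_. M)) powr s))"
    unfolding F_def G_def marginal(2)[OF insert.hyps(1,2) insert.prems(1,3)]
      marginal(2)[OF insert.hyps(1,2) insert.prems(2,4)]
    using insert.hyps(1,2) c by (simp add: ennreal_mult'[symmetric] mult.commute mult.left_commute)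
  finally show ?case unfolding c_def .
qed

end

section \<open>Gaussian vectors\<close>

abbreviation stdN :: "real measure" where "stdN \<equiv> density lborel std_normal_density"

lemma prob_space_stdN: "prob_space stdN"
  by (rule prob_space_normal_density) simp

lemma nn_integral_stdN:
  assumes [measurable]: "f \<in> borel_measurable borel"
  shows "(\<integral>\<^sup>+x. f x \<partial>stdN) = (\<integral>\<^sup>+x. ennreal (std_normal_density x) * f x \<partial>lborel)"
  by (rule nn_integral_density) auto

lemma nn_integral_normal_density:
  assumes "0 < \<sigma>"
  shows "(\<integral>\<^sup>+x. ennreal (normal_density \<mu> \<sigma> x) \<partial>lborel) = 1"
proof -
  have "(\<integral>\<^sup>+x. ennreal (normal_density \<mu> \<sigma> x) \<partial>lborel) = ennreal (\<integral>x. normal_density \<mu> \<sigma> x \<partial>lborel)"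
    by (rule nn_integral_eq_integral) (use assms in auto)
  then show ?thesis using assms by simp
qed

lemma nn_integral_stdN_exp: "(\<integral>\<^sup>+x. ennreal (exp (t * x)) \<partial>stdN) = ennreal (exp (t\<^sup>2 / 2))"
proof -
  have "(\<integral>\<^sup>+x. ennreal (exp (t * x)) \<partial>stdN) = (\<integral>\<^sup>+x. ennreal (exp (t\<^sup>2 / 2)) * ennreal (normal_density t 1 x) \<partial>lborel)"
  proof (subst nn_integral_stdN)
    have "std_normal_density x * exp (t * x) = exp (t\<^sup>2 / 2) * normal_density t 1 x" for x
      by (simp add: normal_density_def std_normal_density_def mult_exp_exp power2_eq_square field_simps)
    then show "(\<integral>\<^sup>+x. ennreal (std_normal_density x) * ennreal (exp (t * x)) \<partial>lborel)
      = (\<integral>\<^sup>+x. ennreal (exp (t\<^sup>2 / 2)) * ennreal (normal_density t 1 x) \<partial>lborel)"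
      by (simp add: ennreal_mult'[symmetric])
  qed simp
  also have "\<dots> = ennreal (exp (t\<^sup>2 / 2))"
    by (simp add: nn_integral_cmult nn_integral_normal_density)
  finally show ?thesis .
qed

lemma nn_integral_stdN_exp_square:
  assumes "a < 1/2"
  shows "(\<integral>\<^sup>+x. ennreal (exp (a * x\<^sup>2)) \<partial>stdN) = ennreal (1 / sqrt (1 - 2 * a))"
proof -
  define \<sigma> where "\<sigma> = 1 / sqrt (1 - 2 * a)"
  have \<sigma>: "0 < \<sigma>" "\<sigma>\<^sup>2 = 1 / (1 - 2 * a)" using assms by (auto simp: \<sigma>_def power_divide)
  have "(\<integral>\<^sup>+x. ennreal (exp (a * x\<^sup>2)) \<partial>stdN) = (\<integral>\<^sup>+x. ennreal \<sigma> * ennreal (normal_density 0 \<sigma> x) \<partial>lborel)"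
  proof (subst nn_integral_stdN)
    have "std_normal_density x * exp (a * x\<^sup>2) = \<sigma> * normal_density 0 \<sigma> x" for x
    proof -
      have "sqrt (2 * pi * \<sigma>\<^sup>2) = sqrt (2 * pi) * \<sigma>" using \<sigma>(1) by (simp add: real_sqrt_mult)
      moreover have "- x\<^sup>2 / 2 + a * x\<^sup>2 = - (x\<^sup>2 / (2 * \<sigma>\<^sup>2))" unfolding \<sigma>(2) using assms by (simp add: field_simps)
      ultimately show ?thesis
        using \<sigma>(1) by (simp add: normal_density_def std_normal_density_def mult_exp_exp)
    qed
    then show "(\<integral>\<^sup>+x. ennreal (std_normal_density x) * ennreal (exp (a * x\<^sup>2)) \<partial>lborel)
      = (\<integral>\<^sup>+x. ennreal \<sigma> * ennreal (normal_density 0 \<sigma> x) \<partial>lborel)"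
      using \<sigma>(1) by (simp add: ennreal_mult'[symmetric])
  qed simp
  also have "\<dots> = ennreal \<sigma>" using \<sigma>(1) by (simp add: nn_integral_cmult nn_integral_normal_density)
  finally show ?thesis by (simp add: \<sigma>_def)
qed

lemma distr_stdN_uminus: "distr stdN borel uminus = stdN"
proof (rule measure_eqI)
  fix A assume "A \<in> sets (distr stdN borel uminus)"
  then have A [measurable]: "A \<in> sets borel" by simp
  have "emeasure (distr stdN borel uminus) A = (\<integral>\<^sup>+x. indicator A (- x) \<partial>stdN)"
    by (subst nn_integral_indicator[symmetric], simp, subst nn_integral_distr) auto
  also have "\<dots> = (\<integral>\<^sup>+x. ennreal (std_normal_density x) * indicator A (- x) \<partial>lborel)"
    by (subst nn_integral_stdN) auto
  also have "\<dots> = (\<integral>\<^sup>+x. ennreal (std_normal_density x) * indicator A x \<partial>lborel)"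
    by (subst nn_integral_real_affine[of _ "-1" 0]) (auto simp: std_normal_density_def one_ennreal_def[symmetric])
  also have "\<dots> = emeasure stdN A" by (subst emeasure_density) auto
  finally show "emeasure (distr stdN borel uminus) A = emeasure stdN A" .
qed simp

lemma integral_stdN_exp:
  "integrable stdN (\<lambda>x. exp (t * x))" "(\<integral>x. exp (t * x) \<partial>stdN) = exp (t\<^sup>2 / 2)"
  by (rule integrableI_nn_integral_finite[OF _ _ nn_integral_stdN_exp]; simp)
    (rule integral_eq_nn_integral[THEN trans]; simp add: nn_integral_stdN_exp)

lemma integral_stdN_exp_square:
  assumes "a < 1/2"
  shows "integrable stdN (\<lambda>x. exp (a * x\<^sup>2))" "(\<integral>x. exp (a * x\<^sup>2) \<partial>stdN) = 1 / sqrt (1 - 2 * a)"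
  by (rule integrableI_nn_integral_finite[OF _ _ nn_integral_stdN_exp_square[OF assms]]; use assms in simp)
    (rule integral_eq_nn_integral[THEN trans]; use assms in \<open>simp add: nn_integral_stdN_exp_square\<close>)

section \<open>The truncated standard Gaussian as an instance\<close>

definition trunc :: "real \<Rightarrow> real \<Rightarrow> real" where "trunc B x = (if \<bar>x\<bar> \<le> B then x else 0)"

lemma measurable_trunc [measurable]: "trunc B \<in> borel_measurable borel"
  unfolding trunc_def by measurable

lemma integrable_stdN_bounded:
  fixes f :: "real \<Rightarrow> real"
  assumes "f \<in> borel_measurable borel" "\<And>x. \<bar>f x\<bar> \<le> C"
  shows "integrable stdN f"
  by (rule prob_integrable_bounded[OF prob_space_stdN, of _ C]) (use assms in auto)

text \<open>By symmetry of the law and oddness of the truncation, both sides may be averaged over t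
  and -t. The averaged integrands are hyperbolic cosines, and replacing x by 0 only lowers a
  hyperbolic cosine.\<close>

lemma trunc_mgf:
  assumes "0 \<le> B"
  shows "(\<integral>x. exp (t * trunc B x) \<partial>stdN) \<le> exp (t\<^sup>2 / 2)"
proof -
  have i: "integrable stdN (\<lambda>x. exp (s * trunc B x))" for s
  proof (rule integrable_stdN_bounded[of _ "exp (\<bar>s\<bar> * B)"])
    fix x
    have "s * trunc B x \<le> \<bar>s\<bar> * \<bar>trunc B x\<bar>" by (metis abs_ge_self abs_mult)
    also have "\<dots> \<le> \<bar>s\<bar> * B" using assms by (intro mult_left_mono) (auto simp: trunc_def)
    finally show "\<bar>exp (s * trunc B x)\<bar> \<le> exp (\<bar>s\<bar> * B)" by simp
  qed measurable
  have "(\<integral>x. exp (t * trunc B x) \<partial>stdN) = (\<integral>x. exp (t * trunc B x) \<partial>distr stdN borel uminus)"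
    by (simp add: distr_stdN_uminus)
  also have "\<dots> = (\<integral>x. exp (t * trunc B (- x)) \<partial>stdN)" by (rule integral_distr) auto
  also have "\<dots> = (\<integral>x. exp (- t * trunc B x) \<partial>stdN)"
    by (rule Bochner_Integration.integral_cong) (auto simp: trunc_def)
  finally have "2 * (\<integral>x. exp (t * trunc B x) \<partial>stdN) = (\<integral>x. exp (t * trunc B x) + exp (- t * trunc B x) \<partial>stdN)"
    using i[of t] i[of "-t"] by simp
  also have "\<dots> \<le> (\<integral>x. exp (t * x) + exp (- t * x) \<partial>stdN)"
  proof (rule integral_mono)
    fix x :: real
    have "2 \<le> exp (t * x) + exp (- t * x)"
      using exp_ge_add_one_self[of "t * x"] exp_ge_add_one_self[of "- t * x"]
      unfolding mult_minus_left by linarith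
    then show "exp (t * trunc B x) + exp (- t * trunc B x) \<le> exp (t * x) + exp (- t * x)"
      by (auto simp: trunc_def)
  qed (use i[of t] i[of "-t"] integral_stdN_exp(1)[of t] integral_stdN_exp(1)[of "-t"] in auto)
  also have "\<dots> = 2 * exp (t\<^sup>2 / 2)"
    using integral_stdN_exp[of t] integral_stdN_exp[of "-t"] by simp
  finally show ?thesis by simp
qed

lemma trunc_mgf_square:
  assumes "0 \<le> B"
  shows "(\<integral>x. exp ((trunc B x)\<^sup>2 / 4) \<partial>stdN) \<le> 3/2"
proof -
  have "(\<integral>x. exp ((trunc B x)\<^sup>2 / 4) \<partial>stdN) \<le> (\<integral>x. exp (1/4 * x\<^sup>2) \<partial>stdN)"
  proof (rule integral_mono)
    show "integrable stdN (\<lambda>x. exp ((trunc B x)\<^sup>2 / 4))"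
    proof (rule integrable_stdN_bounded[of _ "exp (B\<^sup>2 / 4)"])
      fix x
      have "(trunc B x)\<^sup>2 \<le> B\<^sup>2" using assms by (auto simp: trunc_def abs_le_square_iff[symmetric])
      then show "\<bar>exp ((trunc B x)\<^sup>2 / 4)\<bar> \<le> exp (B\<^sup>2 / 4)" by simp
    qed measurable
    show "integrable stdN (\<lambda>x. exp (1/4 * x\<^sup>2))" by (rule integral_stdN_exp_square) simp
  qed (auto simp: trunc_def)
  also have "\<dots> = 1 / sqrt (1/2)" by (subst integral_stdN_exp_square) auto
  also have "\<dots> = sqrt 2" by (simp add: real_sqrt_divide)
  also have "\<dots> \<le> 3/2" by (rule real_le_lsqrt) (auto simp: power2_eq_square)
  finally show ?thesis .
qed

text \<open>The cutoff 1 / (4 * sqrt \<rho>) is the largest one the locale admits; a high cutoff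
  keeps the truncation error small.\<close>

lemma truncated_subgaussian_stdN:
  assumes "0 < \<rho>" "\<rho> \<le> 1/16"
  shows "truncated_subgaussian stdN (trunc (1 / (4 * sqrt \<rho>))) \<rho> (1 / (4 * sqrt \<rho>))"
proof -
  interpret prob_space stdN by (rule prob_space_stdN)
  have B: "0 \<le> 1 / (4 * sqrt \<rho>)" using assms by simp
  show ?thesis
    by unfold_locales
      (use assms B trunc_mgf[OF B] trunc_mgf_square[OF B]
       in \<open>auto simp: trunc_def power_divide power_mult_distrib\<close>)
qed

section \<open>Measurability and Chernoff bounds for the product Gaussian\<close>

interpretation stdN: product_sigma_finite "\<lambda>_ :: nat. stdN"
  by (rule product_sigma_finite.intro) (rule prob_space_imp_sigma_finite[OF prob_space_stdN])

lemma prob_space_std_gaussian: "prob_space (std_gaussian d)"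
  unfolding std_gaussian_def by (intro prob_space_PiM prob_space_stdN)

lemma measurable_std_gaussian_component [measurable]:
  "k \<in> {1..d} \<Longrightarrow> (\<lambda>x. x k) \<in> borel_measurable (std_gaussian d)"
  unfolding std_gaussian_def by (rule measurable_component_singleton[of k _ "\<lambda>_. stdN", simplified])

lemma measurable_ip [measurable (raw)]:
  assumes "f \<in> measurable M (std_gaussian d)" "g \<in> measurable M (std_gaussian d)"
  shows "(\<lambda>w. ip d (f w) (g w)) \<in> borel_measurable M"
  unfolding ip_def
  by (intro borel_measurable_sum borel_measurable_times
      measurable_compose[OF assms(1) measurable_std_gaussian_component]
      measurable_compose[OF assms(2) measurable_std_gaussian_component])

lemma nn_integral_std_gaussian_prod:
  assumes "\<And>k. f k \<in> borel_measurable borel"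
  shows "(\<integral>\<^sup>+x. (\<Prod>k\<in>{1..d}. f k (x k)) \<partial>std_gaussian d) = (\<Prod>k\<in>{1..d}. \<integral>\<^sup>+u. f k u \<partial>stdN)"
  unfolding std_gaussian_def by (rule stdN.product_nn_integral_prod) (use assms in auto)

lemma std_gaussian_chernoff:
  fixes \<phi> :: "real \<Rightarrow> real"
  assumes [measurable]: "\<phi> \<in> borel_measurable borel"
    and c: "(\<integral>\<^sup>+u. ennreal (exp (\<phi> u)) \<partial>stdN) \<le> ennreal c" "0 \<le> c"
  shows "measure (std_gaussian d) {x \<in> space (std_gaussian d). m \<le> (\<Sum>k\<in>{1..d}. \<phi> (x k))} \<le> exp (- m) * c ^ d"
proof -
  interpret prob_space "std_gaussian d" by (rule prob_space_std_gaussian)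
  let ?E = "{x \<in> space (std_gaussian d). m \<le> (\<Sum>k\<in>{1..d}. \<phi> (x k))}"
  have E [measurable]: "?E \<in> sets (std_gaussian d)" by measurable
  have "emeasure (std_gaussian d) ?E = (\<integral>\<^sup>+x. indicator ?E x \<partial>std_gaussian d)"
    by simp
  also have "\<dots> \<le> (\<integral>\<^sup>+x. ennreal (exp (- m)) * (\<Prod>k\<in>{1..d}. ennreal (exp (\<phi> (x k)))) \<partial>std_gaussian d)"
  proof (rule nn_integral_mono)
    fix x
    have "ennreal (exp (- m)) * (\<Prod>k\<in>{1..d}. ennreal (exp (\<phi> (x k)))) = ennreal (exp ((\<Sum>k\<in>{1..d}. \<phi> (x k)) - m))"
      by (simp add: prod_ennreal ennreal_mult'[symmetric] exp_sum[symmetric] mult_exp_exp)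
    moreover have "1 \<le> exp ((\<Sum>k\<in>{1..d}. \<phi> (x k)) - m)" if "x \<in> ?E"
      using that by simp
    ultimately show "indicator ?E x \<le> ennreal (exp (- m)) * (\<Prod>k\<in>{1..d}. ennreal (exp (\<phi> (x k))))"
      by (auto simp: indicator_def ennreal_1[symmetric] simp del: ennreal_1 intro!: ennreal_leI)
  qed
  also have "\<dots> = ennreal (exp (- m)) * (\<Prod>k\<in>{1..d}. \<integral>\<^sup>+u. ennreal (exp (\<phi> u)) \<partial>stdN)"
    by (subst nn_integral_std_gaussian_prod[of "\<lambda>_ u. ennreal (exp (\<phi> u))", symmetric], measurable,
        subst nn_integral_cmult, measurable)
  also have "\<dots> \<le> ennreal (exp (- m)) * (\<Prod>k\<in>{1..d}. ennreal c)"
    by (intro mult_left_mono prod_mono_ennreal c) auto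
  also have "\<dots> = ennreal (exp (- m) * c ^ d)"
    using c(2) by (simp add: ennreal_mult' ennreal_power)
  finally show ?thesis
    using c(2) by (simp add: emeasure_eq_measure)
qed

section \<open>Two sets of vectors without a negative inner product\<close>

text \<open>The part of a squared coordinate that truncation removes. It dominates the error made in
  a product of two coordinates, and after division by B^2 it dominates the indicator of a truncated
  coordinate.\<close>

definition big_square :: "real \<Rightarrow> real \<Rightarrow> real" where "big_square B x = (if B < \<bar>x\<bar> then x\<^sup>2 else 0)"

definition small_ind :: "real \<Rightarrow> real \<Rightarrow> real" where "small_ind b x = (if \<bar>x\<bar> < b then 1 else 0)"

lemma measurable_big_square [measurable]: "big_square B \<in> borel_measurable borel"
  unfolding big_square_def by measurable

lemma measurable_small_ind [measurable]: "small_ind b \<in> borel_measurable borel"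
  unfolding small_ind_def by measurable

text \<open>The first condition keeps the truncated inner product close to the true one. The second
  ensures that most products of coordinates are not tiny, which gives the kernel its second-order
  decay.\<close>

definition typical :: "nat \<Rightarrow> real \<Rightarrow> real \<Rightarrow> real \<Rightarrow> (nat \<Rightarrow> real) set" where
  "typical d B b r = {x \<in> space (std_gaussian d). (\<Sum>k\<in>{1..d}. big_square B (x k)) \<le> 12 * r
     \<and> (\<Sum>k\<in>{1..d}. small_ind b (x k)) \<le> real d / 8}"

lemma typical_sets [measurable]: "typical d B b r \<in> sets (std_gaussian d)"
  unfolding typical_def by measurable

text \<open>Where |u| > B, the exponent u^2 / 4 is at most 3 * u^2 / 8 - B^2 / 8, and the Gaussian
  integral of exp (3 * u^2 / 8) equals 2.\<close>

lemma nn_integral_exp_big_square: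
  assumes "0 \<le> B"
  shows "(\<integral>\<^sup>+u. ennreal (exp (big_square B u / 4)) \<partial>stdN) \<le> ennreal (1 + 2 * exp (- B\<^sup>2 / 8))"
proof -
  interpret prob_space stdN by (rule prob_space_stdN)
  have "(\<integral>\<^sup>+u. ennreal (exp (big_square B u / 4)) \<partial>stdN)
      \<le> (\<integral>\<^sup>+u. 1 + ennreal (exp (- B\<^sup>2 / 8)) * ennreal (exp (3/8 * u\<^sup>2)) \<partial>stdN)"
  proof (rule nn_integral_mono)
    fix u
    have "exp (big_square B u / 4) \<le> 1 + exp (- B\<^sup>2 / 8) * exp (3/8 * u\<^sup>2)"
    proof (cases "B < \<bar>u\<bar>")
      case True
      then have "B\<^sup>2 \<le> u\<^sup>2" using assms by (simp add: abs_le_square_iff[symmetric])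
      then have "exp (big_square B u / 4) \<le> exp (- B\<^sup>2 / 8) * exp (3/8 * u\<^sup>2)"
        using True by (simp add: big_square_def mult_exp_exp)
      then show ?thesis by simp
    qed (simp add: big_square_def)
    then have "ennreal (exp (big_square B u / 4)) \<le> ennreal (1 + exp (- B\<^sup>2 / 8) * exp (3/8 * u\<^sup>2))"
      by (rule ennreal_leI)
    then show "ennreal (exp (big_square B u / 4)) \<le> 1 + ennreal (exp (- B\<^sup>2 / 8)) * ennreal (exp (3/8 * u\<^sup>2))"
      by (simp add: ennreal_mult')
  qed
  also have "\<dots> = 1 + ennreal (exp (- B\<^sup>2 / 8)) * ennreal (1 / sqrt (1 - 2 * (3/8)))"
    by (subst nn_integral_add) (simp_all add: nn_integral_cmult nn_integral_stdN_exp_square[of "3/8", simplified] emeasure_space_1[simplified])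
  also have "\<dots> = ennreal (1 + 2 * exp (- B\<^sup>2 / 8))"
  proof -
    have "1 / sqrt (1 - 2 * (3/8)) = (2::real)" by (simp add: real_sqrt_divide)
    then have "ennreal (exp (- B\<^sup>2 / 8)) * ennreal (1 / sqrt (1 - 2 * (3/8))) = ennreal (2 * exp (- B\<^sup>2 / 8))"
      by (simp only: ennreal_mult'[symmetric] exp_ge_zero mult.commute)
    then show ?thesis by (simp add: ennreal_plus[symmetric] ennreal_1[symmetric] del: ennreal_plus ennreal_1)
  qed
  finally show ?thesis .
qed

lemma nn_integral_exp_small_ind:
  assumes "0 < b"
  shows "(\<integral>\<^sup>+u. ennreal (exp (8 * small_ind b u)) \<partial>stdN) \<le> ennreal (1 + exp 8 * b)"
proof -
  interpret prob_space stdN by (rule prob_space_stdN)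
  have "(\<integral>\<^sup>+u. ennreal (exp (8 * small_ind b u)) \<partial>stdN)
      \<le> (\<integral>\<^sup>+u. 1 + ennreal (exp 8) * indicator {-b<..<b} u \<partial>stdN)"
    by (rule nn_integral_mono) (auto simp: small_ind_def indicator_def abs_less_iff)
  also have "\<dots> = 1 + ennreal (exp 8) * emeasure stdN {-b<..<b}"
    by (subst nn_integral_add) (simp_all add: nn_integral_cmult_indicator emeasure_space_1[simplified])
  \<comment> \<open>The density is at most 1/2 because sqrt (2 * pi) \<ge> 2, and the interval has
    length 2 * b.\<close>
  also have "emeasure stdN {-b<..<b} \<le> ennreal b"
  proof -
    have "emeasure stdN {-b<..<b} = (\<integral>\<^sup>+x. ennreal (std_normal_density x) * indicator {-b<..<b} x \<partial>lborel)"
      by (subst emeasure_density) auto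
    also have "\<dots> \<le> (\<integral>\<^sup>+x. ennreal (1/2) * indicator {-b<..<b} x \<partial>lborel)"
    proof (intro nn_integral_mono mult_right_mono ennreal_leI)
      fix x :: real
      have "2 \<le> sqrt (2 * pi)" using pi_ge_two by (intro real_le_rsqrt) (simp add: power2_eq_square)
      then have "1 / sqrt (2 * pi) \<le> 1 / 2" by (intro divide_left_mono) auto
      moreover have "exp (- x\<^sup>2 / 2) \<le> 1" by simp
      ultimately have "1 / sqrt (2 * pi) * exp (- x\<^sup>2 / 2) \<le> 1/2 * 1" by (intro mult_mono) auto
      then show "std_normal_density x \<le> 1/2" by (simp add: std_normal_density_def)
    qed auto
    also have "\<dots> = ennreal (1/2) * ennreal (2 * b)"
      using assms by (subst nn_integral_cmult_indicator) auto
    also have "\<dots> = ennreal b" by (subst ennreal_mult'[symmetric]) auto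
    finally show ?thesis .
  qed
  also have "1 + ennreal (exp 8) * ennreal b = ennreal (1 + exp 8 * b)"
    using assms by (simp add: ennreal_mult')
  finally show ?thesis by (simp add: add_left_mono mult_left_mono)
qed

lemma one_plus_power_le_exp: "0 \<le> x \<Longrightarrow> (1 + x) ^ d \<le> exp (real d * (x::real))"
  by (metis exp_ge_add_one_self exp_of_nat_mult add_nonneg_nonneg power_mono zero_le_one)

text \<open>The exponent 2 * r is what is needed to intersect a set of measure exp (- r) with the
  typical vectors and still keep half of it. The value of \<open>b\<close> makes exp 8 * b = 1/16 in
  the second Chernoff bound.\<close>

lemma typical_prob:
  assumes \<rho>: "0 < \<rho>" and B: "B = 1 / (4 * sqrt \<rho>)" and b: "b = exp (- 8) / 16"
    and r1: "65536 * \<rho>\<^sup>2 * real d \<le> r" and r2: "r \<le> real d / 4"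
  shows "1 - 2 * exp (- 2 * r) \<le> measure (std_gaussian d) (typical d B b r)"
proof -
  interpret prob_space "std_gaussian d" by (rule prob_space_std_gaussian)
  let ?E1 = "{x \<in> space (std_gaussian d). 3 * r \<le> (\<Sum>k\<in>{1..d}. big_square B (x k) / 4)}"
  let ?E2 = "{x \<in> space (std_gaussian d). real d \<le> (\<Sum>k\<in>{1..d}. 8 * small_ind b (x k))}"
  have bp: "0 < b" by (simp add: b)
  have r0: "0 \<le> r" using r1 by (rule order_trans[rotated]) auto
  have "prob ?E1 \<le> exp (- (3 * r)) * (1 + 2 * exp (- B\<^sup>2 / 8)) ^ d"
    by (rule std_gaussian_chernoff[OF _ nn_integral_exp_big_square]) (use \<rho> B in auto)
  also have "\<dots> \<le> exp (- (3 * r)) * exp (real d * (2 * exp (- B\<^sup>2 / 8)))"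
    by (intro mult_left_mono one_plus_power_le_exp) auto
  also have "\<dots> \<le> exp (- (3 * r)) * exp r"
  proof -
    define z where "z = B\<^sup>2 / 8"
    have z: "z = 1 / (128 * \<rho>)" "0 < z" using \<rho> by (auto simp: z_def B power_divide power_mult_distrib)
    \<comment> \<open>Replaces the exponentially small exp (- B^2 / 8) by 2 / z^2 = 32768 *
      \<rho>^2; twice this number is the constant 65536 of the hypothesis.\<close>
    have "z\<^sup>2 / 2 \<le> exp z" using exp_lower_Taylor_quadratic[of z] z(2) by linarith
    then have "exp (- z) \<le> 2 / z\<^sup>2" using z(2) by (simp add: exp_minus field_simps)
    also have "\<dots> = 32768 * \<rho>\<^sup>2" using \<rho> by (simp add: z(1) power_divide power_mult_distrib)
    finally have "real d * (2 * exp (- B\<^sup>2 / 8)) \<le> real d * (2 * (32768 * \<rho>\<^sup>2))"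
      by (intro mult_left_mono) (auto simp: z_def)
    also have "\<dots> \<le> r" using r1 by (simp add: mult_ac)
    finally show ?thesis by simp
  qed
  also have "\<dots> = exp (- 2 * r)" by (simp add: mult_exp_exp)
  finally have E1: "prob ?E1 \<le> exp (- 2 * r)" .
  have "prob ?E2 \<le> exp (- real d) * (1 + exp 8 * b) ^ d"
    by (rule std_gaussian_chernoff[OF _ nn_integral_exp_small_ind]) (use bp in auto)
  also have "\<dots> \<le> exp (- real d) * exp (real d * (exp 8 * b))"
    by (intro mult_left_mono one_plus_power_le_exp) (use bp in auto)
  also have "\<dots> \<le> exp (- 2 * r)"
  proof -
    have "exp 8 * b = 1 / 16" by (simp add: b mult_exp_exp)
    show ?thesis unfolding \<open>exp 8 * b = 1 / 16\<close> using r2 by (simp add: mult_exp_exp)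
  qed
  finally have E2: "prob ?E2 \<le> exp (- 2 * r)" .
  have "space (std_gaussian d) - typical d B b r \<subseteq> ?E1 \<union> ?E2"
    by (auto simp: typical_def sum_divide_distrib[symmetric] sum_distrib_left[symmetric])
  then have "prob (space (std_gaussian d) - typical d B b r) \<le> prob (?E1 \<union> ?E2)"
    by (intro finite_measure_mono) measurable
  also have "\<dots> \<le> prob ?E1 + prob ?E2" by (rule measure_Un_le) measurable
  finally have "1 - prob (typical d B b r) \<le> 2 * exp (- 2 * r)"
    using E1 E2 prob_compl[of "typical d B b r"] by simp
  then show ?thesis by simp
qed

text \<open>Passes through the square (1 - w / 2)^2 with w = z + z^2 / 16. The extra z^2 / 16 is the
  second-order decay of the kernel that remains when the linear terms sum to nothing.\<close>

lemma one_minus_le_exp_quadratic: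
  fixes z :: real
  assumes "\<bar>z\<bar> \<le> 1"
  shows "1 - z \<le> exp (- z - z\<^sup>2 / 16)"
proof -
  define w where "w = z + z\<^sup>2 / 16"
  have z2: "z\<^sup>2 \<le> 1" using assms by (simp add: abs_square_le_1)
  have w1: "w \<le> 2" using assms z2 by (auto simp: w_def)
  have "z\<^sup>2 * (1/2)\<^sup>2 \<le> z\<^sup>2 * (1 + z / 16)\<^sup>2"
    by (intro mult_left_mono power_mono) (use assms in auto)
  also have "\<dots> = w\<^sup>2" by (simp add: w_def power2_eq_square algebra_simps)
  finally have "1 - z \<le> (1 - w / 2)\<^sup>2" by (simp add: w_def power2_eq_square algebra_simps)
  also have "\<dots> \<le> (exp (- w / 2))\<^sup>2"
    using exp_ge_add_one_self[of "- w / 2"] w1 by (intro power_mono) auto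
  also have "\<dots> = exp (- w)" by (simp add: exp_double[symmetric])
  finally show ?thesis by (simp add: w_def)
qed

text \<open>A second-order expansion of each factor leaves - \<rho> times the truncated inner
  product and - \<rho>^2 / 16 times the sum of the squared truncated products. Typicality bounds the
  former from ip \<ge> 0 with a loss of 24 * r, and bounds the sum of squares from below by b^4 * d
  / 2, after the small and the truncated coordinates are discounted.\<close>

lemma pkern_typical_le:
  assumes \<rho>: "0 < \<rho>" "\<rho> \<le> 1/16" and B: "B = 1 / (4 * sqrt \<rho>)" and b: "0 < b"
    and x: "x \<in> typical d B b r" and y: "y \<in> typical d B b r" and ip: "0 \<le> ip d x y"
    and r: "3072 * (\<rho> * r) \<le> real d"
  shows "truncated_subgaussian.pkern (trunc B) \<rho> {1..d} x y
    \<le> exp (24 * \<rho> * r - \<rho>\<^sup>2 * real d * (b ^ 4 / 32))"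
proof -
  interpret T: truncated_subgaussian stdN "trunc B" \<rho> B
    unfolding B by (rule truncated_subgaussian_stdN) (use \<rho> in auto)
  have Bp: "0 < B" and B2: "B\<^sup>2 = 1 / (16 * \<rho>)" using \<rho> by (auto simp: B power_divide power_mult_distrib)
  let ?t = "\<lambda>k. trunc B (x k) * trunc B (y k)"
  have "T.pkern {1..d} x y \<le> (\<Prod>k\<in>{1..d}. exp (- \<rho> * ?t k - \<rho>\<^sup>2 * (?t k)\<^sup>2 / 16))"
    unfolding T.pkern_def
  proof (intro prod_mono conjI T.kern_nonneg)
    fix k
    have "\<bar>\<rho> * ?t k\<bar> \<le> 1"
      using T.kern_bounds[of "x k" "y k"] by (auto simp: T.kern_def mult.assoc)
    then have "1 - \<rho> * ?t k \<le> exp (- (\<rho> * ?t k) - (\<rho> * ?t k)\<^sup>2 / 16)"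
      by (rule one_minus_le_exp_quadratic)
    then show "T.kern (x k) (y k) \<le> exp (- \<rho> * ?t k - \<rho>\<^sup>2 * (?t k)\<^sup>2 / 16)"
      by (simp add: T.kern_def power_mult_distrib mult.assoc)
  qed
  also have "\<dots> = exp (- \<rho> * (\<Sum>k\<in>{1..d}. ?t k) - \<rho>\<^sup>2 / 16 * (\<Sum>k\<in>{1..d}. (?t k)\<^sup>2))"
    by (simp add: exp_sum[symmetric] sum_subtractf sum_negf sum_distrib_left)
  also have "\<dots> \<le> exp (24 * \<rho> * r - \<rho>\<^sup>2 * real d * (b ^ 4 / 32))"
  proof -
    have x': "(\<Sum>k\<in>{1..d}. big_square B (x k)) \<le> 12 * r" "(\<Sum>k\<in>{1..d}. small_ind b (x k)) \<le> real d / 8"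
      and y': "(\<Sum>k\<in>{1..d}. big_square B (y k)) \<le> 12 * r" "(\<Sum>k\<in>{1..d}. small_ind b (y k)) \<le> real d / 8"
      using x y by (auto simp: typical_def)
    \<comment> \<open>If any coordinate is truncated, then so is the one larger in absolute value,
      and its square dominates the product.\<close>
    have p1: "u * v - trunc B u * trunc B v \<le> big_square B u + big_square B v" for u v
    proof -
      have nn: "0 \<le> big_square B w" for w by (simp add: big_square_def)
      consider "\<bar>u\<bar> \<le> B" "\<bar>v\<bar> \<le> B" | "\<bar>u\<bar> \<le> \<bar>v\<bar>" "B < \<bar>v\<bar>" | "\<bar>v\<bar> \<le> \<bar>u\<bar>" "B < \<bar>u\<bar>" by linarith
      then show ?thesis
      proof cases
        case 2
        have "u * v \<le> \<bar>u\<bar> * \<bar>v\<bar>" by (metis abs_ge_self abs_mult)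
        also have "\<dots> \<le> \<bar>v\<bar> * \<bar>v\<bar>" using 2 by (intro mult_right_mono) auto
        also have "\<dots> = big_square B v" using 2 by (simp add: big_square_def power2_eq_square)
        finally show ?thesis using 2 nn[of u] by (simp add: trunc_def)
      next
        case 3
        have "u * v \<le> \<bar>u\<bar> * \<bar>v\<bar>" by (metis abs_ge_self abs_mult)
        also have "\<dots> \<le> \<bar>u\<bar> * \<bar>u\<bar>" using 3 by (intro mult_left_mono) auto
        also have "\<dots> = big_square B u" using 3 by (simp add: big_square_def power2_eq_square)
        finally show ?thesis using 3 nn[of v] by (simp add: trunc_def)
      qed (auto simp: trunc_def big_square_def)
    qed
    have "ip d x y - (\<Sum>k\<in>{1..d}. ?t k) = (\<Sum>k\<in>{1..d}. x k * y k - ?t k)"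
      by (simp add: ip_def sum_subtractf)
    also have "\<dots> \<le> (\<Sum>k\<in>{1..d}. big_square B (x k) + big_square B (y k))"
      by (intro sum_mono p1)
    also have "\<dots> \<le> 24 * r" using x' y' by (simp add: sum.distrib)
    finally have s1: "- 24 * r \<le> (\<Sum>k\<in>{1..d}. ?t k)" using ip by simp
    \<comment> \<open>A bound that is linear in the indicators and hence can be summed: a small or
      truncated coordinate makes the bracket nonpositive.\<close>
    have p2: "b ^ 4 * (1 - small_ind b u - small_ind b v - big_square B u / B\<^sup>2 - big_square B v / B\<^sup>2)
        \<le> (trunc B u * trunc B v)\<^sup>2" for u v
    proof -
      have bb: "0 \<le> b ^ 4" using b by simp
      have nn: "0 \<le> big_square B w / B\<^sup>2" "0 \<le> small_ind b w" for w by (auto simp: big_square_def small_ind_def)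
      have big: "1 \<le> big_square B w / B\<^sup>2" if "B < \<bar>w\<bar>" for w
      proof -
        have "B\<^sup>2 \<le> w\<^sup>2" using that Bp by (simp add: abs_le_square_iff[symmetric])
        then show ?thesis using that Bp by (simp add: big_square_def)
      qed
      show ?thesis
      proof (cases "b \<le> \<bar>u\<bar> \<and> b \<le> \<bar>v\<bar> \<and> \<bar>u\<bar> \<le> B \<and> \<bar>v\<bar> \<le> B")
        case True
        then have "b\<^sup>2 \<le> u\<^sup>2" "b\<^sup>2 \<le> v\<^sup>2" using b by (auto simp: abs_le_square_iff[symmetric])
        then have "b\<^sup>2 * b\<^sup>2 \<le> u\<^sup>2 * v\<^sup>2" by (intro mult_mono) auto
        then show ?thesis using True by (simp add: trunc_def small_ind_def big_square_def power_mult_distrib power_add[symmetric])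
      next
        case False
        then have "1 - small_ind b u - small_ind b v - big_square B u / B\<^sup>2 - big_square B v / B\<^sup>2 \<le> 0"
          using nn[of u] nn[of v] big[of u] big[of v] by (auto simp: small_ind_def not_le split: if_splits)
        then have "b ^ 4 * (1 - small_ind b u - small_ind b v - big_square B u / B\<^sup>2 - big_square B v / B\<^sup>2) \<le> 0"
          using bb by (rule mult_nonneg_nonpos[rotated])
        then show ?thesis by (rule order_trans) auto
      qed
    qed
    have "b ^ 4 * (real d / 2) \<le> b ^ 4 * (real d - (\<Sum>k\<in>{1..d}. small_ind b (x k)) - (\<Sum>k\<in>{1..d}. small_ind b (y k))
      - (\<Sum>k\<in>{1..d}. big_square B (x k)) / B\<^sup>2 - (\<Sum>k\<in>{1..d}. big_square B (y k)) / B\<^sup>2)"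
    proof (rule mult_left_mono)
      have q: "(12 * r) / B\<^sup>2 \<le> real d / 16" unfolding B2 using r \<rho> by (simp add: field_simps)
      have "(\<Sum>k\<in>{1..d}. big_square B (x k)) / B\<^sup>2 \<le> (12 * r) / B\<^sup>2"
        "(\<Sum>k\<in>{1..d}. big_square B (y k)) / B\<^sup>2 \<le> (12 * r) / B\<^sup>2"
        using x' y' Bp by (auto intro!: divide_right_mono)
      then show "real d / 2 \<le> real d - (\<Sum>k\<in>{1..d}. small_ind b (x k)) - (\<Sum>k\<in>{1..d}. small_ind b (y k))
      - (\<Sum>k\<in>{1..d}. big_square B (x k)) / B\<^sup>2 - (\<Sum>k\<in>{1..d}. big_square B (y k)) / B\<^sup>2"
        using q x'(2) y'(2) by linarith
    qed (use b in auto)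
    also have "\<dots> = (\<Sum>k\<in>{1..d}. b ^ 4 * (1 - small_ind b (x k) - small_ind b (y k)
        - big_square B (x k) / B\<^sup>2 - big_square B (y k) / B\<^sup>2))"
      by (simp add: sum_distrib_left[symmetric] sum_subtractf sum_divide_distrib)
    also have "\<dots> \<le> (\<Sum>k\<in>{1..d}. (?t k)\<^sup>2)" by (intro sum_mono p2)
    finally have s2: "b ^ 4 * (real d / 2) \<le> (\<Sum>k\<in>{1..d}. (?t k)\<^sup>2)" .
    have "- \<rho> * (\<Sum>k\<in>{1..d}. ?t k) \<le> 24 * \<rho> * r"
      using mult_left_mono[OF s1, of \<rho>] \<rho> by (simp add: algebra_simps)
    moreover have "\<rho>\<^sup>2 * real d * (b ^ 4 / 32) \<le> \<rho>\<^sup>2 / 16 * (\<Sum>k\<in>{1..d}. (?t k)\<^sup>2)"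
      using mult_left_mono[OF s2, of "\<rho>\<^sup>2 / 16"] by (simp add: algebra_simps)
    ultimately show ?thesis unfolding exp_le_cancel_iff by linarith
  qed
  finally show ?thesis .
qed

text \<open>The violation probability is bounded from below by comparing the tilted mass of
  \<open>A \<times> D\<close> (reverse inequality) with its part on \<open>ip \<ge> 0\<close>, where the kernel is small, and its part
  on \<open>ip < 0\<close>, controlled through the second moment of the kernel (forward inequality).\<close>

lemma overlap_violation:
  fixes A :: "(nat \<Rightarrow> real) set"
  assumes \<rho>: "0 < \<rho>" "\<rho> \<le> 1/16" "\<rho> * r \<ge> 1"
    and r1: "65536 * \<rho>\<^sup>2 * real d \<le> r" and r2: "r \<le> real d / 4" and r3: "3072 * (\<rho> * r) \<le> real d" and r4: "2 \<le> r"
    and r5: "42 * r \<le> \<rho> * real d * (exp (- 32) / (32 * 16 ^ 4))"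
    and A: "A \<in> sets (std_gaussian d)" "exp (- r) \<le> measure (std_gaussian d) A"
    and \<delta>: "\<delta> = exp (- 64 * \<rho> * r - 100 * \<rho>\<^sup>2 * real d - 4)"
  shows "measure (std_gaussian d) {y \<in> space (std_gaussian d).
      measure (std_gaussian d) {x \<in> A. ip d x y < 0} \<le> \<delta> * measure (std_gaussian d) A} \<le> exp (- r)"
proof (rule ccontr)
  let ?G = "std_gaussian d"
  interpret prob_space ?G by (rule prob_space_std_gaussian)
  define B where "B = 1 / (4 * sqrt \<rho>)"
  define b :: real where "b = exp (- 8) / 16"
  interpret T: truncated_subgaussian stdN "trunc B" \<rho> B
    unfolding B_def by (rule truncated_subgaussian_stdN) (use \<rho> in auto)
  define D where "D = {y \<in> space ?G. prob {x \<in> A. ip d x y < 0} \<le> \<delta> * prob A}"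
  note A(1) [measurable]
  have Asub: "A \<subseteq> space ?G" using A(1) by (rule sets.sets_into_space)
  have mV: "(\<lambda>y. prob {x \<in> A. ip d x y < 0}) \<in> borel_measurable ?G"
  proof -
    have "{x \<in> A. ip d x y < 0} = Pair y -` {w \<in> space (?G \<Otimes>\<^sub>M ?G). snd w \<in> A \<and> ip d (snd w) (fst w) < 0}"
      if "y \<in> space ?G" for y
      using that Asub by (auto simp: space_pair_measure)
    moreover have "(\<lambda>y. prob (Pair y -` {w \<in> space (?G \<Otimes>\<^sub>M ?G). snd w \<in> A \<and> ip d (snd w) (fst w) < 0})) \<in> borel_measurable ?G"
      unfolding measure_def by (intro borel_measurable_enn2real measurable_emeasure_Pair) measurable
    ultimately show ?thesis by (simp cong: measurable_cong)
  qed
  then have D [measurable]: "D \<in> sets ?G" unfolding D_def by measurable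
  assume "\<not> measure ?G {y \<in> space ?G. measure ?G {x \<in> A. ip d x y < 0} \<le> \<delta> * measure ?G A} \<le> exp (- r)"
  then have Dr: "exp (- r) < prob D" by (simp add: D_def)
  define T where "T = typical d B b r"
  have [measurable]: "T \<in> sets ?G" unfolding T_def by measurable
  have "1 - 2 * exp (- 2 * r) \<le> prob T"
    unfolding T_def by (rule typical_prob[OF \<rho>(1) B_def b_def r1 r2])
  moreover have "2 * exp (- 2 * r) \<le> exp (- r) / 2"
  proof -
    have "(4::real) \<le> exp 2" using exp_lower_Taylor_quadratic[of "2::real"] by simp
    also have "\<dots> \<le> exp r" using r4 by simp
    finally have "4 * exp (- 2 * r) \<le> exp r * exp (- 2 * r)" by (intro mult_right_mono) auto
    then show ?thesis by (simp add: mult_exp_exp)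
  qed
  ultimately have Tc: "prob (space ?G - T) \<le> exp (- r) / 2" using prob_compl[of T] by simp
  \<comment> \<open>The atypical part has measure at most exp (- r) / 2, hence at most half that of
    \<open>S\<close>. The lost factor 2 is then absorbed by weakening exp (- r) to exp (- 2 *
    r).\<close>
  have half: "prob S / 2 \<le> prob (S \<inter> T)" "exp (- 2 * r) \<le> prob (S \<inter> T)"
    if [measurable]: "S \<in> sets ?G" and "exp (- r) \<le> prob S" for S
  proof -
    have "S \<subseteq> (S \<inter> T) \<union> (space ?G - T)" using sets.sets_into_space[OF that(1)] by auto
    then have "prob S \<le> prob ((S \<inter> T) \<union> (space ?G - T))" by (intro finite_measure_mono) measurable
    also have "\<dots> \<le> prob (S \<inter> T) + prob (space ?G - T)" by (rule measure_Un_le) measurable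
    finally show *: "prob S / 2 \<le> prob (S \<inter> T)" using Tc that by simp
    have "2 \<le> exp r" using exp_ge_add_one_self[of r] r4 by linarith
    then have "2 * exp (- 2 * r) \<le> exp r * exp (- 2 * r)" by (intro mult_right_mono) auto
    then show "exp (- 2 * r) \<le> prob (S \<inter> T)" using * that(2) by (simp add: mult_exp_exp)
  qed
  \<comment> \<open>Indicators do not change under powers (\<open>fp\<close>), so the reverse
    inequality with exponent 1 + 4 * \<rho> and the forward one with exponent 1 - 8 * \<rho> speak
    about the same pair of functions.\<close>
  define f g :: "(nat \<Rightarrow> real) \<Rightarrow> real" where "f = indicator (A \<inter> T)" and "g = indicator (D \<inter> T)"
  have [measurable]: "f \<in> borel_measurable ?G" "g \<in> borel_measurable ?G" unfolding f_def g_def by measurable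
  have fg: "0 \<le> f x \<and> f x \<le> 1" "0 \<le> g x \<and> g x \<le> 1" for x by (auto simp: f_def g_def indicator_def)
  have fp: "f x powr s = f x" "g x powr s = g x" for x s by (auto simp: f_def g_def indicator_def)
  define \<alpha> \<beta> where "\<alpha> = prob (A \<inter> T)" and "\<beta> = prob (D \<inter> T)"
  have \<alpha>: "prob A / 2 \<le> \<alpha>" "exp (- 2 * r) \<le> \<alpha>" unfolding \<alpha>_def using half[OF A] by auto
  have \<beta>: "exp (- 2 * r) \<le> \<beta>" unfolding \<beta>_def using half[of D] Dr by auto
  have pos: "0 < \<alpha>" "0 < \<beta>" using \<alpha>(2) \<beta> by (auto intro: less_le_trans[OF exp_gt_zero])
  have If: "(\<integral>x. f x \<partial>?G) = \<alpha>" "(\<integral>x. g x \<partial>?G) = \<beta>" by (auto simp: f_def g_def \<alpha>_def \<beta>_def)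
  define H where "H = T.pkern {1..d}"
  have H0: "0 \<le> H x y" for x y unfolding H_def by simp
  have [measurable (raw)]: "(\<lambda>w. H (u w) (v w)) \<in> borel_measurable N"
    if "u \<in> measurable N ?G" "v \<in> measurable N ?G" for u v and N :: "'x measure"
    unfolding H_def using that unfolding std_gaussian_def by (rule T.measurable_pkern)
  \<comment> \<open>\<open>Z\<close> is the guaranteed mean of the kernel, exp (- 4 * r) to the
    power 4 * \<rho>, and \<open>L\<close> is the price of the second moment.
    \<open>\<theta>\<close> is tuned so that the second-moment term is at most \<open>Z\<close> / 4:
    the power -8 * \<rho> of the product of measures contributes exp (32 * \<rho> * r), and 48 = 32
    + 16.\<close>
  define Z where "Z = exp (- 16 * \<rho> * r)"
  define L where "L = exp (100 * \<rho>\<^sup>2 * real d)"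
  define \<theta> where "\<theta> = exp (- 48 * \<rho> * r) / (4 * L)"
  have \<theta>: "0 < \<theta>" by (simp add: \<theta>_def L_def)
  define \<Lambda> where "\<Lambda> = exp (24 * \<rho> * r - \<rho>\<^sup>2 * real d * (b ^ 4 / 32))"
  have lower: "ennreal (\<alpha> powr (1 + 4 * \<rho>) * \<beta> powr (1 + 4 * \<rho>)) \<le> (\<integral>\<^sup>+x. \<integral>\<^sup>+y. ennreal (f x * g y * H x y) \<partial>?G \<partial>?G)"
    using T.reverse_product[OF _ refl, of "{1..d}" f g, folded std_gaussian_def] fg
    by (simp add: fp H_def If)
  have upper: "(\<integral>\<^sup>+x. \<integral>\<^sup>+y. ennreal (f x * g y * (H x y)\<^sup>2) \<partial>?G \<partial>?G)
      \<le> ennreal (L * (\<alpha> powr (1 - 8 * \<rho>) * \<beta> powr (1 - 8 * \<rho>)))"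
  proof -
    have "(1 + 100 * \<rho>\<^sup>2) ^ d \<le> L" unfolding L_def
      using one_plus_power_le_exp[of "100 * \<rho>\<^sup>2" d] by (simp add: mult_ac)
    then have "ennreal ((1 + 100 * \<rho>\<^sup>2) ^ d * (\<alpha> powr (1 - 8 * \<rho>) * \<beta> powr (1 - 8 * \<rho>)))
       \<le> ennreal (L * (\<alpha> powr (1 - 8 * \<rho>) * \<beta> powr (1 - 8 * \<rho>)))"
      by (intro ennreal_leI mult_right_mono) auto
    then show ?thesis
      using T.forward_product[OF _ refl, of "{1..d}" f g, folded std_gaussian_def] fg
      by (simp add: fp H_def If)
  qed
  define V where "V x y = (if ip d x y < 0 then 1 else 0 :: real)" for x y
  have [measurable (raw)]: "(\<lambda>w. V (u w) (v w)) \<in> borel_measurable N"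
    if [measurable]: "u \<in> measurable N ?G" "v \<in> measurable N ?G" for u v and N :: "'x measure"
    unfolding V_def by measurable
  \<comment> \<open>With y outermost, membership in \<open>D\<close> bounds the inner integral. The
    factor 2 is the loss from \<open>A\<close> to its typical part.\<close>
  have viol: "(\<integral>\<^sup>+x. \<integral>\<^sup>+y. ennreal (f x * g y * V x y) \<partial>?G \<partial>?G) \<le> ennreal (2 * \<delta> * (\<alpha> * \<beta>))"
  proof -
    interpret PP: pair_prob_space ?G ?G ..
    have "(\<integral>\<^sup>+x. \<integral>\<^sup>+y. ennreal (f x * g y * V x y) \<partial>?G \<partial>?G)
        = (\<integral>\<^sup>+y. \<integral>\<^sup>+x. ennreal (f x * g y * V x y) \<partial>?G \<partial>?G)"
      by (rule PP.Fubini') measurable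
    also have "\<dots> \<le> (\<integral>\<^sup>+y. ennreal (\<delta> * prob A) * indicator (D \<inter> T) y \<partial>?G)"
    proof (rule nn_integral_mono)
      fix y assume y: "y \<in> space ?G"
      show "(\<integral>\<^sup>+x. ennreal (f x * g y * V x y) \<partial>?G) \<le> ennreal (\<delta> * prob A) * indicator (D \<inter> T) y"
      proof (cases "y \<in> D \<inter> T")
        case True
        have [measurable]: "{x \<in> A. ip d x y < 0} \<in> sets ?G"
        proof -
          have "{x \<in> A. ip d x y < 0} = A \<inter> {x \<in> space ?G. ip d x y < 0}" using Asub by auto
          also have "\<dots> \<in> sets ?G" using y by measurable
          finally show ?thesis .
        qed
        have "(\<integral>\<^sup>+x. ennreal (f x * g y * V x y) \<partial>?G) \<le> (\<integral>\<^sup>+x. indicator {x \<in> A. ip d x y < 0} x \<partial>?G)"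
          by (rule nn_integral_mono) (auto simp: f_def g_def V_def indicator_def)
        also have "\<dots> = ennreal (prob {x \<in> A. ip d x y < 0})" by (simp add: emeasure_eq_measure)
        also have "\<dots> \<le> ennreal (\<delta> * prob A)" using True by (intro ennreal_leI) (auto simp: D_def)
        finally show ?thesis using True by simp
      qed (simp add: g_def)
    qed
    also have "\<dots> = ennreal (\<delta> * prob A) * ennreal \<beta>"
      by (subst nn_integral_cmult_indicator) (auto simp: emeasure_eq_measure \<beta>_def)
    also have "\<dots> = ennreal (\<delta> * prob A * \<beta>)" using pos \<delta> by (intro ennreal_mult'[symmetric]) auto
    also have "\<dots> \<le> ennreal (2 * \<delta> * (\<alpha> * \<beta>))"
    proof (rule ennreal_leI)
      have "\<delta> * prob A * \<beta> \<le> \<delta> * (2 * \<alpha>) * \<beta>" using \<alpha>(1) pos \<delta> by (intro mult_right_mono mult_left_mono) auto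
      then show "\<delta> * prob A * \<beta> \<le> 2 * \<delta> * (\<alpha> * \<beta>)" by (simp add: mult_ac)
    qed
    finally show ?thesis .
  qed
  have const: "(\<integral>\<^sup>+x. \<integral>\<^sup>+y. ennreal (f x * g y) \<partial>?G \<partial>?G) = ennreal (\<alpha> * \<beta>)"
  proof -
    have "(\<integral>\<^sup>+x. \<integral>\<^sup>+y. ennreal (f x * g y) \<partial>?G \<partial>?G) = (\<integral>\<^sup>+x. indicator (A \<inter> T) x * ennreal \<beta> \<partial>?G)"
    proof (intro nn_integral_cong)
      fix x
      have "(\<integral>\<^sup>+y. ennreal (f x * g y) \<partial>?G) = (\<integral>\<^sup>+y. indicator (A \<inter> T) x * indicator (D \<inter> T) y \<partial>?G)"
        by (intro nn_integral_cong) (auto simp: f_def g_def indicator_def)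
      also have "\<dots> = indicator (A \<inter> T) x * ennreal \<beta>"
        by (subst nn_integral_cmult) (auto simp: emeasure_eq_measure \<beta>_def)
      finally show "(\<integral>\<^sup>+y. ennreal (f x * g y) \<partial>?G) = indicator (A \<inter> T) x * ennreal \<beta>" .
    qed
    also have "\<dots> = ennreal \<alpha> * ennreal \<beta>"
      by (subst nn_integral_multc) (auto simp: emeasure_eq_measure \<alpha>_def)
    also have "\<dots> = ennreal (\<alpha> * \<beta>)" using pos by (intro ennreal_mult'[symmetric]) auto
    finally show ?thesis .
  qed
  \<comment> \<open>On violating pairs AM-GM trades the kernel for \<theta> times its square plus a
    constant over \<theta>; all other typical pairs fall under the pointwise bound
    \<open>\<Lambda>\<close>.\<close>
  have pt: "f x * g y * H x y \<le> \<Lambda> * (f x * g y) + \<theta> * (f x * g y * (H x y)\<^sup>2) + (1 / \<theta>) * (f x * g y * V x y)" for x y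
  proof (cases "x \<in> A \<inter> T \<and> y \<in> D \<inter> T")
    case True
    then have one: "f x = 1" "g y = 1" by (auto simp: f_def g_def)
    show ?thesis
    proof (cases "ip d x y < 0")
      case True
      have "0 \<le> (2 * \<theta> * H x y - 1)\<^sup>2 / (4 * \<theta>)" using \<theta> by auto
      also have "\<dots> = \<theta> * (H x y)\<^sup>2 - H x y + 1 / (4 * \<theta>)" using \<theta> by (simp add: power2_eq_square field_simps)
      finally have "H x y \<le> \<theta> * (H x y)\<^sup>2 + 1 / (4 * \<theta>)" by simp
      moreover have "1 / (4 * \<theta>) \<le> 1 / \<theta>" using \<theta> by (simp add: field_simps)
      moreover have "0 \<le> \<Lambda>" by (simp add: \<Lambda>_def)
      ultimately show ?thesis using True one by (simp add: V_def)
    next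
      case False
      have "H x y \<le> \<Lambda>" unfolding H_def \<Lambda>_def
        by (rule pkern_typical_le[OF \<rho>(1,2) B_def]) (use True False r3 in \<open>auto simp: T_def b_def\<close>)
      then show ?thesis using False one \<theta> by (simp add: V_def add_increasing2)
    qed
  qed (auto simp: f_def g_def)
  have "ennreal (\<alpha> powr (1 + 4 * \<rho>) * \<beta> powr (1 + 4 * \<rho>))
      \<le> (\<integral>\<^sup>+x. \<integral>\<^sup>+y. ennreal (f x * g y * H x y) \<partial>?G \<partial>?G)" by (rule lower)
  also have "\<dots> \<le> (\<integral>\<^sup>+x. \<integral>\<^sup>+y. ennreal (f x * g y) * ennreal \<Lambda> + ennreal (f x * g y * (H x y)\<^sup>2) * ennreal \<theta>
      + ennreal (f x * g y * V x y) * ennreal (1 / \<theta>) \<partial>?G \<partial>?G)"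
  proof (intro nn_integral_mono)
    fix x y
    have "ennreal (f x * g y * H x y) \<le> ennreal (\<Lambda> * (f x * g y) + \<theta> * (f x * g y * (H x y)\<^sup>2) + (1 / \<theta>) * (f x * g y * V x y))"
      by (rule ennreal_leI[OF pt])
    also have "\<dots> = ennreal (\<Lambda> * (f x * g y)) + ennreal (\<theta> * (f x * g y * (H x y)\<^sup>2)) + ennreal ((1 / \<theta>) * (f x * g y * V x y))"
      using fg(1)[of x] fg(2)[of y] \<theta> by (subst ennreal_plus[symmetric]; auto simp: \<Lambda>_def V_def)+
    also have "\<dots> = ennreal (f x * g y) * ennreal \<Lambda> + ennreal (f x * g y * (H x y)\<^sup>2) * ennreal \<theta>
      + ennreal (f x * g y * V x y) * ennreal (1 / \<theta>)"
    proof -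
      have nn: "0 \<le> \<Lambda>" "0 \<le> \<theta>" "0 \<le> 1 / \<theta>" using \<theta> by (auto simp: \<Lambda>_def)
      show ?thesis by (simp only: ennreal_mult'[OF nn(1)] ennreal_mult'[OF nn(2)] ennreal_mult'[OF nn(3)]) (simp only: ac_simps)
    qed
    finally show "ennreal (f x * g y * H x y) \<le> \<dots>" .
  qed
  also have "\<dots> = (\<integral>\<^sup>+x. \<integral>\<^sup>+y. ennreal (f x * g y) \<partial>?G \<partial>?G) * ennreal \<Lambda>
      + (\<integral>\<^sup>+x. \<integral>\<^sup>+y. ennreal (f x * g y * (H x y)\<^sup>2) \<partial>?G \<partial>?G) * ennreal \<theta>
      + (\<integral>\<^sup>+x. \<integral>\<^sup>+y. ennreal (f x * g y * V x y) \<partial>?G \<partial>?G) * ennreal (1 / \<theta>)"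
  proof -
    have add: "(\<integral>\<^sup>+x. \<integral>\<^sup>+y. P x y + Q x y \<partial>?G \<partial>?G) = (\<integral>\<^sup>+x. \<integral>\<^sup>+y. P x y \<partial>?G \<partial>?G) + (\<integral>\<^sup>+x. \<integral>\<^sup>+y. Q x y \<partial>?G \<partial>?G)"
      if P: "(\<lambda>w. P (fst w) (snd w)) \<in> borel_measurable (?G \<Otimes>\<^sub>M ?G)" and Q: "(\<lambda>w. Q (fst w) (snd w)) \<in> borel_measurable (?G \<Otimes>\<^sub>M ?G)" for P Q
    proof -
      have "(\<integral>\<^sup>+x. \<integral>\<^sup>+y. P x y + Q x y \<partial>?G \<partial>?G) = (\<integral>\<^sup>+x. (\<integral>\<^sup>+y. P x y \<partial>?G) + (\<integral>\<^sup>+y. Q x y \<partial>?G) \<partial>?G)"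
        using measurable_Pair2[OF P] measurable_Pair2[OF Q]
        by (intro nn_integral_cong nn_integral_add) auto
      also have "\<dots> = (\<integral>\<^sup>+x. \<integral>\<^sup>+y. P x y \<partial>?G \<partial>?G) + (\<integral>\<^sup>+x. \<integral>\<^sup>+y. Q x y \<partial>?G \<partial>?G)"
        using borel_measurable_nn_integral[of P ?G] borel_measurable_nn_integral[of Q ?G] P Q
        by (intro nn_integral_add) (auto simp: split_beta')
      finally show ?thesis .
    qed
    show ?thesis
      by (subst add, measurable, subst add, measurable)
        (intro arg_cong2[where f = "(+)"] nn_integral_pair_multc; measurable)
  qed
  also have "\<dots> \<le> ennreal (\<alpha> * \<beta>) * ennreal \<Lambda> + ennreal (L * (\<alpha> powr (1 - 8 * \<rho>) * \<beta> powr (1 - 8 * \<rho>))) * ennreal \<theta>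
      + ennreal (2 * \<delta> * (\<alpha> * \<beta>)) * ennreal (1 / \<theta>)"
    unfolding const by (intro add_mono mult_right_mono upper viol) auto
  also have "\<dots> = ennreal (\<alpha> * \<beta> * \<Lambda> + L * (\<alpha> powr (1 - 8 * \<rho>) * \<beta> powr (1 - 8 * \<rho>)) * \<theta> + 2 * \<delta> * (\<alpha> * \<beta>) * (1 / \<theta>))"
    using pos \<theta> by (subst ennreal_mult'[symmetric] ennreal_plus[symmetric]; simp add: \<Lambda>_def L_def \<delta>)+
  finally have main: "\<alpha> powr (1 + 4 * \<rho>) * \<beta> powr (1 + 4 * \<rho>)
      \<le> \<alpha> * \<beta> * \<Lambda> + L * (\<alpha> powr (1 - 8 * \<rho>) * \<beta> powr (1 - 8 * \<rho>)) * \<theta> + 2 * \<delta> * (\<alpha> * \<beta>) * (1 / \<theta>)"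
    by (subst (asm) ennreal_le_iff) (use pos \<theta> in \<open>auto simp: \<Lambda>_def L_def \<delta>\<close>)
  define ab where "ab = \<alpha> * \<beta>"
  have ab: "0 < ab" "exp (- 4 * r) \<le> ab"
  proof -
    show "0 < ab" using pos by (simp add: ab_def)
    have "exp (- 2 * r) * exp (- 2 * r) \<le> ab" unfolding ab_def using \<alpha>(2) \<beta> pos by (intro mult_mono) auto
    then show "exp (- 4 * r) \<le> ab" by (simp add: mult_exp_exp)
  qed
  have e1: "\<alpha> powr (1 + 4 * \<rho>) * \<beta> powr (1 + 4 * \<rho>) = ab * ab powr (4 * \<rho>)"
    "\<alpha> powr (1 - 8 * \<rho>) * \<beta> powr (1 - 8 * \<rho>) = ab * ab powr (- (8 * \<rho>))"
    using pos ab by (simp_all add: ab_def powr_mult powr_add powr_diff powr_minus field_simps)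
  have "ab * ab powr (4 * \<rho>) \<le> ab * (\<Lambda> + L * ab powr (- (8 * \<rho>)) * \<theta> + 2 * \<delta> / \<theta>)"
    using main unfolding e1 ab_def[symmetric] by (simp add: algebra_simps)
  \<comment> \<open>Contradiction ahead: the left side is at least \<open>Z\<close>, the last two
    terms on the right are at most \<open>Z\<close> / 4 each, and \<open>\<Lambda>\<close> is less
    than \<open>Z\<close> / 2.\<close>
  then have "ab powr (4 * \<rho>) \<le> \<Lambda> + L * ab powr (- (8 * \<rho>)) * \<theta> + 2 * \<delta> / \<theta>"
    using ab(1) by simp
  moreover have "Z \<le> ab powr (4 * \<rho>)"
  proof -
    have "Z = exp (- 4 * r) powr (4 * \<rho>)" by (simp add: Z_def exp_powr_real)
    also have "\<dots> \<le> ab powr (4 * \<rho>)" using ab \<rho> by (intro powr_mono2) auto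
    finally show ?thesis .
  qed
  moreover have "L * ab powr (- (8 * \<rho>)) * \<theta> \<le> Z / 4"
  proof -
    have "ab powr (- (8 * \<rho>)) \<le> exp (- 4 * r) powr (- (8 * \<rho>))" using ab \<rho> by (intro powr_mono2') auto
    also have "\<dots> = exp (32 * \<rho> * r)" by (simp add: exp_powr_real)
    finally have "L * ab powr (- (8 * \<rho>)) * \<theta> \<le> L * exp (32 * \<rho> * r) * \<theta>"
      using \<theta> by (intro mult_right_mono mult_left_mono) (auto simp: L_def)
    also have "\<dots> = exp (32 * \<rho> * r) * exp (- 48 * \<rho> * r) / 4" by (simp add: \<theta>_def L_def)
    also have "\<dots> = Z / 4" by (simp add: Z_def mult_exp_exp)
    finally show ?thesis .
  qed
  moreover have "2 * \<delta> / \<theta> \<le> Z / 4"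
  proof -
    have "2 * \<delta> / \<theta> = 8 * exp (- 16 * \<rho> * r - 4)"
      by (simp add: \<delta> \<theta>_def L_def exp_diff exp_minus field_simps flip: exp_add)
    also have "\<dots> = 8 * exp (- 4) * Z" by (simp add: Z_def exp_diff exp_minus field_simps)
    also have "\<dots> \<le> 1 / 4 * Z"
    proof (rule mult_right_mono)
      have "(32::real) \<le> exp 4"
      proof -
        have "(13 / 8 :: real) \<le> exp (1/2)" using exp_lower_Taylor_quadratic[of "1/2::real"] by (simp add: power2_eq_square)
        then have "(13 / 8) ^ 8 \<le> exp (1/2 :: real) ^ 8" by (intro power_mono) auto
        also have "\<dots> = exp 4" by (simp add: exp_of_nat_mult[symmetric])
        finally show ?thesis by (simp add: power_divide)
      qed
      then show "8 * exp (- 4) \<le> (1 / 4 :: real)" by (simp add: exp_minus field_simps)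
    qed (simp add: Z_def)
    finally show ?thesis by simp
  qed
  moreover have "\<Lambda> < Z / 2"
  proof -
    \<comment> \<open>42 = 24 + 16 + 2: the first part cancels the truncation loss, the second
      matches \<open>Z\<close>, and the third gives the factor exp (- 2) since \<rho> * r \<ge>
      1.\<close>
    have "42 * (\<rho> * r) \<le> \<rho>\<^sup>2 * real d * (b ^ 4 / 32)"
    proof -
      have "b ^ 4 / 32 = exp (- 32) / (32 * 16 ^ 4)" by (simp add: b_def power_divide exp_of_nat_mult[symmetric])
      show ?thesis using mult_left_mono[OF r5, of \<rho>] \<rho>
        unfolding \<open>b ^ 4 / 32 = exp (- 32) / (32 * 16 ^ 4)\<close> by (simp add: power2_eq_square mult_ac)
    qed
    then have "\<Lambda> \<le> exp (- 16 * \<rho> * r - 2)" unfolding \<Lambda>_def using \<rho>(3) by simp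
    also have "\<dots> = exp (- 2) * Z" by (simp add: Z_def exp_diff exp_minus field_simps)
    also have "\<dots> < 1 / 2 * Z"
    proof (rule mult_strict_right_mono)
      have "(3::real) \<le> exp 2" using exp_ge_add_one_self[of "2::real"] by simp
      then show "exp (- 2) < (1 / 2 :: real)" by (simp add: exp_minus field_simps)
    qed (simp add: Z_def)
    finally show ?thesis by simp
  qed
  ultimately show False by linarith
qed

section \<open>Upper bound\<close>

interpretation stdG: product_sigma_finite "\<lambda>_ :: nat. std_gaussian d" for d
  by (rule product_sigma_finite.intro) (rule prob_space_imp_sigma_finite[OF prob_space_std_gaussian])

lemma prob_space_PiM_std_gaussian: "prob_space (PiM I (\<lambda>_ :: nat. std_gaussian d))"
  by (intro prob_space_PiM prob_space_std_gaussian)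

lemma prob_space_gaussian_sample: "prob_space (gaussian_sample n d)"
  unfolding gaussian_sample_def by (rule prob_space_PiM_std_gaussian)

lemma measurable_sample_component [measurable]:
  "i \<in> {1..n} \<Longrightarrow> (\<lambda>X. X i) \<in> measurable (gaussian_sample n d) (std_gaussian d)"
  unfolding gaussian_sample_def by measurable

lemma complete_event_sets [measurable]: "complete_event n d t \<in> sets (gaussian_sample n d)"
proof -
  have "complete_event n d t = {X \<in> space (gaussian_sample n d).
      \<forall>(i, j) \<in> {(i, j). i \<in> {1..n} \<and> j \<in> {1..n} \<and> i \<noteq> j}. t \<le> ip d (X i) (X j)}"
    by (auto simp: complete_event_def)
  also have "\<dots> \<in> sets (gaussian_sample n d)"
  proof (rule sets.sets_Collect_finite_All)
    show "finite {(i, j). i \<in> {1..n} \<and> j \<in> {1..n} \<and> i \<noteq> j}"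
      by (rule finite_subset[of _ "{1..n} \<times> {1..n}"]) auto
  qed (use atLeastAtMost_iff in \<open>auto intro!: borel_measurable_le measurable_ip\<close>)
  finally show ?thesis .
qed

lemma measurable_section_measure:
  assumes S: "{w \<in> space (N \<Otimes>\<^sub>M std_gaussian d). P (fst w) (snd w)} \<in> sets (N \<Otimes>\<^sub>M std_gaussian d)"
  shows "(\<lambda>y. measure (std_gaussian d) {x \<in> space (std_gaussian d). P y x}) \<in> borel_measurable N"
proof -
  interpret prob_space "std_gaussian d" by (rule prob_space_std_gaussian)
  have "(\<lambda>y. prob (Pair y -` {w \<in> space (N \<Otimes>\<^sub>M std_gaussian d). P (fst w) (snd w)})) \<in> borel_measurable N"
    unfolding measure_def
    by (intro borel_measurable_enn2real
        sigma_finite_measure.measurable_emeasure_Pair[OF prob_space_imp_sigma_finite[OF prob_space_std_gaussian]] S)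
  moreover have "Pair y -` {w \<in> space (N \<Otimes>\<^sub>M std_gaussian d). P (fst w) (snd w)} = {x \<in> space (std_gaussian d). P y x}"
    if "y \<in> space N" for y using that by (auto simp: space_pair_measure)
  ultimately show ?thesis by (simp cong: measurable_cong)
qed

text \<open>\<open>A\<close> is the cone left after some vectors; it varies in the induction, since
  each new vector intersects it with a half-space. Once its measure is below exp (- r), the N-th
  power is at most exp (- r * N) and can only decrease. This summand passes through the remaining
  averages unchanged, because they are taken over probability measures, so it occurs once and not
  once per step.\<close>

lemma dual_cone_recursion:
  assumes two_set: "\<And>A. A \<in> sets (std_gaussian d) \<Longrightarrow> exp (- r) \<le> measure (std_gaussian d) A \<Longrightarrow>
      measure (std_gaussian d) {y \<in> space (std_gaussian d). measure (std_gaussian d) {x \<in> A. ip d x y < 0}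
        \<le> \<delta> * measure (std_gaussian d) A} \<le> exp (- r)"
    and \<delta>: "0 < \<delta>" "\<delta> \<le> 1" and r: "0 \<le> r"
    and I: "finite I" and A: "A \<in> sets (std_gaussian d)"
  shows "(\<integral>\<^sup>+Y. ennreal (measure (std_gaussian d) {x \<in> A. \<forall>i\<in>I. 0 \<le> ip d x (Y i)} ^ N) \<partial>PiM I (\<lambda>_ :: nat. std_gaussian d))
    \<le> ennreal (measure (std_gaussian d) A ^ N * (exp (- r) + exp (- \<delta> * real N)) ^ card I + exp (- r * real N))"
  using I A
proof (induction I arbitrary: A rule: finite_induct)
  case empty
  interpret prob_space "PiM {} (\<lambda>_ :: nat. std_gaussian d)" by (rule prob_space_PiM_std_gaussian)
  show ?case by (simp add: emeasure_space_1)
next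
  case (insert i I)
  let ?G = "std_gaussian d"
  interpret prob_space ?G by (rule prob_space_std_gaussian)
  note A [measurable] = insert.prems
  have Asub: "A \<subseteq> space ?G" using A by (rule sets.sets_into_space)
  define w where "w = exp (- r) + exp (- \<delta> * real N)"
  have w: "0 \<le> w" by (simp add: w_def)
  have half [measurable]: "{x \<in> A. 0 \<le> ip d x y} \<in> sets ?G" "{x \<in> A. ip d x y < 0} \<in> sets ?G" if [measurable]: "y \<in> space ?G" for y
  proof -
    have "{x \<in> A. 0 \<le> ip d x y} = A \<inter> {x \<in> space ?G. 0 \<le> ip d x y}"
      "{x \<in> A. ip d x y < 0} = A \<inter> {x \<in> space ?G. ip d x y < 0}" using Asub by auto
    then show "{x \<in> A. 0 \<le> ip d x y} \<in> sets ?G" "{x \<in> A. ip d x y < 0} \<in> sets ?G" by simp_all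
  qed
  show ?case
  proof (cases "exp (- r) \<le> prob A")
    case False
    interpret Q: prob_space "PiM (insert i I) (\<lambda>_ :: nat. ?G)" by (rule prob_space_PiM_std_gaussian)
    have "(\<integral>\<^sup>+Y. ennreal (prob {x \<in> A. \<forall>j\<in>insert i I. 0 \<le> ip d x (Y j)} ^ N) \<partial>PiM (insert i I) (\<lambda>_. ?G))
        \<le> (\<integral>\<^sup>+Y. ennreal (exp (- r * real N)) \<partial>PiM (insert i I) (\<lambda>_ :: nat. ?G))"
    proof (intro nn_integral_mono ennreal_leI)
      fix Y
      have "prob {x \<in> A. \<forall>j\<in>insert i I. 0 \<le> ip d x (Y j)} \<le> prob A"
        by (intro finite_measure_mono) auto
      also have "\<dots> \<le> exp (- r)" using False by simp
      finally have "prob {x \<in> A. \<forall>j\<in>insert i I. 0 \<le> ip d x (Y j)} ^ N \<le> exp (- r) ^ N" by (intro power_mono) auto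
      then show "prob {x \<in> A. \<forall>j\<in>insert i I. 0 \<le> ip d x (Y j)} ^ N \<le> exp (- r * real N)"
        by (simp add: exp_of_nat_mult[symmetric] mult.commute)
    qed
    also have "\<dots> = ennreal (exp (- r * real N))" by (simp add: Q.emeasure_space_1)
    also have "\<dots> \<le> ennreal (prob A ^ N * w ^ card (insert i I) + exp (- r * real N))"
      using w by (intro ennreal_leI) simp
    finally show ?thesis unfolding w_def .
  next
    case True
    define D where "D = {y \<in> space ?G. prob {x \<in> A. ip d x y < 0} \<le> \<delta> * prob A}"
    have D [measurable]: "D \<in> sets ?G"
    proof -
      have "(\<lambda>y. prob {x \<in> space ?G. x \<in> A \<and> ip d x y < 0}) \<in> borel_measurable ?G"
        by (rule measurable_section_measure) measurable
      moreover have "{x \<in> A. ip d x y < 0} = {x \<in> space ?G. x \<in> A \<and> ip d x y < 0}" for y using Asub by auto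
      ultimately show ?thesis unfolding D_def by simp
    qed
    \<comment> \<open>Outside \<open>D\<close> a factor (1 - \<delta>)^N \<le> exp (- \<delta> * N)
      is gained; inside \<open>D\<close> nothing is gained, but \<open>D\<close> has measure at most
      exp (- r). The average of the bracket is therefore at most \<open>w\<close>.\<close>
    have step: "prob {x \<in> A. 0 \<le> ip d x y} ^ N \<le> prob A ^ N * (indicator D y + exp (- \<delta> * real N))"
      if y: "y \<in> space ?G" for y
    proof (cases "y \<in> D")
      case True
      have "prob {x \<in> A. 0 \<le> ip d x y} ^ N \<le> prob A ^ N"
        by (intro power_mono finite_measure_mono) auto
      also have "\<dots> \<le> prob A ^ N * (1 + exp (- \<delta> * real N))"
        using mult_left_mono[of 1 "1 + exp (- \<delta> * real N)" "prob A ^ N"] by simp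
      finally show ?thesis using True by simp
    next
      case False
      have "prob A = prob ({x \<in> A. 0 \<le> ip d x y} \<union> {x \<in> A. ip d x y < 0})"
        by (intro arg_cong[where f = prob]) auto
      also have "\<dots> = prob {x \<in> A. 0 \<le> ip d x y} + prob {x \<in> A. ip d x y < 0}"
        by (rule finite_measure_Union) (use half[OF y] in auto)
      finally have "prob {x \<in> A. 0 \<le> ip d x y} \<le> (1 - \<delta>) * prob A"
        using False y by (simp add: D_def algebra_simps)
      also have "\<dots> \<le> exp (- \<delta>) * prob A"
        using exp_ge_add_one_self[of "- \<delta>"] by (intro mult_right_mono) auto
      finally have "prob {x \<in> A. 0 \<le> ip d x y} ^ N \<le> (exp (- \<delta>) * prob A) ^ N" by (intro power_mono) auto
      then show ?thesis using False by (simp add: power_mult_distrib exp_of_nat_mult[symmetric] mult.commute)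
    qed
    have cone_eq: "{x \<in> A. \<forall>j\<in>insert i I. 0 \<le> ip d x ((Y(i := y)) j)} = {x \<in> {x \<in> A. 0 \<le> ip d x y}. \<forall>j\<in>I. 0 \<le> ip d x (Y j)}"
      for Y y using insert.hyps by auto
    have meas: "(\<lambda>Y. ennreal (prob {x \<in> A. \<forall>j\<in>insert i I. 0 \<le> ip d x (Y j)} ^ N)) \<in> borel_measurable (PiM (insert i I) (\<lambda>_. ?G))"
    proof -
      have "(\<lambda>Y. prob {x \<in> space ?G. x \<in> A \<and> (\<forall>j\<in>insert i I. 0 \<le> ip d x (Y j))}) \<in> borel_measurable (PiM (insert i I) (\<lambda>_. ?G))"
      proof (rule measurable_section_measure)
        have [measurable]: "countable (insert i I)" using insert.hyps by (simp add: countable_finite)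
        have [measurable]: "(\<lambda>w. fst w j) \<in> measurable (PiM (insert i I) (\<lambda>_. ?G) \<Otimes>\<^sub>M ?G) ?G" if "j \<in> insert i I" for j
          using that by measurable
        have "{w \<in> space (PiM (insert i I) (\<lambda>_. ?G) \<Otimes>\<^sub>M ?G). \<forall>j\<in>insert i I. 0 \<le> ip d (snd w) (fst w j)}
           \<in> sets (PiM (insert i I) (\<lambda>_. ?G) \<Otimes>\<^sub>M ?G)"
          by (rule sets.sets_Collect_countable_All'[OF _ \<open>countable (insert i I)\<close>]) measurable
        then show "{w \<in> space (PiM (insert i I) (\<lambda>_. ?G) \<Otimes>\<^sub>M ?G). snd w \<in> A \<and> (\<forall>j\<in>insert i I. 0 \<le> ip d (snd w) (fst w j))}
           \<in> sets (PiM (insert i I) (\<lambda>_. ?G) \<Otimes>\<^sub>M ?G)"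
          by (intro sets.sets_Collect_conj) measurable
      qed
      moreover have "{x \<in> A. \<forall>j\<in>insert i I. 0 \<le> ip d x (Y j)} = {x \<in> space ?G. x \<in> A \<and> (\<forall>j\<in>insert i I. 0 \<le> ip d x (Y j))}" for Y
        using Asub by auto
      ultimately show ?thesis by simp
    qed
    have "(\<integral>\<^sup>+Y. ennreal (prob {x \<in> A. \<forall>j\<in>insert i I. 0 \<le> ip d x (Y j)} ^ N) \<partial>PiM (insert i I) (\<lambda>_. ?G))
      = (\<integral>\<^sup>+y. \<integral>\<^sup>+Y. ennreal (prob {x \<in> {x \<in> A. 0 \<le> ip d x y}. \<forall>j\<in>I. 0 \<le> ip d x (Y j)} ^ N) \<partial>PiM I (\<lambda>_. ?G) \<partial>?G)"
      by (subst stdG.product_nn_integral_insert_rev[OF insert.hyps(1,2) meas]) (simp only: cone_eq)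
    also have "\<dots> \<le> (\<integral>\<^sup>+y. ennreal (prob A ^ N * w ^ card I) * (indicator D y + ennreal (exp (- \<delta> * real N)))
        + ennreal (exp (- r * real N)) \<partial>?G)"
    proof (rule nn_integral_mono)
      fix y assume y: "y \<in> space ?G"
      have "(\<integral>\<^sup>+Y. ennreal (prob {x \<in> {x \<in> A. 0 \<le> ip d x y}. \<forall>j\<in>I. 0 \<le> ip d x (Y j)} ^ N) \<partial>PiM I (\<lambda>_. ?G))
        \<le> ennreal (prob {x \<in> A. 0 \<le> ip d x y} ^ N * w ^ card I + exp (- r * real N))"
        unfolding w_def by (rule insert.IH) (use half[OF y] in auto)
      also have "\<dots> \<le> ennreal (prob A ^ N * (indicator D y + exp (- \<delta> * real N)) * w ^ card I + exp (- r * real N))"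
        by (intro ennreal_leI add_mono mult_right_mono step y) (use w in auto)
      also have "\<dots> = ennreal (prob A ^ N * w ^ card I * (indicator D y + exp (- \<delta> * real N))) + ennreal (exp (- r * real N))"
        using w by (subst ennreal_plus[symmetric]) (auto simp: mult_ac)
      also have "ennreal (prob A ^ N * w ^ card I * (indicator D y + exp (- \<delta> * real N)))
          = ennreal (prob A ^ N * w ^ card I) * (indicator D y + ennreal (exp (- \<delta> * real N)))"
        using w by (subst ennreal_mult') (auto simp: indicator_def)
      finally show "(\<integral>\<^sup>+Y. ennreal (prob {x \<in> {x \<in> A. 0 \<le> ip d x y}. \<forall>j\<in>I. 0 \<le> ip d x (Y j)} ^ N) \<partial>PiM I (\<lambda>_. ?G)) \<le> \<dots> + ennreal (exp (- r * real N))" .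
    qed
    also have "\<dots> = ennreal (prob A ^ N * w ^ card I) * (emeasure ?G D + ennreal (exp (- \<delta> * real N))) + ennreal (exp (- r * real N))"
      by (simp add: nn_integral_add nn_integral_cmult emeasure_space_1)
    also have "\<dots> \<le> ennreal (prob A ^ N * w ^ card I) * (ennreal (exp (- r)) + ennreal (exp (- \<delta> * real N))) + ennreal (exp (- r * real N))"
    proof (intro add_mono mult_left_mono order_refl)
      show "emeasure ?G D \<le> ennreal (exp (- r))"
        using two_set[OF A True] by (simp add: emeasure_eq_measure D_def)
    qed auto
    also have "\<dots> = ennreal (prob A ^ N * w ^ card I * w + exp (- r * real N))"
      using w by (simp add: w_def ennreal_mult')
    also have "\<dots> = ennreal (prob A ^ N * w ^ card (insert i I) + exp (- r * real N))"
      using insert.hyps by (simp add: mult_ac)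
    finally show ?thesis unfolding w_def .
  qed
qed

text \<open>Given the first N vectors, the others are independent. Only the edges between the two
  groups are kept, so the conditional probability is at most a product of measures. The set may
  depend on j, which lets the same lemma serve the cone bound and the bound by disjoint
  pairs.\<close>

lemma complete_event_fold:
  assumes N: "N \<le> n"
    and S: "\<And>Y j. Y \<in> space (PiM {1..N} (\<lambda>_. std_gaussian d)) \<Longrightarrow> j \<in> {Suc N..n} \<Longrightarrow> S Y j \<in> sets (std_gaussian d)"
    and sub: "\<And>Y j x. Y \<in> space (PiM {1..N} (\<lambda>_. std_gaussian d)) \<Longrightarrow> j \<in> {Suc N..n} \<Longrightarrow> x \<in> space (std_gaussian d) \<Longrightarrow>
       (\<And>i. i \<in> {1..N} \<Longrightarrow> t \<le> ip d x (Y i)) \<Longrightarrow> x \<in> S Y j"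
  shows "emeasure (gaussian_sample n d) (complete_event n d t)
    \<le> (\<integral>\<^sup>+Y. (\<Prod>j\<in>{Suc N..n}. emeasure (std_gaussian d) (S Y j)) \<partial>PiM {1..N} (\<lambda>_. std_gaussian d))"
proof -
  let ?G = "std_gaussian d"
  have U: "{1..n} = {1..N} \<union> {Suc N..n}" using N by auto
  have ev: "complete_event n d t \<in> sets (PiM ({1..N} \<union> {Suc N..n}) (\<lambda>_. ?G))"
    using complete_event_sets[of n d t] unfolding gaussian_sample_def U[symmetric] .
  have "emeasure (gaussian_sample n d) (complete_event n d t)
    = (\<integral>\<^sup>+Y. emeasure (PiM {Suc N..n} (\<lambda>_. ?G)) ((\<lambda>Z. merge {1..N} {Suc N..n} (Y, Z)) -` complete_event n d t
        \<inter> space (PiM {Suc N..n} (\<lambda>_. ?G))) \<partial>PiM {1..N} (\<lambda>_. ?G))"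
    unfolding gaussian_sample_def U by (rule stdG.emeasure_fold_integral[OF _ _ _ ev]) auto
  also have "\<dots> \<le> (\<integral>\<^sup>+Y. (\<Prod>j\<in>{Suc N..n}. emeasure ?G (S Y j)) \<partial>PiM {1..N} (\<lambda>_. ?G))"
  proof (rule nn_integral_mono)
    fix Y assume Y: "Y \<in> space (PiM {1..N} (\<lambda>_. ?G))"
    have "(\<lambda>Z. merge {1..N} {Suc N..n} (Y, Z)) -` complete_event n d t \<inter> space (PiM {Suc N..n} (\<lambda>_. ?G)) \<subseteq> PiE {Suc N..n} (S Y)"
    proof
      fix Z assume "Z \<in> (\<lambda>Z. merge {1..N} {Suc N..n} (Y, Z)) -` complete_event n d t \<inter> space (PiM {Suc N..n} (\<lambda>_. ?G))"
      then have Z: "Z \<in> space (PiM {Suc N..n} (\<lambda>_. ?G))" and ce: "merge {1..N} {Suc N..n} (Y, Z) \<in> complete_event n d t"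
        by auto
      show "Z \<in> PiE {Suc N..n} (S Y)"
      proof (rule PiE_I)
        fix j assume j: "j \<in> {Suc N..n}"
        show "Z j \<in> S Y j"
        proof (rule sub[OF Y j])
          show "Z j \<in> space ?G" using Z j by (auto simp: space_PiM)
          fix i assume i: "i \<in> {1..N}"
          then have "j \<in> {1..n}" "i \<in> {1..n}" "j \<noteq> i" using j N by auto
          then have "t \<le> ip d (merge {1..N} {Suc N..n} (Y, Z) j) (merge {1..N} {Suc N..n} (Y, Z) i)"
            using ce unfolding complete_event_def by blast
          then show "t \<le> ip d (Z j) (Y i)" using i j by (simp add: merge_def)
        qed
      qed (use Z in \<open>auto simp: space_PiM\<close>)
    qed
    then have "emeasure (PiM {Suc N..n} (\<lambda>_. ?G)) ((\<lambda>Z. merge {1..N} {Suc N..n} (Y, Z)) -` complete_event n d t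
        \<inter> space (PiM {Suc N..n} (\<lambda>_. ?G))) \<le> emeasure (PiM {Suc N..n} (\<lambda>_. ?G)) (PiE {Suc N..n} (S Y))"
      by (rule emeasure_mono) (use S[OF Y] in \<open>auto intro!: sets_PiM_I_finite\<close>)
    also have "\<dots> = (\<Prod>j\<in>{Suc N..n}. emeasure ?G (S Y j))"
      by (rule stdG.emeasure_PiM) (use S[OF Y] in auto)
    finally show "emeasure (PiM {Suc N..n} (\<lambda>_. ?G)) ((\<lambda>Z. merge {1..N} {Suc N..n} (Y, Z)) -` complete_event n d t
        \<inter> space (PiM {Suc N..n} (\<lambda>_. ?G))) \<le> \<dots>" .
  qed
  finally show ?thesis .
qed

lemma complete_event_cone_bound:
  assumes t: "0 \<le> t" and N: "2 * N \<le> n"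
    and two_set: "\<And>A. A \<in> sets (std_gaussian d) \<Longrightarrow> exp (- r) \<le> measure (std_gaussian d) A \<Longrightarrow>
      measure (std_gaussian d) {y \<in> space (std_gaussian d). measure (std_gaussian d) {x \<in> A. ip d x y < 0}
        \<le> \<delta> * measure (std_gaussian d) A} \<le> exp (- r)"
    and \<delta>: "0 < \<delta>" "\<delta> \<le> 1" and r: "0 \<le> r"
  shows "measure (gaussian_sample n d) (complete_event n d t)
    \<le> (exp (- r) + exp (- \<delta> * real N)) ^ N + exp (- r * real N)"
proof -
  let ?G = "std_gaussian d"
  interpret prob_space ?G by (rule prob_space_std_gaussian)
  interpret S: prob_space "gaussian_sample n d" by (rule prob_space_gaussian_sample)
  let ?K = "\<lambda>Y. {x \<in> space ?G. \<forall>i\<in>{1..N}. 0 \<le> ip d x (Y i)}"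
  have K [measurable]: "?K Y \<in> sets ?G" if Y: "Y \<in> space (PiM {1..N} (\<lambda>_. ?G))" for Y
  proof (rule sets.sets_Collect_finite_All)
    fix i assume "i \<in> {1..N}"
    then have "Y i \<in> space ?G" using Y by (auto simp: space_PiM)
    then show "{x \<in> space ?G. 0 \<le> ip d x (Y i)} \<in> sets ?G" by measurable
  qed auto
  have "emeasure (gaussian_sample n d) (complete_event n d t)
      \<le> (\<integral>\<^sup>+Y. (\<Prod>j\<in>{Suc N..n}. emeasure ?G (?K Y)) \<partial>PiM {1..N} (\<lambda>_. ?G))"
    by (rule complete_event_fold) (use N t K in \<open>auto intro: order_trans\<close>)
  also have "\<dots> \<le> (\<integral>\<^sup>+Y. ennreal (prob (?K Y) ^ N) \<partial>PiM {1..N} (\<lambda>_. ?G))"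
  proof (rule nn_integral_mono)
    fix Y
    have "(\<Prod>j\<in>{Suc N..n}. emeasure ?G (?K Y)) = ennreal (prob (?K Y) ^ (n - N))"
      by (simp add: emeasure_eq_measure ennreal_power)
    also have "\<dots> \<le> ennreal (prob (?K Y) ^ N)"
      using N by (intro ennreal_leI power_decreasing) auto
    finally show "(\<Prod>j\<in>{Suc N..n}. emeasure ?G (?K Y)) \<le> ennreal (prob (?K Y) ^ N)" .
  qed
  also have "\<dots> \<le> ennreal (prob (space ?G) ^ N * (exp (- r) + exp (- \<delta> * real N)) ^ card {1..N} + exp (- r * real N))"
    by (rule dual_cone_recursion[OF two_set \<delta> r]) auto
  also have "\<dots> = ennreal ((exp (- r) + exp (- \<delta> * real N)) ^ N + exp (- r * real N))"
    by (simp add: prob_space)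
  finally show ?thesis
    by (simp add: S.emeasure_eq_measure ennreal_le_iff del: ennreal_plus)
qed

text \<open>With \<rho> = K * r / d all exponents of \<open>overlap_violation\<close> become
  multiples of r^2 / d. \<open>K\<close> turns the requirement with the constant 42 into an
  equality, and \<open>c0\<close> keeps \<rho> small and yields 65536 * \<rho>^2 * d \<le> r. The
  lower bound sqrt d \<le> r gives \<rho> * r \<ge> 1 and lets the additive 4 in \<delta> be
  absorbed into 4 * r^2 / d; d \<ge> 4 gives r \<ge> 2.\<close>

lemma overlap_violation_uniform:
  obtains C c0 :: real where "0 < C" "0 < c0" "c0 \<le> 1"
    "\<And>d r A. 4 \<le> d \<Longrightarrow> sqrt (real d) \<le> r \<Longrightarrow> r \<le> c0 * real d \<Longrightarrow> A \<in> sets (std_gaussian d) \<Longrightarrow>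
      exp (- r) \<le> measure (std_gaussian d) A \<Longrightarrow>
      measure (std_gaussian d) {y \<in> space (std_gaussian d). measure (std_gaussian d) {x \<in> A. ip d x y < 0}
        \<le> exp (- (C * r\<^sup>2 / real d)) * measure (std_gaussian d) A} \<le> exp (- r)"
proof -
  define K :: real where "K = 42 * 32 * 16 ^ 4 * exp 32"
  have K: "1 \<le> K"
  proof -
    have "(1::real) * 1 \<le> 42 * 32 * 16 ^ 4 * exp 32" by (intro mult_mono) auto
    then show ?thesis by (simp add: K_def)
  qed
  define c0 where "c0 = 1 / (65536 * K\<^sup>2)"
  define C where "C = 64 * K + 100 * K\<^sup>2 + 4"
  have c0: "0 < c0" "K * c0 \<le> 1 / 65536" "c0 \<le> 1 / 65536" "65536 * K\<^sup>2 * c0 = 1"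
  proof -
    have K2: "K \<le> K\<^sup>2" using K by (simp add: power2_eq_square)
    show "0 < c0" using K by (simp add: c0_def)
    show "K * c0 \<le> 1 / 65536" using K by (simp add: c0_def power2_eq_square field_simps)
    show "c0 \<le> 1 / 65536" using K K2 by (simp add: c0_def field_simps)
    show "65536 * K\<^sup>2 * c0 = 1" using K by (simp add: c0_def)
  qed
  show ?thesis
  proof (rule that[of C c0])
    fix d r A
    assume d: "4 \<le> d" and r: "sqrt (real d) \<le> r" "r \<le> c0 * real d"
      and A: "A \<in> sets (std_gaussian d)" "exp (- r) \<le> measure (std_gaussian d) A"
    interpret prob_space "std_gaussian d" by (rule prob_space_std_gaussian)
    have dp: "0 < real d" using d by simp
    have rp: "2 \<le> r" using r(1) d real_sqrt_le_mono[of 4 "real d"] by simp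
    have rd: "real d \<le> r\<^sup>2" using power_mono[OF r(1), of 2] by simp
    define \<rho> where "\<rho> = K * r / real d"
    have \<rho>r: "\<rho> * r = K * r\<^sup>2 / real d" and \<rho>d: "\<rho> * real d = K * r" and \<rho>2: "\<rho>\<^sup>2 * real d = K\<^sup>2 * r\<^sup>2 / real d"
      using dp by (auto simp: \<rho>_def power2_eq_square field_simps)
    have rc: "r / real d \<le> c0" using r(2) dp by (simp add: field_simps)
    have \<rho>: "0 < \<rho>" using K rp dp by (simp add: \<rho>_def)
    have \<rho>c: "\<rho> \<le> 1 / 65536"
    proof -
      have "\<rho> \<le> K * c0" unfolding \<rho>_def times_divide_eq_right[symmetric] by (intro mult_left_mono rc) (use K in auto)
      then show ?thesis using c0 by linarith
    qed
    define \<delta> where "\<delta> = exp (- 64 * \<rho> * r - 100 * \<rho>\<^sup>2 * real d - 4)"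
    have main: "prob {y \<in> space (std_gaussian d). prob {x \<in> A. ip d x y < 0} \<le> \<delta> * prob A} \<le> exp (- r)"
    proof (rule overlap_violation[OF \<rho> _ _ _ _ _ rp _ A \<delta>_def])
      show "\<rho> \<le> 1 / 16" using \<rho>c by simp
      have "1 * 1 \<le> K * (r\<^sup>2 / real d)" using K rd dp by (intro mult_mono) (auto simp: field_simps)
      then show "1 \<le> \<rho> * r" by (simp add: \<rho>r)
      have "65536 * K\<^sup>2 * (r / real d) * r \<le> 65536 * K\<^sup>2 * c0 * r"
        using rc rp by (intro mult_right_mono mult_left_mono) auto
      also have "\<dots> = r" unfolding c0(4) by simp
      also have "65536 * K\<^sup>2 * (r / real d) * r = 65536 * \<rho>\<^sup>2 * real d"
        unfolding mult.assoc \<rho>2 by (simp add: power2_eq_square)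
      finally show "65536 * \<rho>\<^sup>2 * real d \<le> r" .
      have "r \<le> 1 / 65536 * real d" using r(2) mult_right_mono[OF c0(3), of "real d"] dp by linarith
      then show r4: "r \<le> real d / 4" using dp by linarith
      have "\<rho> * r \<le> 1 / 65536 * (real d / 4)" using \<rho>c r4 rp \<rho> by (intro mult_mono) auto
      then show "3072 * (\<rho> * r) \<le> real d" using dp by simp
      show "42 * r \<le> \<rho> * real d * (exp (- 32) / (32 * 16 ^ 4))"
        unfolding \<rho>d by (simp add: K_def exp_minus field_simps)
    qed
    have "{y \<in> space (std_gaussian d). prob {x \<in> A. ip d x y < 0} \<le> exp (- (C * r\<^sup>2 / real d)) * prob A}
       \<subseteq> {y \<in> space (std_gaussian d). prob {x \<in> A. ip d x y < 0} \<le> \<delta> * prob A}"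
    proof -
      have "64 * \<rho> * r + 100 * \<rho>\<^sup>2 * real d + 4 \<le> C * r\<^sup>2 / real d"
      proof -
        have "4 \<le> 4 * (r\<^sup>2 / real d)" using rd dp by (simp add: field_simps)
        moreover have "C * r\<^sup>2 / real d = 64 * (K * r\<^sup>2 / real d) + 100 * (K\<^sup>2 * r\<^sup>2 / real d) + 4 * (r\<^sup>2 / real d)"
          by (simp add: C_def algebra_simps add_divide_distrib)
        ultimately show ?thesis unfolding mult.assoc \<rho>r \<rho>2 by linarith
      qed
      then have "exp (- (C * r\<^sup>2 / real d)) \<le> \<delta>" by (simp add: \<delta>_def)
      then have "exp (- (C * r\<^sup>2 / real d)) * prob A \<le> \<delta> * prob A" by (intro mult_right_mono) auto
      then show ?thesis by auto
    qed
    then have "prob {y \<in> space (std_gaussian d). prob {x \<in> A. ip d x y < 0} \<le> exp (- (C * r\<^sup>2 / real d)) * prob A}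
       \<le> prob {y \<in> space (std_gaussian d). prob {x \<in> A. ip d x y < 0} \<le> \<delta> * prob A}"
    proof (rule finite_measure_mono)
      have "(\<lambda>y. prob {x \<in> space (std_gaussian d). x \<in> A \<and> ip d x y < 0}) \<in> borel_measurable (std_gaussian d)"
        by (rule measurable_section_measure) (use A(1) in measurable)
      moreover have "{x \<in> A. ip d x y < 0} = {x \<in> space (std_gaussian d). x \<in> A \<and> ip d x y < 0}" for y
        using sets.sets_into_space[OF A(1)] by auto
      ultimately show "{y \<in> space (std_gaussian d). prob {x \<in> A. ip d x y < 0} \<le> \<delta> * prob A} \<in> sets (std_gaussian d)"
        by simp
    qed
    then show "prob {y \<in> space (std_gaussian d). prob {x \<in> A. ip d x y < 0} \<le> exp (- (C * r\<^sup>2 / real d)) * prob A} \<le> exp (- r)"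
      using main by linarith
  qed (use c0 K in \<open>auto simp: C_def intro!: add_nonneg_pos\<close>)
qed

section \<open>Boxes, half-spaces and the sign of the threshold\<close>

lemma measure_stdN_interval_pos:
  assumes "a < b"
  shows "0 < measure stdN {a<..<b}"
proof -
  interpret prob_space stdN by (rule prob_space_stdN)
  have "emeasure stdN {a<..<b} \<noteq> 0"
  proof
    assume "emeasure stdN {a<..<b} = 0"
    then have "(\<integral>\<^sup>+x. ennreal (std_normal_density x) * indicator {a<..<b} x \<partial>lborel) = 0"
      by (subst (asm) emeasure_density) auto
    then have "AE x in lborel. ennreal (std_normal_density x) * indicator {a<..<b} x = 0"
      by (subst (asm) nn_integral_0_iff_AE) auto
    then have "AE x in lborel. x \<notin> {a<..<b}"
    proof eventually_elim
      case (elim x)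
      have "0 < std_normal_density x" by (rule normal_density_pos) simp
      then show ?case using elim by (auto simp: indicator_def)
    qed
    then have "emeasure lborel {a<..<b} = 0"
      by (subst (asm) AE_iff_measurable[of "{a<..<b}"]) auto
    then show False using assms by simp
  qed
  then show ?thesis by (simp add: emeasure_eq_measure zero_less_measure_iff)
qed

lemma measure_std_gaussian_box:
  assumes "\<And>k. E k \<in> sets borel"
  shows "measure (std_gaussian d) (PiE {1..d} E) = (\<Prod>k\<in>{1..d}. measure stdN (E k))"
proof -
  interpret N: prob_space stdN by (rule prob_space_stdN)
  interpret prob_space "std_gaussian d" by (rule prob_space_std_gaussian)
  have "emeasure (std_gaussian d) (PiE {1..d} E) = (\<Prod>k\<in>{1..d}. emeasure stdN (E k))"
    unfolding std_gaussian_def by (rule stdN.emeasure_PiM) (use assms in auto)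
  then show ?thesis by (simp add: emeasure_eq_measure N.emeasure_eq_measure prod_ennreal prod_nonneg)
qed

lemma box_sets: "(\<And>k. E k \<in> sets borel) \<Longrightarrow> PiE {1..d} E \<in> sets (std_gaussian d)"
  unfolding std_gaussian_def by (rule sets_PiM_I_finite) auto

definition vneg :: "nat \<Rightarrow> (nat \<Rightarrow> real) \<Rightarrow> nat \<Rightarrow> real" where
  "vneg d x = (\<lambda>k\<in>{1..d}. - x k)"

lemma measurable_vneg [measurable]: "vneg d \<in> measurable (std_gaussian d) (std_gaussian d)"
  unfolding std_gaussian_def vneg_def by measurable

lemma distr_std_gaussian_vneg: "distr (std_gaussian d) (std_gaussian d) (vneg d) = std_gaussian d"
proof -
  have "distr (PiM {1..d} (\<lambda>_. stdN)) (PiM {1..d} (\<lambda>_. stdN)) (compose {1..d} uminus) = PiM {1..d} (\<lambda>_. distr stdN stdN uminus)"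
    by (rule distr_PiM_finite_prob_space) (auto intro: prob_space_stdN product_prob_spaceI)
  moreover have "distr stdN stdN uminus = stdN"
    using distr_stdN_uminus by (simp cong: distr_cong)
  moreover have "compose {1..d} uminus = vneg d" by (auto simp: compose_def vneg_def)
  ultimately show ?thesis by (simp add: std_gaussian_def)
qed

lemma ip_vneg: "ip d (vneg d x) y = - ip d x y"
  by (simp add: ip_def vneg_def sum_negf)

lemma ip_commute: "ip d x y = ip d y x"
  by (simp add: ip_def mult.commute)

text \<open>The reflection x to -x preserves the law and exchanges two closed half-spaces that
  together cover the space.\<close>

lemma half_space_prob:
  assumes y [measurable]: "y \<in> space (std_gaussian d)"
  shows "1/2 \<le> measure (std_gaussian d) {x \<in> space (std_gaussian d). 0 \<le> ip d x y}"
proof -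
  interpret prob_space "std_gaussian d" by (rule prob_space_std_gaussian)
  have "prob {x \<in> space (std_gaussian d). 0 \<le> ip d x y} = measure (distr (std_gaussian d) (std_gaussian d) (vneg d)) {x \<in> space (std_gaussian d). 0 \<le> ip d x y}"
    by (simp add: distr_std_gaussian_vneg)
  also have "\<dots> = prob (vneg d -` {x \<in> space (std_gaussian d). 0 \<le> ip d x y} \<inter> space (std_gaussian d))"
    by (rule measure_distr) measurable
  also have "vneg d -` {x \<in> space (std_gaussian d). 0 \<le> ip d x y} \<inter> space (std_gaussian d) = {x \<in> space (std_gaussian d). ip d x y \<le> 0}"
    using measurable_space[OF measurable_vneg] by (auto simp: ip_vneg)
  finally have eq: "prob {x \<in> space (std_gaussian d). 0 \<le> ip d x y} = prob {x \<in> space (std_gaussian d). ip d x y \<le> 0}" .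
  have "1 = prob ({x \<in> space (std_gaussian d). 0 \<le> ip d x y} \<union> {x \<in> space (std_gaussian d). ip d x y \<le> 0})"
    by (subst prob_space[symmetric], rule arg_cong[where f = prob]) auto
  also have "\<dots> \<le> prob {x \<in> space (std_gaussian d). 0 \<le> ip d x y} + prob {x \<in> space (std_gaussian d). ip d x y \<le> 0}"
    by (rule measure_Un_le) measurable
  finally show ?thesis using eq by simp
qed

lemma measurable_ip_level [measurable]:
  "(\<lambda>y. measure (std_gaussian d) {x \<in> space (std_gaussian d). t \<le> ip d x y}) \<in> borel_measurable (std_gaussian d)"
  by (rule measurable_section_measure) measurable

text \<open>Fubini over the first vector. The threshold enters all later estimates in this averaged
  form.\<close>

lemma threshold_integral:
  assumes "is_threshold d p t"
  shows "(\<integral>\<^sup>+y. ennreal (measure (std_gaussian d) {x \<in> space (std_gaussian d). t \<le> ip d x y}) \<partial>std_gaussian d) = ennreal p"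
proof -
  let ?G = "std_gaussian d"
  interpret prob_space ?G by (rule prob_space_std_gaussian)
  interpret S: prob_space "gaussian_sample 2 d" by (rule prob_space_gaussian_sample)
  let ?E = "{X \<in> space (gaussian_sample 2 d). t \<le> ip d (X 1) (X 2)}"
  have I: "{1..2} = insert 1 {2 :: nat}" by auto
  have E: "?E \<in> sets (gaussian_sample 2 d)" by measurable
  have "ennreal p = emeasure (gaussian_sample 2 d) ?E"
    using assms by (simp add: is_threshold_def S.emeasure_eq_measure)
  also have "\<dots> = (\<integral>\<^sup>+X. indicator ?E X \<partial>gaussian_sample 2 d)" using E by simp
  also have "\<dots> = (\<integral>\<^sup>+y. \<integral>\<^sup>+X. indicator ?E (X(1 := y)) \<partial>PiM {2} (\<lambda>_. ?G) \<partial>?G)"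
    unfolding gaussian_sample_def I
    by (rule stdG.product_nn_integral_insert_rev) (use E in \<open>simp_all add: gaussian_sample_def I\<close>)
  also have "\<dots> = (\<integral>\<^sup>+y. ennreal (prob {x \<in> space ?G. t \<le> ip d x y}) \<partial>?G)"
  proof (rule nn_integral_cong)
    fix y assume y [measurable]: "y \<in> space ?G"
    have "(\<integral>\<^sup>+X. indicator ?E (X(1 := y)) \<partial>PiM {2} (\<lambda>_. ?G))
        = (\<integral>\<^sup>+X. indicator {x \<in> space ?G. t \<le> ip d x y} (X 2) \<partial>PiM {2 :: nat} (\<lambda>_. ?G))"
    proof (rule nn_integral_cong)
      fix X assume X: "X \<in> space (PiM {2} (\<lambda>_ :: nat. ?G))"
      then have "X(1 := y) \<in> space (gaussian_sample 2 d)" "X 2 \<in> space ?G"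
        using y unfolding gaussian_sample_def I by (auto simp: space_PiM PiE_def extensional_def)
      then show "indicator ?E (X(1 := y)) = indicator {x \<in> space ?G. t \<le> ip d x y} (X 2)"
        by (auto simp: indicator_def ip_commute[of d y])
    qed
    also have "\<dots> = (\<integral>\<^sup>+x. indicator {x \<in> space ?G. t \<le> ip d x y} x \<partial>?G)"
      by (rule stdG.product_nn_integral_singleton) measurable
    also have "\<dots> = ennreal (prob {x \<in> space ?G. t \<le> ip d x y})"
      by (subst nn_integral_indicator) (auto simp: emeasure_eq_measure)
    finally show "(\<integral>\<^sup>+X. indicator ?E (X(1 := y)) \<partial>PiM {2} (\<lambda>_. ?G)) = \<dots>" .
  qed
  finally show ?thesis by simp
qed

text \<open>If t < 0, every set where ip d x y \<ge> t contains a half-space of measure at least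
  1/2. For y in the positive box \<open>U\<close> it also contains the disjoint box \<open>V\<close>
  of slightly negative vectors, so averaging over y gives p > 1/2.\<close>

lemma threshold_nonneg:
  assumes th: "is_threshold d p t" and p: "p \<le> 1/2" and d: "1 \<le> d"
  shows "0 \<le> t"
proof (rule ccontr)
  assume "\<not> 0 \<le> t"
  then have t: "t < 0" by simp
  let ?G = "std_gaussian d"
  interpret prob_space ?G by (rule prob_space_std_gaussian)
  \<comment> \<open>Coordinates of x in (-e, 0) against coordinates of y in (0, 1) cost at most e
    each, in total d * e = -t.\<close>
  define e where "e = - t / real d"
  have e: "0 < e" using t d divide_neg_pos[of t "real d"] by (simp add: e_def)
  define U where "U = PiE {1..d} (\<lambda>_. {0<..<1::real})"
  define V where "V = PiE {1..d} (\<lambda>_. {-e<..<0::real})"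
  have [measurable]: "U \<in> sets ?G" "V \<in> sets ?G" unfolding U_def V_def by (rule box_sets; simp)+
  have pos: "0 < prob U" "0 < prob V"
    unfolding U_def V_def using e
    by (subst measure_std_gaussian_box, simp, intro prod_pos ballI measure_stdN_interval_pos, simp)+
  have "(\<integral>\<^sup>+y. ennreal (1/2) + ennreal (prob V) * indicator U y \<partial>?G)
      \<le> (\<integral>\<^sup>+y. ennreal (prob {x \<in> space ?G. t \<le> ip d x y}) \<partial>?G)"
  proof (rule nn_integral_mono)
    fix y assume y [measurable]: "y \<in> space ?G"
    have mono: "prob {x \<in> space ?G. 0 \<le> ip d x y} \<le> prob {x \<in> space ?G. t \<le> ip d x y}"
      using t by (intro finite_measure_mono) auto
    show "ennreal (1/2) + ennreal (prob V) * indicator U y \<le> ennreal (prob {x \<in> space ?G. t \<le> ip d x y})"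
    proof (cases "y \<in> U")
      case True
      have V: "V \<subseteq> {x \<in> space ?G. t \<le> ip d x y \<and> ip d x y < 0}"
      proof
        fix x assume x: "x \<in> V"
        have xk: "- e < x k" "x k < 0" "0 < y k" "y k < 1" if "k \<in> {1..d}" for k
          using x True that by (auto simp: U_def V_def PiE_def Pi_def)
        have "(\<Sum>k\<in>{1..d}. - e) \<le> ip d x y" unfolding ip_def
        proof (rule sum_mono)
          fix k assume k: "k \<in> {1..d}"
          have "- x k * y k \<le> e * 1" using xk[OF k] by (intro mult_mono) auto
          then show "- e \<le> x k * y k" by simp
        qed
        then have "t \<le> ip d x y" using d by (simp add: e_def)
        moreover have "ip d x y < (\<Sum>k\<in>{1..d}. 0)" unfolding ip_def
          by (rule sum_strict_mono) (use d xk in \<open>auto simp: mult_neg_pos\<close>)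
        moreover have "x \<in> space ?G" using x \<open>V \<in> sets ?G\<close> sets.sets_into_space by blast
        ultimately show "x \<in> {x \<in> space ?G. t \<le> ip d x y \<and> ip d x y < 0}" by simp
      qed
      have "prob {x \<in> space ?G. 0 \<le> ip d x y} + prob V = prob ({x \<in> space ?G. 0 \<le> ip d x y} \<union> V)"
        by (rule finite_measure_Union[symmetric]) (use V in auto)
      also have "\<dots> \<le> prob {x \<in> space ?G. t \<le> ip d x y}"
        using t V by (intro finite_measure_mono) auto
      finally have le: "1/2 + prob V \<le> prob {x \<in> space ?G. t \<le> ip d x y}" using half_space_prob[OF y] by linarith
      have "ennreal (1/2) + ennreal (prob V) = ennreal (1/2 + prob V)" by (rule ennreal_plus[symmetric]) auto
      also have "\<dots> \<le> ennreal (prob {x \<in> space ?G. t \<le> ip d x y})" by (rule ennreal_leI[OF le])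
      finally show ?thesis unfolding indicator_simps(1)[OF True] mult_1_right .
    next
      case False
      have "ennreal (1/2) \<le> ennreal (prob {x \<in> space ?G. t \<le> ip d x y})"
        by (rule ennreal_leI) (use half_space_prob[OF y] mono in linarith)
      then show ?thesis unfolding indicator_simps(2)[OF False] by simp
    qed
  qed
  also have "\<dots> = ennreal p" by (rule threshold_integral[OF th])
  also have "(\<integral>\<^sup>+y. ennreal (1/2) + ennreal (prob V) * indicator U y \<partial>?G) = ennreal (1/2 + prob V * prob U)"
    by (subst nn_integral_add) (simp_all add: nn_integral_cmult_indicator emeasure_space_1 emeasure_eq_measure[of U] ennreal_mult'[symmetric])
  finally have "1/2 + prob V * prob U \<le> p"
    using mult_pos_pos[OF pos(2,1)] unfolding ennreal_le_iff2 by linarith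
  then show False using p mult_pos_pos[OF pos] by (simp add: mult.commute)
qed

text \<open>Keeps only the N disjoint edges joining i and N + i, which are independent. The
  resulting exponent, linear in n, serves the upper bound where d or the ratio of the target
  exponent to n is bounded.\<close>

lemma complete_event_pairs:
  assumes th: "is_threshold d p t" and p: "0 \<le> p" and N: "2 * N \<le> n"
  shows "measure (gaussian_sample n d) (complete_event n d t) \<le> p ^ N"
proof -
  let ?G = "std_gaussian d"
  interpret prob_space ?G by (rule prob_space_std_gaussian)
  interpret S: prob_space "gaussian_sample n d" by (rule prob_space_gaussian_sample)
  let ?h = "\<lambda>y. {x \<in> space ?G. t \<le> ip d x y}"
  let ?S = "\<lambda>Y j. if j \<le> 2 * N then ?h (Y (j - N)) else space ?G"
  have "emeasure (gaussian_sample n d) (complete_event n d t)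
      \<le> (\<integral>\<^sup>+Y. (\<Prod>j\<in>{Suc N..n}. emeasure ?G (?S Y j)) \<partial>PiM {1..N} (\<lambda>_. ?G))"
  proof (rule complete_event_fold)
    fix Y j assume Y: "Y \<in> space (PiM {1..N} (\<lambda>_ :: nat. ?G))" and j: "j \<in> {Suc N..n}"
    have [measurable]: "Y (j - N) \<in> space ?G" if "j \<le> 2 * N"
    proof -
      have "j - N \<in> {1..N}" using that j by auto
      then show ?thesis using Y unfolding space_PiM by (rule PiE_mem[rotated])
    qed
    show "?S Y j \<in> sets ?G" by (cases "j \<le> 2 * N") simp_all
    fix x assume x: "x \<in> space ?G" and le: "\<And>i. i \<in> {1..N} \<Longrightarrow> t \<le> ip d x (Y i)"
    show "x \<in> ?S Y j"
    proof (cases "j \<le> 2 * N")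
      case True
      then have "j - N \<in> {1..N}" using j by auto
      then show ?thesis using x le[of "j - N"] by simp
    qed (use x in simp)
  qed (use N in auto)
  also have "\<dots> = (\<integral>\<^sup>+Y. (\<Prod>i\<in>{1..N}. ennreal (prob (?h (Y i)))) \<partial>PiM {1..N} (\<lambda>_. ?G))"
  proof (rule nn_integral_cong)
    fix Y
    have "(\<Prod>j\<in>{Suc N..n}. emeasure ?G (?S Y j)) = (\<Prod>j\<in>{Suc N..2 * N}. emeasure ?G (?S Y j))"
      by (rule prod.mono_neutral_right) (use N in \<open>auto simp: emeasure_space_1\<close>)
    also have "\<dots> = (\<Prod>i\<in>{1..N}. ennreal (prob (?h (Y i))))"
      by (rule prod.reindex_bij_witness[of _ "\<lambda>i. i + N" "\<lambda>j. j - N"]) (auto simp: emeasure_eq_measure)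
    finally show "(\<Prod>j\<in>{Suc N..n}. emeasure ?G (?S Y j)) = (\<Prod>i\<in>{1..N}. ennreal (prob (?h (Y i))))" .
  qed
  also have "\<dots> = (\<Prod>i\<in>{1..N}. \<integral>\<^sup>+y. ennreal (prob (?h y)) \<partial>?G)"
    by (rule stdG.product_nn_integral_prod) measurable
  also have "\<dots> = ennreal (p ^ N)" using p by (simp add: threshold_integral[OF th] ennreal_power)
  finally show ?thesis using p by (simp add: S.emeasure_eq_measure)
qed

text \<open>The cone bound has exponent of order N * min r (\<delta> * N), and \<delta> decays with
  r. So r is taken as large as possible while \<delta> * N stays at least of the order of min n s,
  with \<open>s\<close> the logarithmic term divided by n.\<close>

lemma complete_event_upper:
  assumes p: "0 < p" "p \<le> 1/2"
  shows "\<exists>c>0. \<forall>n\<ge>2. \<forall>d\<ge>2. \<forall>t. is_threshold d p t \<longrightarrow>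
    measure (gaussian_sample n d) (complete_event n d t)
      \<le> exp (- c * min ((real n)\<^sup>2)
          (min (real n * sqrt (real d * ln (max (real n / real d powr (3/4)) (exp 1)))) (real n * real d)))"
proof -
  obtain C c0 :: real where C: "0 < C" and c0: "0 < c0" "c0 \<le> 1"
    and two: "\<And>d r A. 4 \<le> d \<Longrightarrow> sqrt (real d) \<le> r \<Longrightarrow> r \<le> c0 * real d \<Longrightarrow> A \<in> sets (std_gaussian d) \<Longrightarrow>
      exp (- r) \<le> measure (std_gaussian d) A \<Longrightarrow>
      measure (std_gaussian d) {y \<in> space (std_gaussian d). measure (std_gaussian d) {x \<in> A. ip d x y < 0}
        \<le> exp (- (C * r\<^sup>2 / real d)) * measure (std_gaussian d) A} \<le> exp (- r)"
    using overlap_violation_uniform by blast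
  \<comment> \<open>For r \<le> c1 * s the exponent of \<delta> is at most L / 4, so \<delta> costs
    no more than the fourth root of n / d^(3/4).\<close>
  define c1 where "c1 = min 1 (1 / (2 * sqrt C))"
  have c1: "0 < c1" "c1 \<le> 1" "C * c1\<^sup>2 \<le> 1/4"
  proof -
    show "0 < c1" "c1 \<le> 1" using C by (auto simp: c1_def)
    have "c1\<^sup>2 \<le> (1 / (2 * sqrt C))\<^sup>2" using C by (intro power_mono) (auto simp: c1_def)
    also have "\<dots> = 1 / (4 * C)" using C by (simp add: power_divide power_mult_distrib)
    finally show "C * c1\<^sup>2 \<le> 1/4" using C by (simp add: field_simps)
  qed
  \<comment> \<open>For d \<ge> D0 one has sqrt d \<le> c0 * d, so the admissible range of r is not
    empty.\<close>
  define D0 where "D0 = 4 + 1 / c0\<^sup>2"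
  have D0: "4 \<le> D0" "0 < D0" using c0 by (auto simp: D0_def intro!: add_pos_nonneg)
  define c2 where "c2 = min (exp (- C - 1) / 3) (min c0 c1)"
  have c2: "0 < c2" "c2 \<le> exp (- C - 1) / 3" "c2 \<le> c0" "c2 \<le> c1" using c0 c1 by (auto simp: c2_def)
  have c23: "c2 \<le> 1/3"
  proof -
    have "exp (- C - 1) \<le> (1::real)" using C by simp
    then show ?thesis using c2(2) by linarith
  qed
  \<comment> \<open>The three entries belong to the cases m \<ge> 4, m < 4 and d < D0 below, in this
    order.\<close>
  define c where "c = min (c2 / 6) (min (c2 * ln 2 / 12) (ln 2 / (3 * D0)))"
  have c: "0 < c" "c \<le> c2 / 6" "c \<le> c2 * ln 2 / 12" "c \<le> ln 2 / (3 * D0)"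
    using c2 D0 by (auto simp: c_def)
  show ?thesis
  proof (intro exI[of _ c] conjI c(1) allI impI)
    fix n d :: nat and t
    assume n: "2 \<le> n" and d: "2 \<le> d" and th: "is_threshold d p t"
    define N where "N = n div 2"
    have N: "2 * N \<le> n" "1 \<le> N" "real n / 3 \<le> real N"
    proof -
      have "n \<le> 3 * (n div 2)" using n by presburger
      then have "real n \<le> real (3 * (n div 2))" by (simp only: of_nat_le_iff)
      then show "real n / 3 \<le> real N" by (simp add: N_def)
    qed (use n in \<open>auto simp: N_def\<close>)
    have t0: "0 \<le> t" using threshold_nonneg[OF th p(2)] d by simp
    define L where "L = ln (max (real n / real d powr (3/4)) (exp 1))"
    define s where "s = sqrt (real d * L)"
    have L1: "1 \<le> L" unfolding L_def using ln_mono[of "exp 1" "max (real n / real d powr (3/4)) (exp 1)"]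
      by (simp add: less_max_iff_disj)
    define P where "P = measure (gaussian_sample n d) (complete_event n d t)"
    define \<Phi> where "\<Phi> = min ((real n)\<^sup>2) (min (real n * s) (real n * real d))"
    define q where "q = min (real n) (min s (real d))"
    have \<Phi>q: "\<Phi> = real n * q" unfolding \<Phi>_def q_def by (simp add: min_mult_distrib_left power2_eq_square)
    have s0: "0 \<le> s" using L1 by (simp add: s_def)
    have q0: "0 \<le> q" using s0 by (simp add: q_def)
    have weak: "P \<le> exp (- (real n * ln 2 / 3))"
    proof -
      have "P \<le> p ^ N" unfolding P_def by (rule complete_event_pairs[OF th _ N(1)]) (use p in simp)
      also have "\<dots> \<le> (1/2) ^ N" using p by (intro power_mono) auto
      also have "\<dots> = exp (- (real N * ln 2))"
        by (simp add: exp_minus exp_of_nat_mult power_one_over field_simps)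
      also have "\<dots> \<le> exp (- (real n * ln 2 / 3))"
        using mult_right_mono[OF N(3), of "ln 2"] by simp
      finally show ?thesis .
    qed
    have "P \<le> exp (- c * \<Phi>)"
    proof (cases "real d < D0")
      case True
      have "c * \<Phi> \<le> ln 2 / (3 * D0) * (real n * D0)"
      proof (rule mult_mono)
        show "\<Phi> \<le> real n * D0" using True by (auto simp: \<Phi>_def intro!: min.coboundedI2 mult_left_mono)
      qed (use c D0 q0 in \<open>auto simp: \<Phi>q\<close>)
      also have "\<dots> = real n * ln 2 / 3" using D0 by simp
      finally have "exp (- (real n * ln 2 / 3)) \<le> exp (- c * \<Phi>)" by simp
      then show ?thesis using weak by linarith
    next
      case False
      then have dD: "D0 \<le> real d" by simp
      have d4: "4 \<le> d" using dD D0 by linarith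
      have dp: "0 < real d" using d by simp
      have sq: "sqrt (real d) \<le> c0 * real d"
      proof -
        have "1 / c0\<^sup>2 \<le> real d" using dD by (simp add: D0_def)
        then have "sqrt (1 / c0\<^sup>2) \<le> sqrt (real d)" by (rule real_sqrt_le_mono)
        then have "1 \<le> c0 * sqrt (real d)" using c0 by (simp add: real_sqrt_divide field_simps)
        then have "1 * sqrt (real d) \<le> (c0 * sqrt (real d)) * sqrt (real d)" by (intro mult_right_mono) auto
        then show ?thesis by (simp add: mult.assoc)
      qed
      \<comment> \<open>The target is c1 * s, clamped to the interval from sqrt d to c0 * d in which
        \<open>two\<close> applies.\<close>
      define r where "r = min (c0 * real d) (max (sqrt (real d)) (c1 * s))"
      have r: "sqrt (real d) \<le> r" "r \<le> c0 * real d" "r \<le> max (sqrt (real d)) (c1 * s)" using sq by (auto simp: r_def)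
      have r0: "0 \<le> r" using r(1) by (meson order_trans real_sqrt_ge_zero of_nat_0_le_iff)
      define \<delta> where "\<delta> = exp (- (C * r\<^sup>2 / real d))"
      have \<delta>1: "0 < \<delta>" "\<delta> \<le> 1" using C dp by (auto simp: \<delta>_def)
      have rsq: "C * r\<^sup>2 / real d \<le> max C (L / 4)"
      proof (cases "r \<le> sqrt (real d)")
        case True
        then have "r\<^sup>2 \<le> real d" using power_mono[OF True r0, of 2] by simp
        then have "C * r\<^sup>2 / real d \<le> C" using C dp by (simp add: field_simps)
        then show ?thesis by simp
      next
        case False
        then have "r \<le> c1 * s" using r(3) by auto
        then have "r\<^sup>2 \<le> c1\<^sup>2 * (real d * L)" using power_mono[of r "c1 * s" 2] r0 L1 by (simp add: power_mult_distrib s_def)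
        then have "C * r\<^sup>2 / real d \<le> C * (c1\<^sup>2 * (real d * L)) / real d" using C by (intro divide_right_mono mult_left_mono) auto
        also have "\<dots> = C * c1\<^sup>2 * L" using dp by simp
        also have "\<dots> \<le> 1/4 * L" using c1 L1 by (intro mult_right_mono) auto
        finally have "C * r\<^sup>2 / real d \<le> L / 4" by simp
        then show ?thesis by (rule max.coboundedI2)
      qed
      \<comment> \<open>If the exponent of \<delta> is bounded, then \<delta> * N is of order n.
        Otherwise L > 1, so exp L = u = n / d^(3/4), and \<delta> \<ge> u^(-1/4). From sqrt d \<le>
        d^(3/4) and sqrt L \<le> u^(3/4) follows s \<le> u^(-1/4) * n, hence s / 3 \<le> \<delta> *
        N.\<close>
      have \<delta>N: "c2 * min (real n) s \<le> \<delta> * real N"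
      proof (cases "C * r\<^sup>2 / real d \<le> C + 1")
        case True
        then have "exp (- C - 1) \<le> \<delta>" by (simp add: \<delta>_def)
        then have "exp (- C - 1) * (real n / 3) \<le> \<delta> * real N" using N \<delta>1 by (intro mult_mono) auto
        moreover have "c2 * min (real n) s \<le> exp (- C - 1) / 3 * real n"
          using c2 s0 by (intro mult_mono) auto
        ultimately show ?thesis by simp
      next
        case False
        then have L4: "C * r\<^sup>2 / real d \<le> L / 4" "1 < L" using rsq C unfolding le_max_iff_disj by linarith+
        define u where "u = real n / real d powr (3/4)"
        have mx: "max u (exp 1) = u"
        proof (rule ccontr)
          assume "max u (exp 1) \<noteq> u"
          then have "max u (exp 1) = exp 1" by (auto simp: max_def split: if_splits)
          then show False using L4(2) by (simp add: L_def u_def)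
        qed
        then have Lu: "L = ln u" "exp 1 \<le> u" by (auto simp: L_def u_def max_def split: if_splits)
        have up: "1 \<le> u" using Lu(2) one_le_exp_iff[of "1::real"] by linarith
        have nu: "real n = u * real d powr (3/4)" using dp by (simp add: u_def)
        have "s = sqrt (real d) * sqrt L" by (simp add: s_def real_sqrt_mult)
        also have "\<dots> \<le> real d powr (3/4) * u powr (3/4)"
        proof (intro mult_mono)
          show "sqrt (real d) \<le> real d powr (3/4)" using d by (auto simp: powr_half_sqrt[symmetric] intro!: powr_mono)
          have "L \<le> u" unfolding Lu using up ln_le_minus_one[of u] by linarith
          then have "sqrt L \<le> u powr (1/2)" using up by (simp add: powr_half_sqrt)
          also have "\<dots> \<le> u powr (3/4)" using up by (intro powr_mono) auto
          finally show "sqrt L \<le> u powr (3/4)" .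
        qed (use L1 in auto)
        also have "\<dots> = u powr (- 1/4) * real n"
        proof -
          have "u powr (3/4) = u powr (- 1/4) * u" using up powr_add[of u "- 1/4" 1] by simp
          then show ?thesis by (simp add: nu)
        qed
        also have "u powr (- 1/4) = exp (- L / 4)" using up by (simp add: powr_def Lu)
        finally have sn: "s \<le> exp (- L / 4) * real n" .
        have "exp (- L / 4) \<le> \<delta>" using L4 by (simp add: \<delta>_def)
        then have "exp (- L / 4) * (real n / 3) \<le> \<delta> * real N" using N \<delta>1 by (intro mult_mono) auto
        moreover have "c2 * min (real n) s \<le> 1/3 * s" using c23 s0 c2 by (intro mult_mono) auto
        ultimately show ?thesis using sn by simp
      qed
      define m where "m = min r (\<delta> * real N)"
      have mq: "c2 * q \<le> m"
      proof -
        have "c2 * q \<le> c2 * min (real n) s" using c2 by (intro mult_left_mono) (auto simp: q_def)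
        moreover have "c2 * q \<le> r"
        proof -
          have "c2 * q \<le> c0 * real d" using c2 q0 c0 by (intro mult_mono) (auto simp: q_def)
          moreover have "c2 * q \<le> c1 * s" using c2 q0 c1 by (intro mult_mono) (auto simp: q_def)
          ultimately show ?thesis by (auto simp: r_def)
        qed
        ultimately show ?thesis using \<delta>N by (simp add: m_def)
      qed
      show ?thesis
      \<comment> \<open>For m \<ge> 4 half of the exponent absorbs the factor 4 that comes from the
        two sums. For m < 4 the quantity \<open>q\<close> is bounded and the bound by disjoint pairs
        suffices.\<close>
      proof (cases "4 \<le> m")
        case True
        have "P \<le> (exp (- r) + exp (- \<delta> * real N)) ^ N + exp (- r * real N)"
          unfolding P_def
          by (rule complete_event_cone_bound[OF t0 N(1) _ \<delta>1 r0]) (unfold \<delta>_def, rule two[OF d4 r(1,2)])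
        also have "exp (- r * real N) = exp (- r) ^ N"
          using exp_of_nat_mult[of N "- r"] by (simp add: mult.commute)
        also have "(exp (- r) + exp (- \<delta> * real N)) ^ N + exp (- r) ^ N \<le> (2 * exp (- m)) ^ N + (2 * exp (- m)) ^ N"
        proof -
          have e: "exp (- r) \<le> exp (- m)" "exp (- \<delta> * real N) \<le> exp (- m)" by (auto simp: m_def)
          have "(exp (- r) + exp (- \<delta> * real N)) ^ N \<le> (2 * exp (- m)) ^ N"
            by (rule power_mono) (use e in linarith, simp)
          moreover have "exp (- r) ^ N \<le> (2 * exp (- m)) ^ N"
            by (rule power_mono) (use e exp_gt_zero[of "-m"] in linarith, simp)
          ultimately show ?thesis by (rule add_mono)
        qed
        also have "\<dots> = 2 ^ 1 * (2 * exp (- m)) ^ N" by simp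
        also have "\<dots> \<le> 2 ^ N * (2 * exp (- m)) ^ N"
          using N(2) by (intro mult_right_mono power_increasing) auto
        also have "\<dots> = (2 * (2 * exp (- m))) ^ N" by (rule power_mult_distrib[symmetric])
        also have "2 * (2 * exp (- m)) = 4 * exp (- m)" by simp
        also have "(4 * exp (- m)) ^ N \<le> exp (- m / 2) ^ N"
        proof (rule power_mono)
          have "(4::real) \<le> exp 2" using exp_lower_Taylor_quadratic[of "2::real"] by simp
          also have "\<dots> \<le> exp (m / 2)" using True by simp
          finally have "4 * exp (- m) \<le> exp (m / 2) * exp (- m)" by (intro mult_right_mono) auto
          then show "4 * exp (- m) \<le> exp (- m / 2)" by (simp add: mult_exp_exp)
        qed auto
        also have "\<dots> = exp (- (real N * (m / 2)))" using exp_of_nat_mult[of N "- m / 2"] by simp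
        also have "\<dots> \<le> exp (- c * \<Phi>)"
        proof -
          have "real n / 3 * (c2 * q / 2) \<le> real N * (m / 2)" using N mq c2 q0 by (intro mult_mono) auto
          moreover have "c * \<Phi> \<le> c2 / 6 * (real n * q)" unfolding \<Phi>q using c q0 by (intro mult_right_mono) auto
          ultimately show ?thesis by (simp add: mult.commute mult.left_commute)
        qed
        finally show ?thesis .
      next
        case False
        then have "c2 * q \<le> 4" using mq by linarith
        then have "ln 2 / 12 * real n * (c2 * q) \<le> ln 2 / 12 * real n * 4" by (intro mult_left_mono) auto
        moreover have "c * \<Phi> \<le> c2 * ln 2 / 12 * (real n * q)" unfolding \<Phi>q using c q0 by (intro mult_right_mono) auto
        ultimately have "c * \<Phi> \<le> real n * ln 2 / 3" by (simp add: mult_ac)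
        then show ?thesis using weak by (smt (verit) exp_le_cancel_iff mult_minus_left)
      qed
    qed
    then show "measure (gaussian_sample n d) (complete_event n d t)
      \<le> exp (- c * min ((real n)\<^sup>2)
          (min (real n * sqrt (real d * ln (max (real n / real d powr (3/4)) (exp 1)))) (real n * real d)))"
      by (simp add: P_def \<Phi>_def s_def L_def)
  qed
qed

section \<open>Tails, translations and rotations of Gaussian vectors\<close>

lemma ip_self_nonneg [simp]: "0 \<le> ip d x x"
  unfolding ip_def by (intro sum_nonneg) simp

text \<open>The restriction to {1..d} makes the result extensional, hence a point of the sample
  space even if x or y is not.\<close>

definition vlin :: "nat \<Rightarrow> real \<Rightarrow> (nat \<Rightarrow> real) \<Rightarrow> real \<Rightarrow> (nat \<Rightarrow> real) \<Rightarrow> nat \<Rightarrow> real" where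
  "vlin d a x b y = (\<lambda>k\<in>{1..d}. a * x k + b * y k)"

lemma ip_vlin_left: "ip d (vlin d a x b y) z = a * ip d x z + b * ip d y z"
  by (simp add: ip_def vlin_def sum.distrib sum_distrib_left algebra_simps)

lemma ip_vlin_right: "ip d z (vlin d a x b y) = a * ip d z x + b * ip d z y"
  using ip_vlin_left[of d a x b y z] by (simp add: ip_commute)

lemma measurable_vlin [measurable (raw)]:
  assumes "f \<in> measurable M (std_gaussian d)" "g \<in> measurable M (std_gaussian d)"
  shows "(\<lambda>w. vlin d a (f w) b (g w)) \<in> measurable M (std_gaussian d)"
proof -
  note [measurable] = measurable_compose[OF assms(1) measurable_std_gaussian_component]
      measurable_compose[OF assms(2) measurable_std_gaussian_component]
  have "(\<lambda>w. \<lambda>k\<in>{1..d}. a * f w k + b * g w k) \<in> measurable M (PiM {1..d} (\<lambda>_. stdN))"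
    by (rule measurable_restrict) simp
  then show ?thesis unfolding vlin_def std_gaussian_def .
qed

lemma measurable_vlin_const [measurable (raw)]:
  assumes "f \<in> measurable M (std_gaussian d)"
  shows "(\<lambda>w. vlin d a (f w) b y) \<in> measurable M (std_gaussian d)"
proof -
  note [measurable] = measurable_compose[OF assms(1) measurable_std_gaussian_component]
  have "(\<lambda>w. \<lambda>k\<in>{1..d}. a * f w k + b * y k) \<in> measurable M (PiM {1..d} (\<lambda>_. stdN))"
    by (rule measurable_restrict) simp
  then show ?thesis unfolding vlin_def std_gaussian_def .
qed

lemma measurable_ip_const [measurable (raw)]:
  assumes "f \<in> measurable M (std_gaussian d)"
  shows "(\<lambda>w. ip d (f w) y) \<in> borel_measurable M"
  unfolding ip_def
  by (intro borel_measurable_sum borel_measurable_times borel_measurable_const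
      measurable_compose[OF assms(1) measurable_std_gaussian_component])

lemma nn_integral_exp_ip:
  "(\<integral>\<^sup>+x. ennreal (exp (\<mu> * ip d x v)) \<partial>std_gaussian d) = ennreal (exp (\<mu>\<^sup>2 * ip d v v / 2))"
proof -
  have "ennreal (exp (\<mu> * ip d x v)) = (\<Prod>k\<in>{1..d}. ennreal (exp (\<mu> * v k * x k)))" for x
    by (simp add: prod_ennreal exp_sum[symmetric] ip_def sum_distrib_left mult_ac)
  then have "(\<integral>\<^sup>+x. ennreal (exp (\<mu> * ip d x v)) \<partial>std_gaussian d) = (\<Prod>k\<in>{1..d}. \<integral>\<^sup>+u. ennreal (exp (\<mu> * v k * u)) \<partial>stdN)"
    using nn_integral_std_gaussian_prod[of "\<lambda>k u. ennreal (exp (\<mu> * v k * u))" d] by simp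
  also have "\<dots> = ennreal (exp (\<mu>\<^sup>2 * ip d v v / 2))"
    unfolding nn_integral_stdN_exp
    by (simp add: prod_ennreal exp_sum[symmetric] ip_def sum_distrib_left sum_divide_distrib
        power_mult_distrib power2_eq_square mult_ac)
  finally show ?thesis .
qed

lemma nn_integral_exp_norm:
  assumes "a < 1/2"
  shows "(\<integral>\<^sup>+x. ennreal (exp (a * ip d x x)) \<partial>std_gaussian d) = ennreal ((1 / sqrt (1 - 2 * a)) ^ d)"
proof -
  have "ennreal (exp (a * ip d x x)) = (\<Prod>k\<in>{1..d}. ennreal (exp (a * (x k)\<^sup>2)))" for x
    by (simp add: prod_ennreal exp_sum[symmetric] ip_def sum_distrib_left power2_eq_square mult_ac)
  then have "(\<integral>\<^sup>+x. ennreal (exp (a * ip d x x)) \<partial>std_gaussian d) = (\<Prod>k\<in>{1..d}. \<integral>\<^sup>+u. ennreal (exp (a * u\<^sup>2)) \<partial>stdN)"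
    using nn_integral_std_gaussian_prod[of "\<lambda>k u. ennreal (exp (a * u\<^sup>2))" d] by simp
  also have "\<dots> = ennreal ((1 / sqrt (1 - 2 * a)) ^ d)"
    using assms by (simp add: nn_integral_stdN_exp_square ennreal_power)
  finally show ?thesis .
qed

section \<open>Exponential tails and the size of the threshold\<close>

lemma exp_markov:
  assumes "prob_space M" and [measurable]: "f \<in> borel_measurable M"
    and b: "(\<integral>\<^sup>+x. ennreal (exp (f x)) \<partial>M) \<le> ennreal b" "0 \<le> b"
  shows "measure M {x \<in> space M. m \<le> f x} \<le> exp (- m) * b"
proof -
  interpret prob_space M by fact
  have "emeasure M {x \<in> space M. m \<le> f x} = (\<integral>\<^sup>+x. indicator {x \<in> space M. m \<le> f x} x \<partial>M)" by simp
  also have "\<dots> \<le> (\<integral>\<^sup>+x. ennreal (exp (- m)) * ennreal (exp (f x)) \<partial>M)"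
  proof (rule nn_integral_mono)
    fix x
    have "ennreal (exp (- m)) * ennreal (exp (f x)) = ennreal (exp (f x - m))"
      by (simp add: ennreal_mult'[symmetric] mult_exp_exp)
    moreover have "1 \<le> exp (f x - m)" if "m \<le> f x" using that by simp
    ultimately show "indicator {x \<in> space M. m \<le> f x} x \<le> ennreal (exp (- m)) * ennreal (exp (f x))"
      by (auto simp: indicator_def ennreal_1[symmetric] simp del: ennreal_1 intro!: ennreal_leI)
  qed
  also have "\<dots> = ennreal (exp (- m)) * (\<integral>\<^sup>+x. ennreal (exp (f x)) \<partial>M)" by (rule nn_integral_cmult) simp
  also have "\<dots> \<le> ennreal (exp (- m)) * ennreal b" by (intro mult_left_mono b) simp
  also have "\<dots> = ennreal (exp (- m) * b)" by (simp add: ennreal_mult')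
  finally show ?thesis using b(2) by (simp add: emeasure_eq_measure)
qed

lemma norm_upper_tail: "measure (std_gaussian d) {x \<in> space (std_gaussian d). 8 * real d \<le> ip d x x} \<le> exp (- real d)"
proof -
  have "measure (std_gaussian d) {x \<in> space (std_gaussian d). 2 * real d \<le> 1/4 * ip d x x}
      \<le> exp (- (2 * real d)) * (1 / sqrt (1 - 2 * (1/4))) ^ d"
    by (rule exp_markov[OF prob_space_std_gaussian _ eq_refl[OF nn_integral_exp_norm]]) simp_all
  also have "\<dots> \<le> exp (- (2 * real d)) * exp 1 ^ d"
  proof (intro mult_left_mono power_mono)
    have "1 / sqrt (1 - 2 * (1/4)) = sqrt 2" by (simp add: real_sqrt_divide)
    also have "\<dots> \<le> 2" by (rule real_le_lsqrt) auto
    also have "\<dots> \<le> exp 1" using exp_ge_add_one_self[of "1::real"] by simp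
    finally show "1 / sqrt (1 - 2 * (1/4)) \<le> exp (1::real)" .
  qed auto
  also have "\<dots> = exp (- real d)" unfolding exp_of_nat_mult[symmetric] mult_exp_exp by simp
  finally show ?thesis by simp
qed

lemma norm_lower_tail: "measure (std_gaussian d) {x \<in> space (std_gaussian d). ip d x x \<le> real d / 10} \<le> exp (- real d / 2)"
proof -
  have "measure (std_gaussian d) {x \<in> space (std_gaussian d). - real d / 2 \<le> - 5 * ip d x x}
      \<le> exp (- (- real d / 2)) * (1 / sqrt (1 - 2 * (- 5))) ^ d"
    by (rule exp_markov[OF prob_space_std_gaussian _ eq_refl[OF nn_integral_exp_norm]]) simp_all
  also have "\<dots> \<le> exp (- (- real d / 2)) * exp (- 1) ^ d"
  proof (intro mult_left_mono power_mono)
    have "exp 1 \<le> (3::real)" by (rule exp_le)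
    also have "\<dots> \<le> sqrt 11" by (rule real_le_rsqrt) (simp add: power2_eq_square)
    finally show "1 / sqrt (1 - 2 * (- 5)) \<le> exp (- 1 :: real)" by (simp add: exp_minus field_simps)
  qed auto
  also have "\<dots> = exp (- real d / 2)" unfolding exp_of_nat_mult[symmetric] mult_exp_exp by simp
  finally show ?thesis by (simp add: mult.commute)
qed

lemma ip_tail:
  assumes v: "ip d v v \<le> V" and V: "0 < V" and s: "0 < s"
  shows "measure (std_gaussian d) {x \<in> space (std_gaussian d). s < \<bar>ip d x v\<bar>} \<le> 2 * exp (- s\<^sup>2 / (2 * V))"
proof -
  interpret prob_space "std_gaussian d" by (rule prob_space_std_gaussian)
  have one: "prob {x \<in> space (std_gaussian d). s\<^sup>2 / V \<le> \<mu> * ip d x v} \<le> exp (- s\<^sup>2 / (2 * V))"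
    if \<mu>: "\<mu>\<^sup>2 = (s / V)\<^sup>2" for \<mu>
  proof -
    have "prob {x \<in> space (std_gaussian d). s\<^sup>2 / V \<le> \<mu> * ip d x v} \<le> exp (- (s\<^sup>2 / V)) * exp (\<mu>\<^sup>2 * ip d v v / 2)"
      by (rule exp_markov[OF prob_space_std_gaussian _ eq_refl[OF nn_integral_exp_ip]]) simp_all
    also have "\<dots> = exp (\<mu>\<^sup>2 * ip d v v / 2 - s\<^sup>2 / V)" by (simp add: mult_exp_exp)
    also have "\<dots> \<le> exp (- s\<^sup>2 / (2 * V))"
    proof -
      have "\<mu>\<^sup>2 * ip d v v \<le> (s / V)\<^sup>2 * V" unfolding \<mu> by (intro mult_left_mono v) simp
      also have "\<dots> = s\<^sup>2 / V" using V by (simp add: power2_eq_square)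
      finally show ?thesis by (simp add: field_simps)
    qed
    finally show ?thesis .
  qed
  have "{x \<in> space (std_gaussian d). s < \<bar>ip d x v\<bar>} \<subseteq>
      {x \<in> space (std_gaussian d). s\<^sup>2 / V \<le> s / V * ip d x v} \<union> {x \<in> space (std_gaussian d). s\<^sup>2 / V \<le> - (s / V) * ip d x v}"
  proof
    fix x assume x: "x \<in> {x \<in> space (std_gaussian d). s < \<bar>ip d x v\<bar>}"
    then have "s \<le> ip d x v \<or> s \<le> - ip d x v" by auto
    then have "s / V * s \<le> s / V * ip d x v \<or> s / V * s \<le> s / V * (- ip d x v)"
      using s V by (meson mult_left_mono divide_nonneg_nonneg less_imp_le)
    then show "x \<in> {x \<in> space (std_gaussian d). s\<^sup>2 / V \<le> s / V * ip d x v} \<union> {x \<in> space (std_gaussian d). s\<^sup>2 / V \<le> - (s / V) * ip d x v}"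
      using x by (auto simp: power2_eq_square)
  qed
  then have "prob {x \<in> space (std_gaussian d). s < \<bar>ip d x v\<bar>} \<le> prob ({x \<in> space (std_gaussian d). s\<^sup>2 / V \<le> s / V * ip d x v} \<union> {x \<in> space (std_gaussian d). s\<^sup>2 / V \<le> - (s / V) * ip d x v})"
    by (intro finite_measure_mono) measurable
  also have "\<dots> \<le> prob {x \<in> space (std_gaussian d). s\<^sup>2 / V \<le> s / V * ip d x v} + prob {x \<in> space (std_gaussian d). s\<^sup>2 / V \<le> - (s / V) * ip d x v}"
    by (rule measure_Un_le) measurable
  also have "\<dots> \<le> 2 * exp (- s\<^sup>2 / (2 * V))"
    using one[of "s / V"] one[of "- (s / V)"] by simp
  finally show ?thesis .
qed

text \<open>Chernoff with l = 1 / sqrt (2 * d). Given y the moment generating function is exp (l^2 *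
  |y|^2 / 2), and its mean (1 - l^2)^(-d/2) is at most exp (1/2) because d * l^2 = 1/2.\<close>

lemma threshold_upper:
  assumes th: "is_threshold d p t" and p: "0 < p" and d: "1 \<le> d"
  shows "t \<le> sqrt 2 * (1/2 - ln p) * sqrt (real d)"
proof -
  let ?G = "std_gaussian d"
  interpret prob_space ?G by (rule prob_space_std_gaussian)
  define l where "l = 1 / sqrt (2 * real d)"
  have dp: "0 < real d" using d by simp
  have l2: "l\<^sup>2 = 1 / (2 * real d)" "0 < l" using dp by (auto simp: l_def power_divide)
  have l2': "l\<^sup>2 \<le> 1/2" using d by (simp add: l2)
  have "ennreal p = (\<integral>\<^sup>+y. ennreal (prob {x \<in> space ?G. t \<le> ip d x y}) \<partial>?G)"
    by (rule threshold_integral[OF th, symmetric])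
  also have "\<dots> \<le> (\<integral>\<^sup>+y. ennreal (exp (- (l * t))) * ennreal (exp (l\<^sup>2 / 2 * ip d y y)) \<partial>?G)"
  proof (rule nn_integral_mono)
    fix y
    have "prob {x \<in> space ?G. t \<le> ip d x y} = prob {x \<in> space ?G. l * t \<le> l * ip d x y}"
      using l2 by simp
    also have "\<dots> \<le> exp (- (l * t)) * exp (l\<^sup>2 * ip d y y / 2)"
      by (rule exp_markov[OF prob_space_std_gaussian _ eq_refl[OF nn_integral_exp_ip]]) simp_all
    finally show "ennreal (prob {x \<in> space ?G. t \<le> ip d x y}) \<le> ennreal (exp (- (l * t))) * ennreal (exp (l\<^sup>2 / 2 * ip d y y))"
      by (simp add: ennreal_mult'[symmetric])
  qed
  also have "\<dots> = ennreal (exp (- (l * t))) * ennreal ((1 / sqrt (1 - 2 * (l\<^sup>2 / 2))) ^ d)"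
    using l2' by (subst nn_integral_cmult, measurable, subst nn_integral_exp_norm) simp_all
  also have "\<dots> = ennreal (exp (- (l * t)) * (1 / sqrt (1 - l\<^sup>2)) ^ d)" by (simp add: ennreal_mult')
  finally have "p \<le> exp (- (l * t)) * (1 / sqrt (1 - l\<^sup>2)) ^ d"
    using l2' by (subst (asm) ennreal_le_iff) auto
  also have "\<dots> \<le> exp (- (l * t)) * exp (l\<^sup>2) ^ d"
  proof (intro mult_left_mono power_mono)
    have "1 \<le> exp (2 * l\<^sup>2) * (1 - l\<^sup>2)"
    proof -
      have "1 + l\<^sup>2 * (1 - 2 * l\<^sup>2) = (1 + 2 * l\<^sup>2) * (1 - l\<^sup>2)" by (simp add: algebra_simps)
      also have "\<dots> \<le> exp (2 * l\<^sup>2) * (1 - l\<^sup>2)" using l2' by (intro mult_right_mono exp_ge_add_one_self) auto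
      finally have "1 + l\<^sup>2 * (1 - 2 * l\<^sup>2) \<le> exp (2 * l\<^sup>2) * (1 - l\<^sup>2)" .
      moreover have "0 \<le> l\<^sup>2 * (1 - 2 * l\<^sup>2)" using l2' by (intro mult_nonneg_nonneg) auto
      ultimately show ?thesis by linarith
    qed
    then have "1 \<le> sqrt (exp (2 * l\<^sup>2) * (1 - l\<^sup>2))" by simp
    also have "\<dots> = exp (l\<^sup>2) * sqrt (1 - l\<^sup>2)"
      by (simp add: real_sqrt_mult exp_double)
    finally show "1 / sqrt (1 - l\<^sup>2) \<le> exp (l\<^sup>2)" using l2' by (simp add: field_simps)
  qed (use l2' in auto)
  also have "\<dots> = exp (1/2 - l * t)"
    unfolding exp_of_nat_mult[symmetric] mult_exp_exp using dp by (simp add: l2)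
  finally have "p \<le> exp (1/2 - l * t)" .
  then have "ln p \<le> ln (exp (1/2 - l * t))" using p by (subst ln_le_cancel_iff) auto
  then have "l * t \<le> 1/2 - ln p" by simp
  then have "t \<le> (1/2 - ln p) * sqrt (2 * real d)" using dp by (simp add: l_def field_simps)
  then show ?thesis by (simp add: real_sqrt_mult mult_ac)
qed

section \<open>Translations and the cost of shifting a symmetric event\<close>

text \<open>Boxes determine the product law. Taking \<open>E\<close> Borel at every index, also
  outside {1..d}, keeps the later product computations free of side conditions.\<close>

lemma std_gaussian_eqI:
  assumes "sets P = sets (std_gaussian d)" "finite_measure P"
    and "\<And>E. (\<And>k. E k \<in> sets borel) \<Longrightarrow> emeasure P (PiE {1..d} E) = (\<Prod>k\<in>{1..d}. emeasure stdN (E k))"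
  shows "P = std_gaussian d"
  unfolding std_gaussian_def
proof (rule stdN.PiM_eqI)
  fix A :: "nat \<Rightarrow> real set" assume A: "\<And>i. i \<in> {1..d} \<Longrightarrow> A i \<in> sets stdN"
  define E where "E i = (if i \<in> {1..d} then A i else {})" for i
  have "PiE {1..d} A = PiE {1..d} E" by (rule PiE_cong) (simp add: E_def)
  moreover have "(\<Prod>i\<in>{1..d}. emeasure stdN (A i)) = (\<Prod>i\<in>{1..d}. emeasure stdN (E i))"
    by (rule prod.cong) (auto simp: E_def)
  moreover have "E k \<in> sets borel" for k using A by (auto simp: E_def)
  ultimately show "emeasure P (PiE {1..d} A) = (\<Prod>i\<in>{1..d}. emeasure stdN (A i))"
    using assms(3)[of E] by simp
qed (use assms in \<open>auto simp: std_gaussian_def\<close>)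

lemma nn_integral_indicator_box:
  fixes E :: "nat \<Rightarrow> real set" and x :: "nat \<Rightarrow> real"
  assumes "\<And>k. E k \<in> sets borel" and "x \<in> extensional {1..d}"
  shows "(indicator (PiE {1..d} E) x :: ennreal) = (\<Prod>k\<in>{1..d}. indicator (E k) (x k))"
proof (cases "x \<in> PiE {1..d} E")
  case False
  then obtain k where "k \<in> {1..d}" "x k \<notin> E k" using assms(2) by (auto simp: PiE_iff)
  then have "(\<Prod>k\<in>{1..d}. indicator (E k) (x k) :: ennreal) = 0"
    by (intro prod_zero bexI[of _ k] finite_atLeastAtMost) auto
  then show ?thesis using False by simp
qed (auto intro!: prod.neutral[symmetric] simp: PiE_mem)

lemma stdN_translate:
  assumes [measurable]: "E \<in> sets borel"
  shows "(\<integral>\<^sup>+x. ennreal (exp (c * x - c\<^sup>2 / 2)) * indicator E (x - c) \<partial>stdN) = emeasure stdN E"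
proof -
  have "(\<integral>\<^sup>+x. ennreal (exp (c * x - c\<^sup>2 / 2)) * indicator E (x - c) \<partial>stdN)
     = (\<integral>\<^sup>+x. ennreal (std_normal_density x) * (ennreal (exp (c * x - c\<^sup>2 / 2)) * indicator E (x - c)) \<partial>lborel)"
    by (rule nn_integral_stdN) measurable
  also have "\<dots> = (\<integral>\<^sup>+x. ennreal (std_normal_density (x - c)) * indicator E (x - c) \<partial>lborel)"
  proof (rule nn_integral_cong)
    fix x :: real
    have "std_normal_density x * exp (c * x - c\<^sup>2 / 2) = std_normal_density (x - c)"
      by (simp add: std_normal_density_def mult_exp_exp power2_eq_square field_simps)
    then show "ennreal (std_normal_density x) * (ennreal (exp (c * x - c\<^sup>2 / 2)) * indicator E (x - c))
        = ennreal (std_normal_density (x - c)) * indicator E (x - c)"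
      by (simp add: mult.assoc[symmetric] ennreal_mult'[symmetric])
  qed
  also have "\<dots> = (\<integral>\<^sup>+x. ennreal (std_normal_density x) * indicator E x \<partial>lborel)"
    by (subst nn_integral_real_affine[of _ 1 c]) (auto simp: one_ennreal_def[symmetric])
  also have "\<dots> = emeasure stdN E" by (subst emeasure_density) auto
  finally show ?thesis .
qed

text \<open>The Cameron-Martin formula: the density is that of the law translated by u, and the map
  translates back. On boxes everything factors into the one-dimensional statement.\<close>

lemma std_gaussian_translate:
  "distr (density (std_gaussian d) (\<lambda>x. ennreal (exp (ip d x u - ip d u u / 2)))) (std_gaussian d) (\<lambda>x. vlin d 1 x (- 1) u) = std_gaussian d"
proof (rule std_gaussian_eqI)
  let ?G = "std_gaussian d"
  let ?D = "density ?G (\<lambda>x. ennreal (exp (ip d x u - ip d u u / 2)))"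
  have m [measurable]: "(\<lambda>x. vlin d 1 x (- 1) u) \<in> measurable ?D ?G" by simp
  show box: "emeasure (distr ?D ?G (\<lambda>x. vlin d 1 x (- 1) u)) (PiE {1..d} E) = (\<Prod>k\<in>{1..d}. emeasure stdN (E k))"
    if E: "\<And>k. E k \<in> sets borel" for E
  proof -
    have B [measurable]: "PiE {1..d} E \<in> sets ?G" by (rule box_sets[OF E])
    let ?T = "\<lambda>x. vlin d 1 x (- 1) u"
    have [measurable]: "?T -` PiE {1..d} E \<inter> space ?G \<in> sets ?G" by measurable
    have "emeasure (distr ?D ?G ?T) (PiE {1..d} E) = emeasure ?D (?T -` PiE {1..d} E \<inter> space ?G)"
      using emeasure_distr[OF m B] by simp
    also have "\<dots> = (\<integral>\<^sup>+x. ennreal (exp (ip d x u - ip d u u / 2)) * indicator (?T -` PiE {1..d} E \<inter> space ?G) x \<partial>?G)"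
      by (rule emeasure_density) measurable
    also have "\<dots> = (\<integral>\<^sup>+x. ennreal (exp (ip d x u - ip d u u / 2)) * indicator (PiE {1..d} E) (?T x) \<partial>?G)"
      by (rule nn_integral_cong) (simp add: indicator_def)
    also have "\<dots> = (\<integral>\<^sup>+x. (\<Prod>k\<in>{1..d}. ennreal (exp (u k * x k - (u k)\<^sup>2 / 2)) * indicator (E k) (x k - u k)) \<partial>?G)"
    proof (rule nn_integral_cong)
      fix x
      have "indicator (PiE {1..d} E) (vlin d 1 x (- 1) u) = (\<Prod>k\<in>{1..d}. indicator (E k) (vlin d 1 x (- 1) u k) :: ennreal)"
        by (rule nn_integral_indicator_box[OF E]) (simp add: vlin_def)
      also have "\<dots> = (\<Prod>k\<in>{1..d}. indicator (E k) (x k - u k))"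
        by (rule prod.cong) (auto simp: vlin_def)
      finally have 1: "indicator (PiE {1..d} E) (vlin d 1 x (- 1) u) = (\<Prod>k\<in>{1..d}. indicator (E k) (x k - u k) :: ennreal)" .
      have 2: "ennreal (exp (ip d x u - ip d u u / 2)) = (\<Prod>k\<in>{1..d}. ennreal (exp (u k * x k - (u k)\<^sup>2 / 2)))"
        by (simp add: prod_ennreal exp_sum[symmetric] ip_def sum_subtractf sum_divide_distrib power2_eq_square mult.commute)
      show "ennreal (exp (ip d x u - ip d u u / 2)) * indicator (PiE {1..d} E) (vlin d 1 x (- 1) u)
          = (\<Prod>k\<in>{1..d}. ennreal (exp (u k * x k - (u k)\<^sup>2 / 2)) * indicator (E k) (x k - u k))"
        unfolding 1 2 by (rule prod.distrib[symmetric])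
    qed
    also have "\<dots> = (\<Prod>k\<in>{1..d}. \<integral>\<^sup>+w. ennreal (exp (u k * w - (u k)\<^sup>2 / 2)) * indicator (E k) (w - u k) \<partial>stdN)"
      by (rule nn_integral_std_gaussian_prod[of "\<lambda>k w. ennreal (exp (u k * w - (u k)\<^sup>2 / 2)) * indicator (E k) (w - u k)"])
        (use E in measurable)
    also have "\<dots> = (\<Prod>k\<in>{1..d}. emeasure stdN (E k))" using E by (simp add: stdN_translate)
    finally show ?thesis .
  qed
  show "finite_measure (distr ?D ?G (\<lambda>x. vlin d 1 x (- 1) u))"
  proof (rule finite_measureI)
    interpret N: prob_space stdN by (rule prob_space_stdN)
    have "space (distr ?D ?G (\<lambda>x. vlin d 1 x (- 1) u)) = PiE {1..d} (\<lambda>_. UNIV)"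
      by (simp add: std_gaussian_def space_PiM)
    then show "emeasure (distr ?D ?G (\<lambda>x. vlin d 1 x (- 1) u)) (space (distr ?D ?G (\<lambda>x. vlin d 1 x (- 1) u))) \<noteq> \<infinity>"
      using box[of "\<lambda>_. UNIV"] N.emeasure_space_1 by simp
  qed
qed simp

text \<open>The measure of the translate is the integral over A of exp (- ip d x u - |u|^2 / 2). By
  symmetry of A it is also the integral with the sign of ip d x u reversed. The average of the two
  contains a hyperbolic cosine, which is at least 1.\<close>

lemma cameron_martin_symmetric:
  assumes A [measurable]: "A \<in> sets (std_gaussian d)" and sym: "\<And>x. x \<in> A \<Longrightarrow> vneg d x \<in> A"
  shows "exp (- ip d u u / 2) * measure (std_gaussian d) A
    \<le> measure (std_gaussian d) {x \<in> space (std_gaussian d). vlin d 1 x (- 1) u \<in> A}"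
proof -
  let ?G = "std_gaussian d"
  interpret prob_space ?G by (rule prob_space_std_gaussian)
  define v where "v = vneg d u"
  have iv1: "ip d x v = - ip d x u" for x unfolding v_def by (metis ip_commute ip_vneg)
  have iv: "ip d x v = - ip d x u" "ip d v v = ip d u u" for x
    using iv1[of x] iv1[of v] iv1[of u] ip_commute[of d v u] by simp_all
  have vl: "vlin d 1 (vlin d 1 x (- 1) v) (- 1) u = x" if "x \<in> space ?G" for x
    using that by (auto simp: vlin_def v_def vneg_def std_gaussian_def space_PiM PiE_def extensional_def)
  let ?A' = "{x \<in> space ?G. vlin d 1 x (- 1) u \<in> A}"
  have A' [measurable]: "?A' \<in> sets ?G" by measurable
  let ?D = "density ?G (\<lambda>x. ennreal (exp (ip d x v - ip d v v / 2)))"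
  have Asub: "x \<in> space ?G" if "x \<in> A" for x using that sets.sets_into_space[OF A] by auto
  have "emeasure ?G ?A' = emeasure (distr ?D ?G (\<lambda>x. vlin d 1 x (- 1) v)) ?A'"
    by (simp add: std_gaussian_translate)
  also have "\<dots> = emeasure ?D ((\<lambda>x. vlin d 1 x (- 1) v) -` ?A' \<inter> space ?D)"
    by (rule emeasure_distr) simp_all
  also have "(\<lambda>x. vlin d 1 x (- 1) v) -` ?A' \<inter> space ?D = A"
    using Asub measurable_space[OF measurable_vlin_const[OF measurable_ident_sets[OF refl]], of _ d 1 "- 1" v]
    by (auto simp: vl)
  also have "emeasure ?D A = (\<integral>\<^sup>+x. ennreal (exp (ip d x v - ip d v v / 2)) * indicator A x \<partial>?G)"
    by (rule emeasure_density) measurable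
  finally have e1: "emeasure ?G ?A' = (\<integral>\<^sup>+x. ennreal (exp (- ip d x u - ip d u u / 2)) * indicator A x \<partial>?G)"
    unfolding iv(2) unfolding iv1 .
  also have "\<dots> = (\<integral>\<^sup>+x. ennreal (exp (- ip d x u - ip d u u / 2)) * indicator A x \<partial>distr ?G ?G (vneg d))"
    by (simp add: distr_std_gaussian_vneg)
  also have "\<dots> = (\<integral>\<^sup>+x. ennreal (exp (- ip d (vneg d x) u - ip d u u / 2)) * indicator A (vneg d x) \<partial>?G)"
    by (rule nn_integral_distr[OF measurable_vneg]) (simp only: measurable_distr_eq1, measurable)
  also have "\<dots> = (\<integral>\<^sup>+x. ennreal (exp (ip d x u - ip d u u / 2)) * indicator A x \<partial>?G)"
  proof (rule nn_integral_cong)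
    fix x assume x: "x \<in> space ?G"
    have "vneg d (vneg d x) = x" using x
      by (auto simp: vneg_def std_gaussian_def space_PiM PiE_def extensional_def)
    then have "vneg d x \<in> A \<longleftrightarrow> x \<in> A" using sym by metis
    then show "ennreal (exp (- ip d (vneg d x) u - ip d u u / 2)) * indicator A (vneg d x)
      = ennreal (exp (ip d x u - ip d u u / 2)) * indicator A x"
      by (simp add: ip_vneg indicator_def)
  qed
  finally have e2: "emeasure ?G ?A' = (\<integral>\<^sup>+x. ennreal (exp (ip d x u - ip d u u / 2)) * indicator A x \<partial>?G)" .
  have "ennreal (2 * (exp (- ip d u u / 2) * prob A)) = ennreal (2 * exp (- ip d u u / 2)) * emeasure ?G A"
    by (simp add: emeasure_eq_measure ennreal_mult'[symmetric] mult.assoc)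
  also have "\<dots> = (\<integral>\<^sup>+x. ennreal (2 * exp (- ip d u u / 2)) * indicator A x \<partial>?G)"
    by (rule nn_integral_cmult_indicator[symmetric]) simp
  also have "\<dots> \<le> (\<integral>\<^sup>+x. ennreal (exp (- ip d x u - ip d u u / 2)) * indicator A x + ennreal (exp (ip d x u - ip d u u / 2)) * indicator A x \<partial>?G)"
  proof (rule nn_integral_mono)
    fix x
    have "2 \<le> exp (- ip d x u) + exp (ip d x u)"
      using exp_ge_add_one_self[of "ip d x u"] exp_ge_add_one_self[of "- ip d x u"] by linarith
    then have "exp (- ip d u u / 2) * 2 \<le> exp (- ip d u u / 2) * (exp (- ip d x u) + exp (ip d x u))"
      by (intro mult_left_mono) auto
    also have "\<dots> = exp (- ip d x u - ip d u u / 2) + exp (ip d x u - ip d u u / 2)"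
      by (simp add: distrib_left mult_exp_exp add.commute)
    finally have "ennreal (2 * exp (- ip d u u / 2)) \<le> ennreal (exp (- ip d x u - ip d u u / 2) + exp (ip d x u - ip d u u / 2))"
      by (intro ennreal_leI) simp
    then show "ennreal (2 * exp (- ip d u u / 2)) * indicator A x
       \<le> ennreal (exp (- ip d x u - ip d u u / 2)) * indicator A x + ennreal (exp (ip d x u - ip d u u / 2)) * indicator A x"
      by (simp add: indicator_def)
  qed
  also have "\<dots> = emeasure ?G ?A' + emeasure ?G ?A'"
    by (subst nn_integral_add, measurable, measurable) (simp only: e1[symmetric] e2[symmetric])
  also have "\<dots> = ennreal (2 * prob ?A')" by (simp add: emeasure_eq_measure ennreal_plus[symmetric] del: ennreal_plus)
  finally have "2 * (exp (- ip d u u / 2) * prob A) \<le> 2 * prob ?A'"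
    by (subst (asm) ennreal_le_iff) auto
  then show ?thesis by simp
qed

text \<open>The pattern \<open>x k\<close> of these two rules matches every application, so that they misguide
  measurability proofs outside of the sample space.\<close>

declare measurable_std_gaussian_component [measurable del] measurable_sample_component [measurable del]

section \<open>Differences of independent Gaussian vectors\<close>

text \<open>After reflecting y, a change of variables in the inner integral exhibits the convolution
  of two standard densities, which is the normal density of variance 2; the scaling by sqrt 2
  normalizes it.\<close>

lemma stdN_diff:
  assumes [measurable]: "E \<in> sets borel"
  shows "(\<integral>\<^sup>+x. \<integral>\<^sup>+y. indicator E ((x - y) / sqrt 2) \<partial>stdN \<partial>stdN) = emeasure stdN E"
proof -
  interpret N: prob_space stdN by (rule prob_space_stdN)
  have "(\<integral>\<^sup>+y. indicator E ((x - y) / sqrt 2) \<partial>stdN) = (\<integral>\<^sup>+y. ennreal (std_normal_density y) * indicator E ((x + y) / sqrt 2) \<partial>lborel)" for x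
  proof -
    have "(\<integral>\<^sup>+y. indicator E ((x - y) / sqrt 2) \<partial>stdN) = (\<integral>\<^sup>+y. indicator E ((x - y) / sqrt 2) \<partial>distr stdN borel uminus)"
      by (simp add: distr_stdN_uminus)
    also have "\<dots> = (\<integral>\<^sup>+y. indicator E ((x - - y) / sqrt 2) \<partial>stdN)"
      by (rule nn_integral_distr; simp)
    also have "\<dots> = (\<integral>\<^sup>+y. ennreal (std_normal_density y) * indicator E ((x + y) / sqrt 2) \<partial>lborel)"
      by (subst nn_integral_stdN; simp)
    finally show ?thesis .
  qed
  then have "(\<integral>\<^sup>+x. \<integral>\<^sup>+y. indicator E ((x - y) / sqrt 2) \<partial>stdN \<partial>stdN)
      = (\<integral>\<^sup>+x. ennreal (std_normal_density x) * (\<integral>\<^sup>+y. ennreal (std_normal_density y) * indicator E ((x + y) / sqrt 2) \<partial>lborel) \<partial>lborel)"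
    by (simp only:) (rule nn_integral_stdN, measurable)
  also have "\<dots> = (\<integral>\<^sup>+x. \<integral>\<^sup>+y. ennreal (std_normal_density x * std_normal_density y) * indicator E ((x + y) / sqrt 2) \<partial>lborel \<partial>lborel)"
    by (intro nn_integral_cong, subst nn_integral_cmult[symmetric], measurable)
      (simp add: ennreal_mult' mult.assoc)
  also have "\<dots> = (\<integral>\<^sup>+y. \<integral>\<^sup>+x. ennreal (std_normal_density x * std_normal_density y) * indicator E ((x + y) / sqrt 2) \<partial>lborel \<partial>lborel)"
    by (rule lborel_pair.Fubini') measurable
  also have "\<dots> = (\<integral>\<^sup>+y. \<integral>\<^sup>+z. ennreal (sqrt 2) * (ennreal (std_normal_density (sqrt 2 * z - y) * std_normal_density y) * indicator E z) \<partial>lborel \<partial>lborel)"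
  proof (rule nn_integral_cong)
    fix y :: real
    have "(\<integral>\<^sup>+x. ennreal (std_normal_density x * std_normal_density y) * indicator E ((x + y) / sqrt 2) \<partial>lborel)
       = ennreal \<bar>sqrt 2\<bar> * (\<integral>\<^sup>+z. ennreal (std_normal_density (- y + sqrt 2 * z) * std_normal_density y) * indicator E ((- y + sqrt 2 * z + y) / sqrt 2) \<partial>lborel)"
      by (rule nn_integral_real_affine) auto
    also have "\<dots> = (\<integral>\<^sup>+z. ennreal (sqrt 2) * (ennreal (std_normal_density (sqrt 2 * z - y) * std_normal_density y) * indicator E z) \<partial>lborel)"
      by (subst nn_integral_cmult) simp_all
    finally show "(\<integral>\<^sup>+x. ennreal (std_normal_density x * std_normal_density y) * indicator E ((x + y) / sqrt 2) \<partial>lborel) = \<dots>" .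
  qed
  also have "\<dots> = (\<integral>\<^sup>+z. \<integral>\<^sup>+y. ennreal (sqrt 2) * (ennreal (std_normal_density (sqrt 2 * z - y) * std_normal_density y) * indicator E z) \<partial>lborel \<partial>lborel)"
    by (rule lborel_pair.Fubini') measurable
  also have "\<dots> = (\<integral>\<^sup>+z. ennreal (std_normal_density z) * indicator E z \<partial>lborel)"
  proof (rule nn_integral_cong)
    fix z :: real
    have "(\<integral>\<^sup>+y. ennreal (sqrt 2) * (ennreal (std_normal_density (sqrt 2 * z - y) * std_normal_density y) * indicator E z) \<partial>lborel)
      = (\<integral>\<^sup>+y. ennreal (std_normal_density (sqrt 2 * z - y) * std_normal_density y) * (ennreal (sqrt 2) * indicator E z) \<partial>lborel)"
      by (intro nn_integral_cong) (simp only: ac_simps)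
    also have "\<dots> = (\<integral>\<^sup>+y. ennreal (std_normal_density (sqrt 2 * z - y) * std_normal_density y) \<partial>lborel) * (ennreal (sqrt 2) * indicator E z)"
      by (rule nn_integral_multc) measurable
    also have "(\<integral>\<^sup>+y. ennreal (std_normal_density (sqrt 2 * z - y) * std_normal_density y) \<partial>lborel) = ennreal (normal_density 0 (sqrt 2) (sqrt 2 * z))"
      using fun_cong[OF conv_std_normal_density, of "sqrt 2 * z"] by simp
    also have "\<dots> * (ennreal (sqrt 2) * indicator E z) = ennreal (std_normal_density z) * indicator E z"
    proof -
      have "sqrt (2 * pi * (sqrt 2)\<^sup>2) = sqrt (2 * pi) * sqrt 2" by (simp add: real_sqrt_mult)
      then have "normal_density 0 (sqrt 2) (sqrt 2 * z) * sqrt 2 = std_normal_density z"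
        unfolding normal_density_def std_normal_density_def by (simp add: power_mult_distrib)
      then show ?thesis by (simp add: mult.assoc[symmetric] ennreal_mult'[symmetric])
    qed
    finally show "(\<integral>\<^sup>+y. ennreal (sqrt 2) * (ennreal (std_normal_density (sqrt 2 * z - y) * std_normal_density y) * indicator E z) \<partial>lborel) = \<dots>" .
  qed
  also have "\<dots> = emeasure stdN E" by (subst emeasure_density) auto
  finally show ?thesis .
qed

lemma std_gaussian_rotate:
  "distr (std_gaussian d \<Otimes>\<^sub>M std_gaussian d) (std_gaussian d) (\<lambda>w. vlin d (1 / sqrt 2) (fst w) (- 1 / sqrt 2) (snd w)) = std_gaussian d"
proof (rule std_gaussian_eqI)
  let ?G = "std_gaussian d"
  let ?T = "\<lambda>w. vlin d (1 / sqrt 2) (fst w) (- 1 / sqrt 2) (snd w)"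
  interpret G: prob_space ?G by (rule prob_space_std_gaussian)
  interpret N: prob_space stdN by (rule prob_space_stdN)
  interpret PP: pair_prob_space ?G ?G ..
  have T [measurable]: "?T \<in> measurable (?G \<Otimes>\<^sub>M ?G) ?G" by measurable
  show "finite_measure (distr (?G \<Otimes>\<^sub>M ?G) ?G ?T)"
    using PP.prob_space_distr[OF T] by (simp add: prob_space_def)
  fix E :: "nat \<Rightarrow> real set" assume E: "\<And>k. E k \<in> sets borel"
  have B [measurable]: "PiE {1..d} E \<in> sets ?G" by (rule box_sets[OF E])
  have [measurable]: "(\<lambda>u. \<integral>\<^sup>+v. indicator (E k) ((u - v) / sqrt 2) \<partial>stdN) \<in> borel_measurable borel" for k
    using E[of k] by measurable
  have "emeasure (distr (?G \<Otimes>\<^sub>M ?G) ?G ?T) (PiE {1..d} E) = emeasure (?G \<Otimes>\<^sub>M ?G) (?T -` PiE {1..d} E \<inter> space (?G \<Otimes>\<^sub>M ?G))"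
    by (rule emeasure_distr[OF T B])
  also have "\<dots> = (\<integral>\<^sup>+x. \<integral>\<^sup>+y. indicator (?T -` PiE {1..d} E \<inter> space (?G \<Otimes>\<^sub>M ?G)) (x, y) \<partial>?G \<partial>?G)"
    by (rule sigma_finite_measure.emeasure_pair_measure[OF prob_space_imp_sigma_finite[OF prob_space_std_gaussian]]) measurable
  also have "\<dots> = (\<integral>\<^sup>+x. \<integral>\<^sup>+y. (\<Prod>k\<in>{1..d}. indicator (E k) ((x k - y k) / sqrt 2)) \<partial>?G \<partial>?G)"
  proof (intro nn_integral_cong)
    fix x y assume xy: "x \<in> space ?G" "y \<in> space ?G"
    have "indicator (?T -` PiE {1..d} E \<inter> space (?G \<Otimes>\<^sub>M ?G)) (x, y) = (indicator (PiE {1..d} E) (?T (x, y)) :: ennreal)"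
      using xy by (auto simp: indicator_def space_pair_measure)
    also have "\<dots> = (\<Prod>k\<in>{1..d}. indicator (E k) (?T (x, y) k))"
      by (rule nn_integral_indicator_box[OF E]) (simp add: vlin_def)
    also have "\<dots> = (\<Prod>k\<in>{1..d}. indicator (E k) ((x k - y k) / sqrt 2))"
      by (rule prod.cong) (auto simp: vlin_def diff_divide_distrib)
    finally show "indicator (?T -` PiE {1..d} E \<inter> space (?G \<Otimes>\<^sub>M ?G)) (x, y) = (\<Prod>k\<in>{1..d}. indicator (E k) ((x k - y k) / sqrt 2) :: ennreal)" .
  qed
  also have "\<dots> = (\<integral>\<^sup>+x. (\<Prod>k\<in>{1..d}. \<integral>\<^sup>+v. indicator (E k) ((x k - v) / sqrt 2) \<partial>stdN) \<partial>?G)"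
    by (intro nn_integral_cong nn_integral_std_gaussian_prod[of "\<lambda>k v. indicator (E k) ((_ k - v) / sqrt 2)"])
      (use E in measurable)
  also have "\<dots> = (\<Prod>k\<in>{1..d}. \<integral>\<^sup>+u. \<integral>\<^sup>+v. indicator (E k) ((u - v) / sqrt 2) \<partial>stdN \<partial>stdN)"
    by (rule nn_integral_std_gaussian_prod[of "\<lambda>k u. \<integral>\<^sup>+v. indicator (E k) ((u - v) / sqrt 2) \<partial>stdN"]) measurable
  also have "\<dots> = (\<Prod>k\<in>{1..d}. emeasure stdN (E k))" using E by (simp add: stdN_diff)
  finally show "emeasure (distr (?G \<Otimes>\<^sub>M ?G) ?G ?T) (PiE {1..d} E) = (\<Prod>k\<in>{1..d}. emeasure stdN (E k))" .
qed simp

text \<open>Two independent vectors lie in C with the squared probability, and their difference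
  divided by sqrt 2 is again standard. This turns a set of unknown location into one centred at the
  origin.\<close>

lemma rotation_square:
  assumes C [measurable]: "C \<in> sets (std_gaussian d)" and S [measurable]: "S \<in> sets (std_gaussian d)"
    and CS: "\<And>x y. x \<in> C \<Longrightarrow> y \<in> C \<Longrightarrow> vlin d (1 / sqrt 2) x (- 1 / sqrt 2) y \<in> S"
  shows "(measure (std_gaussian d) C)\<^sup>2 \<le> measure (std_gaussian d) S"
proof -
  let ?G = "std_gaussian d"
  let ?T = "\<lambda>w. vlin d (1 / sqrt 2) (fst w) (- 1 / sqrt 2) (snd w)"
  interpret G: prob_space ?G by (rule prob_space_std_gaussian)
  have T [measurable]: "?T \<in> measurable (?G \<Otimes>\<^sub>M ?G) ?G" by measurable
  have "ennreal ((measure ?G C)\<^sup>2) = emeasure (?G \<Otimes>\<^sub>M ?G) (C \<times> C)"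
    by (simp add: sigma_finite_measure.emeasure_pair_measure_Times[OF prob_space_imp_sigma_finite[OF prob_space_std_gaussian]] G.emeasure_eq_measure ennreal_mult'[symmetric] power2_eq_square)
  also have "\<dots> \<le> emeasure (?G \<Otimes>\<^sub>M ?G) (?T -` S \<inter> space (?G \<Otimes>\<^sub>M ?G))"
    by (rule emeasure_mono) (use CS sets.sets_into_space[OF C] in \<open>auto simp: space_pair_measure\<close>)
  also have "\<dots> = emeasure (distr (?G \<Otimes>\<^sub>M ?G) ?G ?T) S" by (rule emeasure_distr[symmetric, OF T S])
  also have "\<dots> = ennreal (measure ?G S)" by (simp only: std_gaussian_rotate G.emeasure_eq_measure)
  finally show ?thesis by (subst (asm) ennreal_le_iff) auto
qed

section \<open>Simultaneous slabs by pigeonhole\<close>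

lemma sum_half_power_abs_le: "(\<Sum>i\<in>{- int m..int m}. (1/2 :: real) ^ nat \<bar>i\<bar>) \<le> 3 - 2 * (1/2) ^ m"
proof (induction m)
  case (Suc m)
  have "{- int (Suc m)..int (Suc m)} = insert (- int (Suc m)) (insert (int (Suc m)) {- int m..int m})" by auto
  then have "(\<Sum>i\<in>{- int (Suc m)..int (Suc m)}. (1/2 :: real) ^ nat \<bar>i\<bar>)
      = (1/2) ^ Suc m + ((1/2) ^ Suc m + (\<Sum>i\<in>{- int m..int m}. (1/2 :: real) ^ nat \<bar>i\<bar>))"
    by (simp add: nat_add_distrib)
  also have "\<dots> \<le> 3 - 2 * (1/2) ^ Suc m" using Suc.IH by simp
  finally show ?case .
qed simp

text \<open>A generating function evaluated at 1/2: each counted vector has weight 2^m times the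
  product of 2^(-|z j|), which is at least 1, and the weights of one coordinate sum to at most
  3.\<close>

lemma card_small_integer_vectors:
  fixes m :: nat
  assumes J: "finite J"
  shows "real (card {z \<in> PiE J (\<lambda>_. {- int m..int m}). (\<Sum>j\<in>J. nat \<bar>z j\<bar>) \<le> m}) \<le> 2 ^ m * 3 ^ card J"
proof -
  let ?P = "PiE J (\<lambda>_. {- int m..int m})"
  let ?F = "{z \<in> ?P. (\<Sum>j\<in>J. nat \<bar>z j\<bar>) \<le> m}"
  have fin: "finite ?P" by (rule finite_PiE[OF J]) simp
  have "real (card ?F) = (\<Sum>z\<in>?F. 1)" by simp
  also have "\<dots> \<le> (\<Sum>z\<in>?F. 2 ^ m * (\<Prod>j\<in>J. (1/2) ^ nat \<bar>z j\<bar>))"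
  proof (rule sum_mono)
    fix z assume "z \<in> ?F"
    then have "(1/2 :: real) ^ m \<le> (1/2) ^ (\<Sum>j\<in>J. nat \<bar>z j\<bar>)" by (intro power_decreasing) auto
    then have "2 ^ m * (1/2 :: real) ^ m \<le> 2 ^ m * (1/2) ^ (\<Sum>j\<in>J. nat \<bar>z j\<bar>)" by (intro mult_left_mono) auto
    then show "1 \<le> 2 ^ m * (\<Prod>j\<in>J. (1/2 :: real) ^ nat \<bar>z j\<bar>)" by (simp add: power_sum power_mult_distrib[symmetric])
  qed
  also have "\<dots> \<le> (\<Sum>z\<in>?P. 2 ^ m * (\<Prod>j\<in>J. (1/2) ^ nat \<bar>z j\<bar>))"
    by (rule sum_mono2) (use fin in \<open>auto intro!: mult_nonneg_nonneg prod_nonneg\<close>)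
  also have "\<dots> = 2 ^ m * (\<Prod>j\<in>J. \<Sum>i\<in>{- int m..int m}. (1/2) ^ nat \<bar>i\<bar>)"
    by (subst prod_sum_PiE[OF J]) (simp_all only: sum_distrib_left finite_atLeastAtMost_int)
  also have "\<dots> \<le> 2 ^ m * (\<Prod>j\<in>J. 3)"
  proof (intro mult_left_mono prod_mono conjI)
    show "(\<Sum>i\<in>{- int m..int m}. (1/2 :: real) ^ nat \<bar>i\<bar>) \<le> 3"
      using sum_half_power_abs_le[of m] zero_le_power[of "1/2::real" m] by linarith
  qed (auto intro!: sum_nonneg)
  finally show ?thesis by simp
qed

text \<open>Pigeonhole over the cells of side \<open>s\<close> on which all \<open>\<lfloor>ip d x (v j) / s\<rfloor>\<close> are constant; the
  difference of two independent vectors from one cell lies in the slabs.\<close>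

lemma slab_prob:
  fixes v :: "'j \<Rightarrow> nat \<Rightarrow> real"
  assumes J: "finite J" and s: "0 < s" and \<Lambda>: "0 \<le> \<Lambda>"
    and v: "\<And>j. j \<in> J \<Longrightarrow> ip d (v j) (v j) \<le> \<Lambda> * s\<^sup>2" and d: "2 \<le> d"
  shows "exp (- (36 * exp (\<Lambda> / 2) * (real (card J) + 1))) \<le> measure (std_gaussian d)
    {x \<in> space (std_gaussian d). ip d x x \<le> 16 * real d \<and> (\<forall>j\<in>J. \<bar>ip d x (v j)\<bar> \<le> s)}"
proof -
  let ?G = "std_gaussian d"
  interpret prob_space ?G by (rule prob_space_std_gaussian)
  let ?S = "{x \<in> space ?G. ip d x x \<le> 16 * real d \<and> (\<forall>j\<in>J. \<bar>ip d x (v j)\<bar> \<le> s)}"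
  define k where "k = card J"
  define e where "e = exp (\<Lambda> / 2)"
  have e1: "1 \<le> e" using \<Lambda> by (simp add: e_def)
  define m where "m = nat \<lceil>9 * e * real k\<rceil>"
  have m: "9 * e * real k \<le> real m" "real m \<le> 9 * e * real k + 1"
    using e1 by (auto simp: m_def real_nat_ceiling_ge nat_ceiling_le_eq[symmetric] of_nat_nat intro!: less_imp_le)
  define h where "h x = (\<Sum>j\<in>J. \<bar>ip d x (v j)\<bar> / s)" for x
  have [measurable]: "h \<in> borel_measurable ?G" unfolding h_def by measurable
  \<comment> \<open>The bound |z| \<le> exp z + exp (- z) reduces the first absolute moment to
    Gaussian moment generating functions, each at most \<open>e\<close> = exp (\<Lambda> /
    2).\<close>
  have hI: "(\<integral>\<^sup>+x. ennreal (h x) \<partial>?G) \<le> ennreal (2 * e * real k)"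
  proof -
    have "(\<integral>\<^sup>+x. ennreal (h x) \<partial>?G) \<le> (\<integral>\<^sup>+x. (\<Sum>j\<in>J. ennreal (exp (1 / s * ip d x (v j))) + ennreal (exp (- 1 / s * ip d x (v j)))) \<partial>?G)"
    proof (rule nn_integral_mono)
      fix x
      have "ennreal (h x) = (\<Sum>j\<in>J. ennreal (\<bar>ip d x (v j)\<bar> / s))"
        unfolding h_def using s by (subst sum_ennreal) auto
      also have "\<dots> \<le> (\<Sum>j\<in>J. ennreal (exp (1 / s * ip d x (v j))) + ennreal (exp (- 1 / s * ip d x (v j))))"
      proof (rule sum_mono)
        fix j
        define z where "z = ip d x (v j) / s"
        have "\<bar>z\<bar> \<le> exp z + exp (- z)"
          using exp_ge_add_one_self[of z] exp_ge_add_one_self[of "- z"] exp_gt_zero[of z] exp_gt_zero[of "- z"] by linarith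
        then have "\<bar>ip d x (v j)\<bar> / s \<le> exp (1 / s * ip d x (v j)) + exp (- 1 / s * ip d x (v j))"
          using s by (simp add: z_def abs_divide)
        then have "ennreal (\<bar>ip d x (v j)\<bar> / s) \<le> ennreal (exp (1 / s * ip d x (v j)) + exp (- 1 / s * ip d x (v j)))"
          by (rule ennreal_leI)
        then show "ennreal (\<bar>ip d x (v j)\<bar> / s) \<le> ennreal (exp (1 / s * ip d x (v j))) + ennreal (exp (- 1 / s * ip d x (v j)))"
          by (simp add: ennreal_plus)
      qed
      finally show "ennreal (h x) \<le> \<dots>" .
    qed
    also have "\<dots> = (\<Sum>j\<in>J. (\<integral>\<^sup>+x. ennreal (exp (1 / s * ip d x (v j))) \<partial>?G) + (\<integral>\<^sup>+x. ennreal (exp (- 1 / s * ip d x (v j))) \<partial>?G))"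
      by (subst nn_integral_sum, measurable, intro sum.cong refl nn_integral_add; measurable)
    also have "\<dots> = (\<Sum>j\<in>J. ennreal (exp ((1 / s)\<^sup>2 * ip d (v j) (v j) / 2)) + ennreal (exp ((- 1 / s)\<^sup>2 * ip d (v j) (v j) / 2)))"
      unfolding nn_integral_exp_ip ..
    also have "\<dots> \<le> (\<Sum>j\<in>J. ennreal (2 * e))"
    proof (rule sum_mono)
      fix j assume "j \<in> J"
      then have "(1 / s)\<^sup>2 * ip d (v j) (v j) / 2 \<le> \<Lambda> / 2"
        using v[of j] s by (simp add: power_divide field_simps)
      then have "exp ((1 / s)\<^sup>2 * ip d (v j) (v j) / 2) \<le> e" by (simp add: e_def)
      then have "ennreal (exp ((1 / s)\<^sup>2 * ip d (v j) (v j) / 2) + exp ((- 1 / s)\<^sup>2 * ip d (v j) (v j) / 2)) \<le> ennreal (2 * e)"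
        by (intro ennreal_leI) (simp add: power_divide)
      then show "ennreal (exp ((1 / s)\<^sup>2 * ip d (v j) (v j) / 2)) + ennreal (exp ((- 1 / s)\<^sup>2 * ip d (v j) (v j) / 2)) \<le> ennreal (2 * e)"
        by (simp only: ennreal_plus exp_ge_zero)
    qed
    also have "\<dots> = ennreal (2 * e * real k)"
      using e1 by (subst sum_ennreal) (auto simp: k_def mult.commute)
    finally show ?thesis .
  qed
  have h0: "0 \<le> h x" for x unfolding h_def using s by (intro sum_nonneg) auto
  have hP: "prob {x \<in> space ?G. 8 * e * real k < h x} \<le> 1/4"
  proof (cases "k = 0")
    case True
    then have "J = {}" using J by (simp add: k_def)
    then show ?thesis by (simp add: h_def True)
  next
    case False
    define b where "b = 8 * e * real k"
    have b: "0 < b" using False e1 by (simp add: b_def)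
    have "ennreal b * emeasure ?G {x \<in> space ?G. b < h x} = (\<integral>\<^sup>+x. ennreal b * indicator {x \<in> space ?G. b < h x} x \<partial>?G)"
      by (rule nn_integral_cmult_indicator[symmetric]) measurable
    also have "\<dots> \<le> (\<integral>\<^sup>+x. ennreal (h x) \<partial>?G)"
      by (rule nn_integral_mono) (auto simp: indicator_def intro!: ennreal_leI)
    also have "\<dots> \<le> ennreal (b / 4)"
    proof -
      have b4: "b / 4 = 2 * e * real k" by (simp add: b_def)
      show ?thesis unfolding b4 by (rule hI)
    qed
    finally have "b * prob {x \<in> space ?G. b < h x} \<le> b / 4"
      using b by (simp add: emeasure_eq_measure ennreal_mult'[symmetric])
    then have "b * prob {x \<in> space ?G. b < h x} \<le> b * (1/4)" by simp
    then have "prob {x \<in> space ?G. b < h x} \<le> 1/4" using b by (simp only: mult_le_cancel_left_pos)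
    then show ?thesis by (simp only: b_def)
  qed
  define W where "W = {x \<in> space ?G. ip d x x \<le> 8 * real d \<and> h x \<le> 8 * e * real k}"
  have [measurable]: "W \<in> sets ?G" unfolding W_def by measurable
  have W: "1/2 \<le> prob W"
  proof -
    have "prob (space ?G - W) \<le> prob ({x \<in> space ?G. 8 * real d \<le> ip d x x} \<union> {x \<in> space ?G. 8 * e * real k < h x})"
      by (intro finite_measure_mono) (auto simp: W_def)
    also have "\<dots> \<le> prob {x \<in> space ?G. 8 * real d \<le> ip d x x} + prob {x \<in> space ?G. 8 * e * real k < h x}"
      by (rule measure_Un_le) measurable
    also have "\<dots> \<le> exp (- real d) + 1/4" using norm_upper_tail[of d] hP by linarith
    also have "exp (- real d) \<le> 1/4"
    proof -
      have "(4::real) \<le> exp 2" using exp_lower_Taylor_quadratic[of "2::real"] by simp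
      also have "\<dots> \<le> exp (real d)" using d by simp
      finally show ?thesis by (simp add: exp_minus field_simps)
    qed
    finally show ?thesis using prob_compl[of W] by simp
  qed
  \<comment> \<open>Only the sum of the cell indices is bounded, by Markov applied to
    \<open>h\<close>, and not every single index. This leaves exp (O(k)) cells. Rounding to integers
    adds at most k, whence 9 * e * k in \<open>m\<close> instead of 8 * e * k.\<close>
  define F where "F = {z \<in> PiE J (\<lambda>_. {- int m..int m}). (\<Sum>j\<in>J. nat \<bar>z j\<bar>) \<le> m}"
  define cell where "cell z = {x \<in> W. \<forall>j\<in>J. \<lfloor>ip d x (v j) / s\<rfloor> = z j}" for z
  have finF: "finite F" unfolding F_def using finite_PiE[OF J, of "\<lambda>_. {- int m..int m}"] by simp
  have cellm [measurable]: "cell z \<in> sets ?G" for z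
  proof -
    have "cell z = W \<inter> {x \<in> space ?G. \<forall>j\<in>J. \<lfloor>ip d x (v j) / s\<rfloor> = z j}"
      using sets.sets_into_space[OF \<open>W \<in> sets ?G\<close>] by (auto simp: cell_def)
    also have "\<dots> \<in> sets ?G"
      by (intro sets.Int sets.sets_Collect_finite_All J) measurable
    finally show ?thesis .
  qed
  have cover: "W \<subseteq> (\<Union>z\<in>F. cell z)"
  proof
    fix x assume x: "x \<in> W"
    define z where "z = (\<lambda>j\<in>J. \<lfloor>ip d x (v j) / s\<rfloor>)"
    have fl: "real (nat \<bar>\<lfloor>w\<rfloor>\<bar>) \<le> \<bar>w\<bar> + 1" for w :: real by linarith
    have "real (\<Sum>j\<in>J. nat \<bar>z j\<bar>) = (\<Sum>j\<in>J. real (nat \<bar>z j\<bar>))" by simp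
    also have "\<dots> \<le> (\<Sum>j\<in>J. \<bar>ip d x (v j)\<bar> / s + 1)"
    proof (rule sum_mono)
      fix j assume "j \<in> J"
      then show "real (nat \<bar>z j\<bar>) \<le> \<bar>ip d x (v j)\<bar> / s + 1"
        using fl[of "ip d x (v j) / s"] s by (simp add: z_def abs_divide)
    qed
    also have "\<dots> = h x + real k" by (simp add: h_def sum.distrib k_def)
    also have "\<dots> \<le> 8 * e * real k + e * real k" using x e1 mult_right_mono[OF e1, of "real k"] by (simp add: W_def)
    also have "\<dots> \<le> real m" using m(1) by (simp add: algebra_simps)
    finally have sm: "(\<Sum>j\<in>J. nat \<bar>z j\<bar>) \<le> m" by (simp only: of_nat_le_iff)
    have "z j \<in> {- int m..int m}" if "j \<in> J" for j
    proof -
      have "nat \<bar>z j\<bar> \<le> (\<Sum>j\<in>J. nat \<bar>z j\<bar>)" by (rule member_le_sum[OF that _ J]) simp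
      then have "nat \<bar>z j\<bar> \<le> m" using sm by linarith
      then show ?thesis by auto
    qed
    then have "z \<in> F" using sm by (auto simp: F_def z_def PiE_iff)
    moreover have "x \<in> cell z" using x by (auto simp: cell_def z_def)
    ultimately show "x \<in> (\<Union>z\<in>F. cell z)" by blast
  qed
  have cardF: "real (card F) \<le> 2 ^ m * 3 ^ k" unfolding F_def k_def by (rule card_small_integer_vectors[OF J])
  define c :: real where "c = 1 / (2 * (2 ^ m * 3 ^ k))"
  have c: "0 < c" by (simp add: c_def)
  obtain z where "c \<le> prob (cell z)"
  proof (rule ccontr)
    assume "\<not> thesis"
    then have less: "prob (cell z) < c" for z using that by (meson not_le)
    have "1/2 \<le> prob (\<Union>z\<in>F. cell z)" using W finite_measure_mono[OF cover] finF by (force intro: sets.finite_UN)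
    also have "\<dots> \<le> (\<Sum>z\<in>F. prob (cell z))" by (rule finite_measure_subadditive_finite[OF finF]) auto
    also have "\<dots> < (\<Sum>z\<in>F. c)"
    proof (rule sum_strict_mono[OF finF])
      show "F \<noteq> {}" using W cover by auto
    qed (rule less)
    also have "\<dots> = real (card F) * c" by simp
    also have "\<dots> \<le> 2 ^ m * 3 ^ k * c" using cardF c by (intro mult_right_mono) auto
    also have "\<dots> = 1/2" by (simp add: c_def)
    finally show False by simp
  qed
  then have "c\<^sup>2 \<le> (prob (cell z))\<^sup>2" using c by (intro power_mono) auto
  also have "\<dots> \<le> prob ?S"
  proof (rule rotation_square)
    show "?S \<in> sets ?G"
      by (intro sets.sets_Collect_conj sets.sets_Collect_finite_All J) measurable
    fix x y assume x: "x \<in> cell z" and y: "y \<in> cell z"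
    let ?u = "vlin d (1 / sqrt 2) x (- 1 / sqrt 2) y"
    have u: "?u \<in> space ?G" by (auto simp: vlin_def std_gaussian_def space_PiM)
    have r2: "1 / sqrt 2 * (1 / sqrt 2) = (1 / 2 :: real)" by simp
    have "ip d ?u ?u = 1/2 * (ip d x x + ip d y y - 2 * ip d x y)"
      unfolding ip_vlin_left ip_vlin_right ip_commute[of d y x] using r2 by (simp add: algebra_simps)
    also have "\<dots> \<le> ip d x x + ip d y y"
    proof -
      have "0 \<le> ip d (vlin d 1 x 1 y) (vlin d 1 x 1 y)" by simp
      then show ?thesis unfolding ip_vlin_left ip_vlin_right ip_commute[of d y x] by simp
    qed
    also have "\<dots> \<le> 16 * real d" using x y by (auto simp: cell_def W_def)
    finally have n: "ip d ?u ?u \<le> 16 * real d" .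
    have "\<bar>ip d ?u (v j)\<bar> \<le> s" if j: "j \<in> J" for j
    proof -
      have "\<lfloor>ip d x (v j) / s\<rfloor> = \<lfloor>ip d y (v j) / s\<rfloor>" using x y j by (auto simp: cell_def)
      then have "\<bar>ip d x (v j) / s - ip d y (v j) / s\<bar> \<le> 1" by linarith
      then have "\<bar>ip d x (v j) - ip d y (v j)\<bar> \<le> s" using s by (simp add: diff_divide_distrib[symmetric] abs_divide)
      moreover have "ip d ?u (v j) = 1 / sqrt 2 * (ip d x (v j) - ip d y (v j))"
        unfolding ip_vlin_left by (simp add: algebra_simps)
      moreover have "1 / sqrt 2 * \<bar>ip d x (v j) - ip d y (v j)\<bar> \<le> 1 * \<bar>ip d x (v j) - ip d y (v j)\<bar>"
        by (intro mult_right_mono) auto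
      ultimately show ?thesis by (simp add: abs_mult)
    qed
    then show "?u \<in> ?S" using u n by simp
  qed simp
  finally have fin: "c\<^sup>2 \<le> prob ?S" .
  \<comment> \<open>A best cell has measure at least exp (- 18 * e * (k + 1)); the square in the
    rotation step doubles 18 to 36.\<close>
  have "exp (- (36 * e * (real k + 1))) \<le> c\<^sup>2"
  proof -
    have ln2: "ln (2::real) \<le> 1" using ln_le_minus_one[of "2::real"] by simp
    have ln3: "ln (3::real) \<le> 2" using ln_le_minus_one[of "3::real"] by simp
    have "ln (1 / c) = ln 2 + real m * ln 2 + real k * ln 3"
      by (simp add: c_def ln_mult ln_realpow)
    also have "\<dots> \<le> 1 + real m + real k * 2"
      using mult_left_mono[OF ln2, of "real m"] mult_left_mono[OF ln3, of "real k"] ln2 by simp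
    also have "\<dots> \<le> 11 * e * real k + 2"
      using m(2) mult_right_mono[OF e1, of "real k"] by simp
    also have "\<dots> \<le> 18 * e * (real k + 1)"
    proof -
      have "0 \<le> e * real k" using e1 by simp
      moreover have "18 * e * (real k + 1) = 18 * (e * real k) + 18 * e" by (simp add: algebra_simps)
      ultimately show ?thesis using e1 unfolding mult.assoc by linarith
    qed
    finally have "- ln c \<le> 18 * e * (real k + 1)" using c by (simp add: ln_div)
    then have "- (18 * e * (real k + 1)) \<le> ln c" by linarith
    then have "exp (- (18 * e * (real k + 1))) \<le> c" using c by (simp add: ln_ge_iff[symmetric])
    then have "(exp (- (18 * e * (real k + 1))))\<^sup>2 \<le> c\<^sup>2" by (intro power_mono) auto
    then show ?thesis by (simp add: exp_double[symmetric] mult.assoc)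
  qed
  then show ?thesis using fin by (simp add: e_def k_def)
qed

section \<open>Lower bound\<close>

text \<open>The vectors are drawn one by one, and each is acceptable with conditional probability at
  least q given an acceptable past. Pairs in \<open>RR\<close> are oriented as (later, earlier). The
  relations within the past are handed to \<open>step\<close>, since the construction for small n
  needs the earlier inner products.\<close>

lemma sequential_lower:
  assumes S [measurable]: "S \<in> sets (std_gaussian d)"
    and RR [measurable]: "RR \<in> sets (std_gaussian d \<Otimes>\<^sub>M std_gaussian d)" and q: "0 \<le> q"
    and step: "\<And>k Y. k < n \<Longrightarrow> (\<And>i. i \<in> {1..k} \<Longrightarrow> Y i \<in> S) \<Longrightarrow>
      (\<And>i j. i \<in> {1..k} \<Longrightarrow> j \<in> {1..k} \<Longrightarrow> i < j \<Longrightarrow> (Y j, Y i) \<in> RR) \<Longrightarrow>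
      q \<le> measure (std_gaussian d) {g \<in> S. \<forall>i\<in>{1..k}. (g, Y i) \<in> RR}"
    and t: "\<And>x y. x \<in> S \<Longrightarrow> y \<in> S \<Longrightarrow> (x, y) \<in> RR \<Longrightarrow> t \<le> ip d x y"
  shows "q ^ n \<le> measure (gaussian_sample n d) (complete_event n d t)"
proof -
  let ?G = "std_gaussian d"
  interpret prob_space ?G by (rule prob_space_std_gaussian)
  define P where "P k = PiM {1..k} (\<lambda>_ :: nat. ?G)" for k
  define good where "good k = {X \<in> space (P k). (\<forall>i\<in>{1..k}. X i \<in> S) \<and>
     (\<forall>i\<in>{1..k}. \<forall>j\<in>{1..k}. i < j \<longrightarrow> (X j, X i) \<in> RR)}" for k
  have comp: "(\<lambda>X. X i) \<in> measurable (P k) ?G" if "i \<in> {1..k}" for i k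
    unfolding P_def using that by (rule measurable_component_singleton)
  have good [measurable]: "good k \<in> sets (P k)" for k
    unfolding good_def
  proof (intro sets.sets_Collect_conj sets.sets_Collect_finite_All sets.sets_Collect_imp sets.sets_Collect_const finite_atLeastAtMost)
    fix i assume i: "i \<in> {1..k}"
    note [measurable] = comp[OF i]
    show "{X \<in> space (P k). X i \<in> S} \<in> sets (P k)" by measurable
    fix j assume j: "j \<in> {1..k}"
    note [measurable] = comp[OF j]
    show "{X \<in> space (P k). (X j, X i) \<in> RR} \<in> sets (P k)" by measurable
  qed
  have "ennreal (q ^ k) \<le> emeasure (P k) (good k)" if "k \<le> n" for k
    using that
  proof (induction k)
    case 0
    interpret Q: prob_space "P 0" unfolding P_def by (rule prob_space_PiM_std_gaussian)
    have "good 0 = space (P 0)" by (auto simp: good_def)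
    then show ?case by (simp add: Q.emeasure_space_1)
  next
    case (Suc k)
    have ins: "{1..Suc k} = insert (Suc k) {1..k}" by auto
    have gm: "good (Suc k) \<in> sets (PiM (insert (Suc k) {1..k}) (\<lambda>_. ?G))"
      using good[of "Suc k"] unfolding P_def ins .
    have "ennreal (q ^ Suc k) = ennreal (q ^ k) * ennreal q" using q by (simp add: ennreal_mult'[symmetric] mult.commute)
    also have "\<dots> \<le> emeasure (P k) (good k) * ennreal q" using Suc by (intro mult_right_mono) auto
    also have "\<dots> = (\<integral>\<^sup>+X. indicator (good k) X * ennreal q \<partial>P k)"
      by (simp add: nn_integral_multc)
    also have "\<dots> \<le> (\<integral>\<^sup>+X. \<integral>\<^sup>+g. indicator (good (Suc k)) (X(Suc k := g)) \<partial>?G \<partial>P k)"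
    proof (rule nn_integral_mono)
      fix X assume X: "X \<in> space (P k)"
      show "indicator (good k) X * ennreal q \<le> (\<integral>\<^sup>+g. indicator (good (Suc k)) (X(Suc k := g)) \<partial>?G)"
      proof (cases "X \<in> good k")
        case True
        let ?E = "{g \<in> S. \<forall>i\<in>{1..k}. (g, X i) \<in> RR}"
        have Xi: "X i \<in> space ?G" if "i \<in> {1..k}" for i
          using measurable_space[OF comp[OF that] X] .
        have E [measurable]: "?E \<in> sets ?G"
        proof -
          have "?E = S \<inter> {g \<in> space ?G. \<forall>i\<in>{1..k}. (g, X i) \<in> RR}"
            using sets.sets_into_space[OF S] by auto
          also have "\<dots> \<in> sets ?G"
          proof (intro sets.Int S sets.sets_Collect_finite_All finite_atLeastAtMost)
            fix i assume "i \<in> {1..k}"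
            note [measurable] = Xi[OF this]
            show "{g \<in> space ?G. (g, X i) \<in> RR} \<in> sets ?G" by measurable
          qed
          finally show ?thesis .
        qed
        have "q \<le> prob ?E"
          by (rule step) (use True Suc.prems in \<open>auto simp: good_def\<close>)
        then have "ennreal q \<le> (\<integral>\<^sup>+g. indicator ?E g \<partial>?G)" unfolding nn_integral_indicator[OF E] emeasure_eq_measure
          by (rule ennreal_leI)
        also have "\<dots> \<le> (\<integral>\<^sup>+g. indicator (good (Suc k)) (X(Suc k := g)) \<partial>?G)"
        proof (rule nn_integral_mono)
          fix g
          have "X(Suc k := g) \<in> good (Suc k)" if g: "g \<in> ?E"
          proof -
            have "g \<in> space ?G" using g sets.sets_into_space[OF S] by auto
            then have "X(Suc k := g) \<in> space (P (Suc k))"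
              using X unfolding P_def ins by (auto simp: space_PiM PiE_iff extensional_def)
            then show ?thesis using g True by (auto simp: good_def le_Suc_eq)
          qed
          then show "indicator ?E g \<le> (indicator (good (Suc k)) (X(Suc k := g)) :: ennreal)"
            by (auto simp: indicator_def)
        qed
        finally show ?thesis using True by simp
      qed simp
    qed
    also have "\<dots> = emeasure (P (Suc k)) (good (Suc k))"
    proof -
      have "(\<integral>\<^sup>+X. indicator (good (Suc k)) X \<partial>PiM (insert (Suc k) {1..k}) (\<lambda>_. ?G))
        = (\<integral>\<^sup>+X. \<integral>\<^sup>+g. indicator (good (Suc k)) (X(Suc k := g)) \<partial>?G \<partial>PiM {1..k} (\<lambda>_. ?G))"
        by (rule stdG.product_nn_integral_insert) (use gm in auto)
      then show ?thesis using gm unfolding P_def ins by simp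
    qed
    finally show ?case .
  qed
  then have "ennreal (q ^ n) \<le> emeasure (P n) (good n)" by simp
  also have "\<dots> \<le> emeasure (gaussian_sample n d) (complete_event n d t)"
  proof -
    have Pn: "P n = gaussian_sample n d" by (simp add: P_def gaussian_sample_def)
    have "good n \<subseteq> complete_event n d t"
    proof
      fix X assume X: "X \<in> good n"
      have "t \<le> ip d (X i) (X j)" if ij: "i \<in> {1..n}" "j \<in> {1..n}" "i \<noteq> j" for i j
      proof (cases "i < j")
        case True
        then have "t \<le> ip d (X j) (X i)" using X ij by (intro t) (auto simp: good_def)
        then show ?thesis by (simp add: ip_commute)
      next
        case False
        then show ?thesis using X ij by (intro t) (auto simp: good_def)
      qed
      then show "X \<in> complete_event n d t" using X by (simp add: complete_event_def good_def Pn)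
    qed
    then show ?thesis unfolding Pn by (rule emeasure_mono) (rule complete_event_sets)
  qed
  finally have le: "ennreal (q ^ n) \<le> emeasure (gaussian_sample n d) (complete_event n d t)" .
  interpret SS: prob_space "gaussian_sample n d" by (rule prob_space_gaussian_sample)
  show ?thesis using le by (simp add: SS.emeasure_eq_measure)
qed

lemma complete_event_lower_box:
  assumes t: "t \<le> T * sqrt (real d)" and T: "0 \<le> T" and d: "1 \<le> d"
  shows "measure stdN {sqrt T<..<sqrt T + 1} ^ (n * d) \<le> measure (gaussian_sample n d) (complete_event n d t)"
proof -
  let ?G = "std_gaussian d"
  define E where "E = PiE {1..d} (\<lambda>_. {sqrt T<..<sqrt T + 1})"
  have E: "E \<in> sets ?G" unfolding E_def by (rule box_sets) simp
  have mE: "measure ?G E = measure stdN {sqrt T<..<sqrt T + 1} ^ d"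
    unfolding E_def by (subst measure_std_gaussian_box) auto
  have "measure ?G E ^ n \<le> measure (gaussian_sample n d) (complete_event n d t)"
  proof (rule sequential_lower[OF E, where RR = "space (?G \<Otimes>\<^sub>M ?G)"])
    fix k Y assume Y: "\<And>i. i \<in> {1..k} \<Longrightarrow> Y i \<in> E"
    have "{g \<in> E. \<forall>i\<in>{1..k}. (g, Y i) \<in> space (?G \<Otimes>\<^sub>M ?G)} = E"
      using Y sets.sets_into_space[OF E] by (auto simp: space_pair_measure)
    then show "measure ?G E \<le> measure ?G {g \<in> E. \<forall>i\<in>{1..k}. (g, Y i) \<in> space (?G \<Otimes>\<^sub>M ?G)}" by simp
  next
    fix x y assume x: "x \<in> E" and y: "y \<in> E"
    have "(\<Sum>k\<in>{1..d}. T) \<le> ip d x y" unfolding ip_def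
    proof (rule sum_mono)
      fix k assume k: "k \<in> {1..d}"
      have "x k \<in> {sqrt T<..<sqrt T + 1}" "y k \<in> {sqrt T<..<sqrt T + 1}"
        using x y k unfolding E_def by (auto simp only: PiE_iff)
      moreover have "0 \<le> sqrt T" using T by simp
      ultimately have "sqrt T * sqrt T \<le> x k * y k" by (intro mult_mono) (auto simp del: real_sqrt_ge_0_iff)
      then show "T \<le> x k * y k" using T by simp
    qed
    moreover have "T * sqrt (real d) \<le> T * real d"
    proof (intro mult_left_mono T)
      have "sqrt (real d) * 1 \<le> sqrt (real d) * sqrt (real d)" using d by (intro mult_left_mono) auto
      then show "sqrt (real d) \<le> real d" by simp
    qed
    ultimately show "t \<le> ip d x y" using t by (simp add: mult.commute)
  qed auto
  then show ?thesis by (simp add: mE power_mult[symmetric] mult.commute)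
qed

section \<open>A common shift along the first axis\<close>

definition axis1 :: "nat \<Rightarrow> real" where "axis1 k = (if k = 1 then 1 else 0)"

lemma ip_axis1: "1 \<le> d \<Longrightarrow> ip d axis1 axis1 = 1"
  by (simp add: ip_def axis1_def sum.If_cases if_distrib cong: if_cong)

text \<open>For x = h + u and y = h' + u with u = a * axis1, the inner product is ip h h' + a * (x 1
  + y 1) - a^2. With both first coordinates at least 3 * a / 4 and ip h h' \<ge> - s this is at
  least a^2 / 2 - s. The conditions are imposed on h, so the event in \<open>slab\<close> is
  symmetric and its translate costs exp (- a^2 / 2); the norm bound makes h usable as a slab
  direction for later vectors.\<close>

lemma complete_event_lower_shift:
  assumes d: "1 \<le> d" and q: "0 \<le> q" and t: "t \<le> a\<^sup>2 / 2 - s" and a: "0 \<le> a"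
    and slab: "\<And>k v. k < n \<Longrightarrow> (\<And>j. j \<in> {1..k :: nat} \<Longrightarrow> ip d (v j) (v j) \<le> 16 * real d) \<Longrightarrow>
      q \<le> measure (std_gaussian d) {x \<in> space (std_gaussian d). ip d x x \<le> 16 * real d \<and> \<bar>ip d x axis1\<bar> \<le> a / 4
        \<and> (\<forall>j\<in>{1..k}. \<bar>ip d x (v j)\<bar> \<le> s)}"
  shows "(exp (- a\<^sup>2 / 2) * q) ^ n \<le> measure (gaussian_sample n d) (complete_event n d t)"
proof -
  let ?G = "std_gaussian d"
  interpret prob_space ?G by (rule prob_space_std_gaussian)
  define u where "u = vlin d a axis1 0 axis1"
  have iu: "ip d x u = a * ip d x axis1" "ip d u x = a * ip d x axis1" for x
    unfolding u_def ip_vlin_left ip_vlin_right by (simp_all add: ip_commute)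
  have uu: "ip d u u = a\<^sup>2"
    unfolding u_def ip_vlin_left ip_vlin_right using ip_axis1[OF d] by (simp add: power2_eq_square)
  define sh where "sh x = vlin d 1 x (- 1) u" for x
  have sh [measurable (raw)]: "(\<lambda>w. sh (f w)) \<in> measurable N ?G" if [measurable]: "f \<in> measurable N ?G" for f and N :: "'x measure"
    unfolding sh_def by measurable
  have shx: "ip d (sh x) axis1 = ip d x axis1 - a" "ip d (sh x) (sh y) = ip d x y - a * ip d x axis1 - a * ip d y axis1 + a\<^sup>2" for x y
  proof -
    have "ip d u axis1 = a" unfolding u_def ip_vlin_left using ip_axis1[OF d] by simp
    then show "ip d (sh x) axis1 = ip d x axis1 - a" unfolding sh_def ip_vlin_left by simp
    show "ip d (sh x) (sh y) = ip d x y - a * ip d x axis1 - a * ip d y axis1 + a\<^sup>2"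
      unfolding sh_def ip_vlin_left ip_vlin_right iu uu[symmetric] by (simp add: algebra_simps)
  qed
  define S where "S = {x \<in> space ?G. ip d (sh x) (sh x) \<le> 16 * real d \<and> \<bar>ip d (sh x) axis1\<bar> \<le> a / 4}"
  define RR where "RR = {w \<in> space (?G \<Otimes>\<^sub>M ?G). \<bar>ip d (sh (fst w)) (sh (snd w))\<bar> \<le> s}"
  have S: "S \<in> sets ?G" unfolding S_def by measurable
  have RR: "RR \<in> sets (?G \<Otimes>\<^sub>M ?G)" unfolding RR_def by measurable
  show ?thesis
  proof (rule sequential_lower[OF S RR])
    show "0 \<le> exp (- a\<^sup>2 / 2) * q" using q by simp
    fix k Y assume k: "k < n" and Y: "\<And>i. i \<in> {1..k} \<Longrightarrow> Y i \<in> S"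
    define A where "A = {x \<in> space ?G. ip d x x \<le> 16 * real d \<and> \<bar>ip d x axis1\<bar> \<le> a / 4 \<and> (\<forall>j\<in>{1..k}. \<bar>ip d x (sh (Y j))\<bar> \<le> s)}"
    have A [measurable]: "A \<in> sets ?G" unfolding A_def
      by (intro sets.sets_Collect_conj sets.sets_Collect_finite_All finite_atLeastAtMost) measurable
    have sym: "vneg d x \<in> A" if "x \<in> A" for x
    proof -
      have "ip d (vneg d x) (vneg d x) = ip d x x" by (metis ip_vneg ip_commute minus_minus)
      moreover have "vneg d x \<in> space ?G" by (auto simp: vneg_def std_gaussian_def space_PiM)
      ultimately show ?thesis using that by (simp add: A_def ip_vneg)
    qed
    have "q \<le> prob A" unfolding A_def
      by (rule slab[OF k]) (use Y in \<open>auto simp: S_def\<close>)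
    then have "exp (- a\<^sup>2 / 2) * q \<le> exp (- ip d u u / 2) * prob A" unfolding uu by (intro mult_left_mono) auto
    also have "\<dots> \<le> prob {x \<in> space ?G. sh x \<in> A}" unfolding sh_def by (rule cameron_martin_symmetric[OF A sym])
    also have "\<dots> \<le> prob {g \<in> S. \<forall>i\<in>{1..k}. (g, Y i) \<in> RR}"
    proof (rule finite_measure_mono)
      show "{x \<in> space ?G. sh x \<in> A} \<subseteq> {g \<in> S. \<forall>i\<in>{1..k}. (g, Y i) \<in> RR}"
        using Y by (auto simp: A_def S_def RR_def space_pair_measure)
      have "{g \<in> S. \<forall>i\<in>{1..k}. (g, Y i) \<in> RR} = S \<inter> {g \<in> space ?G. \<forall>i\<in>{1..k}. \<bar>ip d (sh g) (sh (Y i))\<bar> \<le> s}"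
        using Y by (auto simp: S_def RR_def space_pair_measure)
      also have "\<dots> \<in> sets ?G"
        by (intro sets.Int S sets.sets_Collect_finite_All finite_atLeastAtMost) measurable
      finally show "{g \<in> S. \<forall>i\<in>{1..k}. (g, Y i) \<in> RR} \<in> sets ?G" .
    qed
    finally show "exp (- a\<^sup>2 / 2) * q \<le> prob {g \<in> S. \<forall>i\<in>{1..k}. (g, Y i) \<in> RR}" .
  next
    fix x y assume x: "x \<in> S" and y: "y \<in> S" and xy: "(x, y) \<in> RR"
    have "\<bar>ip d x axis1 - a\<bar> \<le> a / 4" "\<bar>ip d y axis1 - a\<bar> \<le> a / 4" using x y by (auto simp: S_def shx)
    then have "3/4 * a \<le> ip d x axis1" "3/4 * a \<le> ip d y axis1" by linarith+
    then have "a * (3/4 * a) \<le> a * ip d x axis1" "a * (3/4 * a) \<le> a * ip d y axis1"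
      using mult_left_mono[OF _ a] by blast+
    moreover have "- s \<le> ip d x y - a * ip d x axis1 - a * ip d y axis1 + a\<^sup>2" using xy by (auto simp: RR_def shx)
    ultimately show "t \<le> ip d x y" using t by (simp add: power2_eq_square)
  qed
qed

text \<open>With s = n / c \<ge> sqrt d the slabs have width at least a quarter of the norm bound 4
  * sqrt d of their directions, so \<open>slab_prob\<close> with \<Lambda> = 16 charges a constant
  per slab; this is the origin of \<open>K\<close>. As a^2 is proportional to s, the shift and the
  slabs both cost order n per vector.\<close>

lemma complete_event_lower_quadratic:
  assumes T: "0 \<le> T" and c: "0 < c" "c \<le> 1"
  shows "\<exists>C>0. \<forall>n\<ge>2. \<forall>d\<ge>2. \<forall>t. c * sqrt (real d) \<le> real n \<longrightarrow> t \<le> T * sqrt (real d) \<longrightarrow>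
    exp (- C * (real n)\<^sup>2) \<le> measure (gaussian_sample n d) (complete_event n d t)"
proof -
  define K :: real where "K = 36 * exp 8"
  have K: "0 < K" by (simp add: K_def)
  define C where "C = (1 + T) / c + 2 * K"
  show ?thesis
  proof (intro exI[of _ C] conjI allI impI)
    show "0 < C" using T c K by (simp add: C_def add_nonneg_pos)
    fix n d :: nat and t
    assume n: "2 \<le> n" and d: "2 \<le> d" and nd: "c * sqrt (real d) \<le> real n" and t: "t \<le> T * sqrt (real d)"
    define s where "s = real n / c"
    have s: "sqrt (real d) \<le> s" "2 \<le> s"
    proof -
      show "sqrt (real d) \<le> s" using nd c by (simp add: s_def field_simps)
      have "2 * c \<le> real n" using n c by linarith
      then show "2 \<le> s" using c by (simp add: s_def field_simps)
    qed
    have s2: "real d \<le> s\<^sup>2" using power_mono[OF s(1), of 2] by simp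
    define a where "a = sqrt (2 * (1 + T) * s)"
    have a2: "a\<^sup>2 = 2 * (1 + T) * s" using T s by (simp add: a_def)
    have a1: "1 \<le> a"
    proof -
      have "1 * 1 \<le> (2 * (1 + T)) * s" using T s by (intro mult_mono) auto
      then show ?thesis by (simp add: a_def)
    qed
    define q where "q = exp (- (K * (real n + 1)))"
    have "(exp (- a\<^sup>2 / 2) * q) ^ n \<le> measure (gaussian_sample n d) (complete_event n d t)"
    proof (rule complete_event_lower_shift)
      show "1 \<le> d" "0 \<le> q" "0 \<le> a" using d a1 by (auto simp: q_def)
      have "T * sqrt (real d) \<le> T * s" using s T by (intro mult_left_mono) auto
      also have "\<dots> = a\<^sup>2 / 2 - s" by (simp add: a2 algebra_simps)
      finally show "t \<le> a\<^sup>2 / 2 - s" using t by linarith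
      fix k :: nat and v :: "nat \<Rightarrow> nat \<Rightarrow> real"
      assume k: "k < n" and v: "\<And>j. j \<in> {1..k} \<Longrightarrow> ip d (v j) (v j) \<le> 16 * real d"
      let ?G = "std_gaussian d"
      interpret prob_space ?G by (rule prob_space_std_gaussian)
      \<comment> \<open>Index 0 encodes the bound a / 4 on the first coordinate as one more slab of
        the common width \<open>s\<close>.\<close>
      define v' where "v' j = (if j = 0 then vlin d (4 * s / a) axis1 0 axis1 else v j)" for j
      have iv0: "ip d x (v' 0) = 4 * s / a * ip d x axis1" for x
        by (simp add: v'_def ip_vlin_right)
      have v'b: "ip d (v' j) (v' j) \<le> 16 * s\<^sup>2" if "j \<in> {0..k}" for j
      proof (cases "j = 0")
        case True
        have "ip d (v' 0) (v' 0) = 16 * s\<^sup>2 / a\<^sup>2"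
          unfolding iv0 using d ip_axis1[of d] by (simp add: v'_def ip_vlin_left power2_eq_square)
        also have "\<dots> \<le> 16 * s\<^sup>2 / 1" using a1 by (intro divide_left_mono) (auto simp: power2_eq_square intro: mult_ge1_I)
        finally show ?thesis using True by simp
      next
        case False
        then have "ip d (v' j) (v' j) \<le> 16 * real d" using v[of j] that by (simp add: v'_def)
        then show ?thesis using s2 by linarith
      qed
      have "exp (- (36 * exp (16 / 2) * (real (card {0..k}) + 1))) \<le> prob
         {x \<in> space ?G. ip d x x \<le> 16 * real d \<and> (\<forall>j\<in>{0..k}. \<bar>ip d x (v' j)\<bar> \<le> s)}"
        by (rule slab_prob) (use s d v'b in auto)
      also have "\<dots> \<le> prob {x \<in> space ?G. ip d x x \<le> 16 * real d \<and> \<bar>ip d x axis1\<bar> \<le> a / 4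
        \<and> (\<forall>j\<in>{1..k}. \<bar>ip d x (v j)\<bar> \<le> s)}"
      proof (rule finite_measure_mono)
        show "{x \<in> space ?G. ip d x x \<le> 16 * real d \<and> (\<forall>j\<in>{0..k}. \<bar>ip d x (v' j)\<bar> \<le> s)}
          \<subseteq> {x \<in> space ?G. ip d x x \<le> 16 * real d \<and> \<bar>ip d x axis1\<bar> \<le> a / 4 \<and> (\<forall>j\<in>{1..k}. \<bar>ip d x (v j)\<bar> \<le> s)}"
        proof
          fix x assume "x \<in> {x \<in> space ?G. ip d x x \<le> 16 * real d \<and> (\<forall>j\<in>{0..k}. \<bar>ip d x (v' j)\<bar> \<le> s)}"
          then have x: "x \<in> space ?G" "ip d x x \<le> 16 * real d" and xj: "\<And>j. j \<in> {0..k} \<Longrightarrow> \<bar>ip d x (v' j)\<bar> \<le> s" by auto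
          have "\<bar>ip d x (v j)\<bar> \<le> s" if "j \<in> {1..k}" for j using xj[of j] that by (simp add: v'_def)
          moreover have "\<bar>ip d x axis1\<bar> \<le> a / 4"
          proof -
            have "4 * s / a * \<bar>ip d x axis1\<bar> \<le> s" using xj[of 0] a1 s by (simp add: iv0 abs_mult)
            then have "s * (4 * \<bar>ip d x axis1\<bar>) \<le> s * a" using a1 by (simp add: field_simps)
            then show ?thesis using s by simp
          qed
          ultimately show "x \<in> {x \<in> space ?G. ip d x x \<le> 16 * real d \<and> \<bar>ip d x axis1\<bar> \<le> a / 4 \<and> (\<forall>j\<in>{1..k}. \<bar>ip d x (v j)\<bar> \<le> s)}"
            using x by simp
        qed
        show "{x \<in> space ?G. ip d x x \<le> 16 * real d \<and> \<bar>ip d x axis1\<bar> \<le> a / 4 \<and> (\<forall>j\<in>{1..k}. \<bar>ip d x (v j)\<bar> \<le> s)} \<in> sets ?G"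
          by (intro sets.sets_Collect_conj sets.sets_Collect_finite_All finite_atLeastAtMost) measurable
      qed
      finally have "exp (- (36 * exp (16 / 2) * (real (card {0..k}) + 1))) \<le> prob {x \<in> space ?G. ip d x x \<le> 16 * real d \<and> \<bar>ip d x axis1\<bar> \<le> a / 4
        \<and> (\<forall>j\<in>{1..k}. \<bar>ip d x (v j)\<bar> \<le> s)}" .
      moreover have "q \<le> exp (- (36 * exp (16 / 2) * (real (card {0..k}) + 1)))"
      proof -
        have "K * (real (card {0..k}) + 1) \<le> K * (real n + 1)" using k K by (intro mult_left_mono) auto
        then show ?thesis by (simp add: q_def K_def)
      qed
      ultimately show "q \<le> prob {x \<in> space ?G. ip d x x \<le> 16 * real d \<and> \<bar>ip d x axis1\<bar> \<le> a / 4
        \<and> (\<forall>j\<in>{1..k}. \<bar>ip d x (v j)\<bar> \<le> s)}" by linarith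
    qed
    moreover have "exp (- C * (real n)\<^sup>2) \<le> (exp (- a\<^sup>2 / 2) * q) ^ n"
    proof -
      have "exp (- a\<^sup>2 / 2) * q = exp (- ((1 + T) * s + K * (real n + 1)))"
        by (simp add: q_def a2 mult_exp_exp)
      then have e: "(exp (- a\<^sup>2 / 2) * q) ^ n = exp (- (real n * ((1 + T) * s + K * (real n + 1))))"
        by (simp only: exp_of_nat_mult[symmetric] mult_minus_right)
      have "(1 + T) * s + K * (real n + 1) \<le> C * real n"
      proof -
        have "K * (real n + 1) \<le> K * (2 * real n)" using n K by (intro mult_left_mono) auto
        then show ?thesis by (simp add: C_def s_def algebra_simps)
      qed
      then have "real n * ((1 + T) * s + K * (real n + 1)) \<le> real n * (C * real n)" by (intro mult_left_mono) auto
      then show ?thesis unfolding e by (simp add: power2_eq_square mult_ac)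
    qed
    ultimately show "exp (- C * (real n)\<^sup>2) \<le> measure (gaussian_sample n d) (complete_event n d t)" by linarith
  qed
qed

lemma complete_event_lower_log:
  assumes T: "0 \<le> T"
  shows "\<exists>C>0. \<forall>n\<ge>2. \<forall>d\<ge>2. \<forall>t. t \<le> T * sqrt (real d) \<longrightarrow>
    exp (- C * (real n * sqrt (real d * ln (real n)))) \<le> measure (gaussian_sample n d) (complete_event n d t)"
proof -
  \<comment> \<open>112 + 2 * T is the cost of the shift, and the remaining 2 absorbs the factor 1/4
    because exp (- 2 * w) \<le> 1/4.\<close>
  define C where "C = 114 + 2 * T"
  show ?thesis
  proof (intro exI[of _ C] conjI allI impI)
    show "0 < C" using T by (simp add: C_def)
    fix n d :: nat and t
    assume n: "2 \<le> n" and d: "2 \<le> d" and t: "t \<le> T * sqrt (real d)"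
    define w where "w = sqrt (real d * ln (real n))"
    have ln_n: "1/2 \<le> ln (real n)"
    proof -
      have "exp (1/2 :: real) \<le> 2" using exp_bound[of "1/2::real"] by (simp add: power2_eq_square)
      also have "\<dots> \<le> real n" using n by simp
      finally show ?thesis using n by (subst ln_ge_iff) simp_all
    qed
    have w1: "1 \<le> w"
    proof -
      have "2 * (1/2) \<le> real d * ln (real n)" using d ln_n by (intro mult_mono) auto
      then show ?thesis by (simp add: w_def)
    qed
    have w2: "w\<^sup>2 = real d * ln (real n)" using ln_n by (simp add: w_def)
    have sd: "sqrt (real d) \<le> 2 * w"
    proof -
      have "real d * 1 \<le> real d * (4 * ln (real n))" using ln_n by (intro mult_left_mono) auto
      then have "sqrt (real d) \<le> sqrt (4 * (real d * ln (real n)))" by (intro real_sqrt_le_mono) simp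
      then show ?thesis by (simp add: w_def real_sqrt_mult)
    qed
    \<comment> \<open>Then s^2 / (32 * d) = 9/2 * ln n, so each of the fewer than n slabs fails with
      probability at most 2 / n^4. The value of \<open>a\<close> below leaves a^2 / 2 - s = 100 * w
      + 2 * T * w \<ge> T * sqrt d, and a^2 \<ge> 224 makes the first coordinate harmless.\<close>
    define s where "s = 12 * w"
    define a where "a = sqrt (2 * (112 + 2 * T) * w)"
    have a2: "a\<^sup>2 = 2 * (112 + 2 * T) * w" using T w1 by (simp add: a_def)
    have ap: "0 < a" using T w1 by (simp add: a_def add_pos_nonneg)
    have "(exp (- a\<^sup>2 / 2) * (1/4)) ^ n \<le> measure (gaussian_sample n d) (complete_event n d t)"
    proof (rule complete_event_lower_shift[where s = s])
      show "1 \<le> d" "0 \<le> (1/4 :: real)" "0 \<le> a" using d ap by auto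
      have "T * sqrt (real d) \<le> T * (2 * w)" using sd T by (intro mult_left_mono) auto
      moreover have "a\<^sup>2 / 2 - s = 100 * w + T * (2 * w)" by (simp add: a2 s_def algebra_simps)
      ultimately show "t \<le> a\<^sup>2 / 2 - s" using t w1 by linarith
      fix k :: nat and v :: "nat \<Rightarrow> nat \<Rightarrow> real"
      assume k: "k < n" and v: "\<And>j. j \<in> {1..k} \<Longrightarrow> ip d (v j) (v j) \<le> 16 * real d"
      let ?G = "std_gaussian d"
      interpret prob_space ?G by (rule prob_space_std_gaussian)
      let ?A = "{x \<in> space ?G. ip d x x \<le> 16 * real d \<and> \<bar>ip d x axis1\<bar> \<le> a / 4 \<and> (\<forall>j\<in>{1..k}. \<bar>ip d x (v j)\<bar> \<le> s)}"
      let ?E1 = "{x \<in> space ?G. 8 * real d \<le> ip d x x}"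
      let ?E2 = "{x \<in> space ?G. a / 4 < \<bar>ip d x axis1\<bar>}"
      let ?F = "\<lambda>j. {x \<in> space ?G. s < \<bar>ip d x (v j)\<bar>}"
      have A: "?A \<in> sets ?G"
        by (intro sets.sets_Collect_conj sets.sets_Collect_finite_All finite_atLeastAtMost) measurable
      have F: "?F j \<in> sets ?G" for j by measurable
      have "prob (space ?G - ?A) \<le> prob ((?E1 \<union> ?E2) \<union> (\<Union>j\<in>{1..k}. ?F j))"
      proof (rule finite_measure_mono)
        show "space ?G - ?A \<subseteq> (?E1 \<union> ?E2) \<union> (\<Union>j\<in>{1..k}. ?F j)" by (auto simp: not_le)
        show "(?E1 \<union> ?E2) \<union> (\<Union>j\<in>{1..k}. ?F j) \<in> sets ?G"
          by (intro sets.Un sets.finite_UN F finite_atLeastAtMost) measurable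
      qed
      also have "\<dots> \<le> prob (?E1 \<union> ?E2) + prob (\<Union>j\<in>{1..k}. ?F j)"
        by (rule measure_Un_le) (auto intro!: sets.finite_UN F)
      also have "\<dots> \<le> (prob ?E1 + prob ?E2) + (\<Sum>j\<in>{1..k}. prob (?F j))"
        by (intro add_mono measure_Un_le finite_measure_subadditive_finite finite_atLeastAtMost) (use F in auto)
      also have "\<dots> \<le> (1/4 + 1/8) + 1/4"
      proof (intro add_mono)
        have "(4::real) \<le> exp 2" using exp_lower_Taylor_quadratic[of "2::real"] by simp
        also have "\<dots> \<le> exp (real d)" using d by simp
        finally have "exp (- real d) \<le> 1/4" by (simp add: exp_minus field_simps)
        then show "prob ?E1 \<le> 1/4" using norm_upper_tail[of d] by linarith
        have "prob ?E2 \<le> 2 * exp (- (a / 4)\<^sup>2 / (2 * 1))"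
          by (rule ip_tail) (use ip_axis1[of d] d ap in auto)
        also have "\<dots> \<le> 2 * exp (- 7)"
        proof -
          have "(224 + 4 * T) * 1 \<le> (224 + 4 * T) * w" using T w1 by (intro mult_left_mono) auto
          then have "224 \<le> a\<^sup>2" using T by (simp add: a2 algebra_simps)
          then show ?thesis by (simp add: power_divide)
        qed
        also have "\<dots> \<le> 1/8"
        proof -
          have "(16::real) \<le> exp 7" using exp_lower_Taylor_quadratic[of "7::real"] by simp
          then show ?thesis by (simp add: exp_minus field_simps)
        qed
        finally show "prob ?E2 \<le> 1/8" .
        have "(\<Sum>j\<in>{1..k}. prob (?F j)) \<le> (\<Sum>j\<in>{1..k}. 2 * (1 / real n ^ 4))"
        proof (rule sum_mono)
          fix j assume j: "j \<in> {1..k}"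
          have "prob (?F j) \<le> 2 * exp (- s\<^sup>2 / (2 * (16 * real d)))"
            by (rule ip_tail) (use v[OF j] d w1 in \<open>auto simp: s_def\<close>)
          also have "\<dots> \<le> 2 * exp (- (4 * ln (real n)))"
          proof -
            have "s\<^sup>2 / (2 * (16 * real d)) = 9/2 * ln (real n)" using d by (simp add: s_def power_mult_distrib w2)
            then have "4 * ln (real n) \<le> s\<^sup>2 / (2 * (16 * real d))" using ln_n by simp
            then show ?thesis by simp
          qed
          also have "exp (- (4 * ln (real n))) = 1 / real n ^ 4"
          proof -
            have "exp (4 * ln (real n)) = real n ^ 4" using n exp_of_nat_mult[of 4 "ln (real n)"] by simp
            then show ?thesis by (simp add: exp_minus field_simps)
          qed
          finally show "prob (?F j) \<le> 2 * (1 / real n ^ 4)" by simp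
        qed
        also have "\<dots> \<le> real n * (2 * (1 / real n ^ 4))" using k by (simp add: divide_right_mono)
        also have "\<dots> = 2 / real n ^ 3" using n by (simp add: field_simps eval_nat_numeral)
        also have "\<dots> \<le> 2 / 2 ^ 3" using n by (intro divide_left_mono power_mono) auto
        finally show "(\<Sum>j\<in>{1..k}. prob (?F j)) \<le> 1/4" by simp
      qed
      finally show "1/4 \<le> prob ?A" using prob_compl[OF A] by simp
    qed
    moreover have "exp (- C * (real n * w)) \<le> (exp (- a\<^sup>2 / 2) * (1/4)) ^ n"
    proof -
      have "exp (- (2 * w)) \<le> 1/4"
      proof -
        have "(4::real) \<le> exp 2" using exp_lower_Taylor_quadratic[of "2::real"] by simp
        also have "\<dots> \<le> exp (2 * w)" using w1 by simp
        finally show ?thesis by (simp add: exp_minus field_simps)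
      qed
      then have "exp (- a\<^sup>2 / 2) * exp (- (2 * w)) \<le> exp (- a\<^sup>2 / 2) * (1/4)" by (intro mult_left_mono) auto
      then have "(exp (- a\<^sup>2 / 2) * exp (- (2 * w))) ^ n \<le> (exp (- a\<^sup>2 / 2) * (1/4)) ^ n" by (intro power_mono) auto
      moreover have "exp (- a\<^sup>2 / 2) * exp (- (2 * w)) = exp (- (C * w))"
      proof -
        have e: "- a\<^sup>2 / 2 = - ((112 + 2 * T) * w)" by (simp add: a2)
        show ?thesis unfolding e mult_exp_exp C_def by (simp add: algebra_simps)
      qed
      moreover have "exp (- (C * w)) ^ n = exp (- C * (real n * w))"
        using exp_of_nat_mult[of n "- (C * w)"] by (simp add: mult_ac)
      ultimately show ?thesis by simp
    qed
    ultimately show "exp (- C * (real n * sqrt (real d * ln (real n)))) \<le> measure (gaussian_sample n d) (complete_event n d t)"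
      unfolding w_def by linarith
  qed
qed

text \<open>For \<open>n\<close> below a small multiple of \<open>sqrt d\<close>, the next vector is pushed along the sum of the previous
  ones; keeping all inner products of order \<open>sqrt d\<close> keeps this sum nearly as short as for
  orthogonal vectors.\<close>

lemma complete_event_lower_small:
  assumes T: "0 \<le> T"
  shows "\<exists>c C. 0 < c \<and> c \<le> 1 \<and> 0 < C \<and> (\<forall>n\<ge>2. \<forall>d\<ge>2. \<forall>t. real n < c * sqrt (real d) \<longrightarrow> t \<le> T * sqrt (real d) \<longrightarrow>
    exp (- C * (real n)\<^sup>2) \<le> measure (gaussian_sample n d) (complete_event n d t))"
proof -
  define K :: real where "K = 36 * exp (33 / 2)"
  \<comment> \<open>Earlier vectors have squared norm at least d / 40, so the push by \<alpha> /
    sqrt d times their sum gives at least (T + 1) * sqrt d with each of them; one sqrt d is reserved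
    for the slab error. \<open>M\<close> below is the matching upper bound, 34 * \<alpha> from the
    push and 1 from the slab.\<close>
  define \<alpha> where "\<alpha> = 40 * (T + 1)"
  define M where "M = 34 * \<alpha> + 1"
  have K: "0 < K" by (simp add: K_def)
  have \<alpha>: "40 \<le> \<alpha>" using T by (simp add: \<alpha>_def)
  have M: "0 < M" using \<alpha> by (simp add: M_def)
  \<comment> \<open>The bound 1 / (2 * K) keeps the slab cost below the lower tail of the norm, 1 /
    M keeps the sum of the cross terms with one vector below d, and 1 / (1360 * \<alpha>^2), where
    1360 = 34 * 40, keeps the squared norm of the push below d / 40.\<close>
  define c where "c = min 1 (min (1 / (2 * K)) (min (1 / M) (1 / (1360 * \<alpha>\<^sup>2))))"
  have c: "0 < c" "c \<le> 1" "c \<le> 1 / (2 * K)" "c \<le> 1 / M" "c \<le> 1 / (1360 * \<alpha>\<^sup>2)"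
    using K M \<alpha> by (auto simp: c_def)
  have cK: "K * c \<le> 1/2" and cM: "c * M \<le> 1" and c\<alpha>: "34 * \<alpha>\<^sup>2 * c \<le> 1/40"
    using c(3-5) K M \<alpha> by (simp_all add: field_simps)
  define C where "C = 17 * \<alpha>\<^sup>2 + K + 1"
  show ?thesis
  proof (rule exI[of _ c], rule exI[of _ C], intro conjI c(1,2) allI impI)
    show "0 < C" using K by (simp add: C_def add_nonneg_pos)
    fix n d :: nat and t
    assume n: "2 \<le> n" and d: "2 \<le> d" and nd: "real n < c * sqrt (real d)" and t: "t \<le> T * sqrt (real d)"
    define D where "D = sqrt (real d)"
    have DD: "D * D = real d" by (simp add: D_def)
    have D2: "2 \<le> D"
    proof -
      have "c * D \<le> 1 * D" using c by (intro mult_right_mono) (auto simp: D_def)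
      then show ?thesis using nd n by (simp add: D_def)
    qed
    have Dd: "2 * D \<le> real d" unfolding DD[symmetric] using D2 by (intro mult_right_mono) auto
    have d4: "4 \<le> real d" using Dd D2 by linarith
    have nD: "real n * M \<le> D"
    proof -
      have "real n * M \<le> c * D * M" using nd M by (intro mult_right_mono) (auto simp: D_def)
      also have "\<dots> = c * M * D" by simp
      also have "\<dots> \<le> 1 * D" using cM D2 by (intro mult_right_mono) auto
      finally show ?thesis by simp
    qed
    let ?G = "std_gaussian d"
    interpret prob_space ?G by (rule prob_space_std_gaussian)
    \<comment> \<open>These bounds survive the push: with |h|^2 between d / 10 and 16 * d and |u|^2
      \<le> d / 40, the sum has squared norm at most 2 * (|h|^2 + |u|^2) \<le> 33 * d and at least
      |h|^2 / 2 - |u|^2 \<ge> d / 40.\<close>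
    define S where "S = {x \<in> space ?G. real d / 40 \<le> ip d x x \<and> ip d x x \<le> 33 * real d}"
    define RR where "RR = {w \<in> space (?G \<Otimes>\<^sub>M ?G). T * D \<le> ip d (fst w) (snd w) \<and> ip d (fst w) (snd w) \<le> M * D}"
    have S: "S \<in> sets ?G" unfolding S_def by measurable
    have RR: "RR \<in> sets (?G \<Otimes>\<^sub>M ?G)" unfolding RR_def by measurable
    define q where "q = exp (- (17 * \<alpha>\<^sup>2 * real n)) * (exp (- (K * real n)) / 2)"
    have "q ^ n \<le> measure (gaussian_sample n d) (complete_event n d t)"
    proof (rule sequential_lower[OF S RR])
      show "0 \<le> q" by (simp add: q_def)
      show "t \<le> ip d x y" if "(x, y) \<in> RR" for x y using that t by (simp add: RR_def D_def)
      fix k Y assume k: "k < n" and YS: "\<And>i. i \<in> {1..k} \<Longrightarrow> Y i \<in> S"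
        and YR: "\<And>i j. i \<in> {1..k} \<Longrightarrow> j \<in> {1..k} \<Longrightarrow> i < j \<Longrightarrow> (Y j, Y i) \<in> RR"
      have Yn: "real d / 40 \<le> ip d (Y i) (Y i)" "ip d (Y i) (Y i) \<le> 33 * real d" "Y i \<in> space ?G" if "i \<in> {1..k}" for i
        using YS[OF that] by (auto simp: S_def)
      have Yp: "0 \<le> ip d (Y j) (Y i)" "ip d (Y j) (Y i) \<le> M * D" if "i \<in> {1..k}" "j \<in> {1..k}" "i \<noteq> j" for i j
      proof -
        have "T * D \<le> ip d (Y j) (Y i) \<and> ip d (Y j) (Y i) \<le> M * D"
        proof (cases "i < j")
          case True
          then show ?thesis using YR[OF that(1,2)] by (simp add: RR_def)
        next
          case False
          then show ?thesis using YR[OF that(2,1)] that(3) by (simp add: RR_def ip_commute[of d "Y j"])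
        qed
        moreover have "0 \<le> T * D" using T D2 by simp
        ultimately show "0 \<le> ip d (Y j) (Y i)" "ip d (Y j) (Y i) \<le> M * D" by auto
      qed
      define \<beta> where "\<beta> = \<alpha> / D"
      have \<beta>: "0 < \<beta>" "\<beta> * real d = \<alpha> * D" using \<alpha> D2 by (auto simp: \<beta>_def DD[symmetric])
      define u where "u = (\<lambda>i\<in>{1..d}. \<beta> * (\<Sum>j\<in>{1..k}. Y j i))"
      have iu: "ip d u z = \<beta> * (\<Sum>j\<in>{1..k}. ip d (Y j) z)" for z
      proof -
        have "ip d u z = (\<Sum>i\<in>{1..d}. \<Sum>j\<in>{1..k}. \<beta> * (Y j i * z i))"
          by (simp add: ip_def u_def sum_distrib_left sum_distrib_right mult.assoc)
        also have "\<dots> = (\<Sum>j\<in>{1..k}. \<Sum>i\<in>{1..d}. \<beta> * (Y j i * z i))" by (rule sum.swap)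
        finally show ?thesis by (simp add: ip_def sum_distrib_left)
      qed
      have iuY: "(T + 1) * D \<le> ip d u (Y i)" "ip d u (Y i) \<le> 34 * \<alpha> * D" if i: "i \<in> {1..k}" for i
      proof -
        have split: "(\<Sum>j\<in>{1..k}. ip d (Y j) (Y i)) = ip d (Y i) (Y i) + (\<Sum>j\<in>{1..k} - {i}. ip d (Y j) (Y i))"
          by (rule sum.remove) (use i in auto)
        have "0 \<le> (\<Sum>j\<in>{1..k} - {i}. ip d (Y j) (Y i))" by (rule sum_nonneg) (use Yp i in auto)
        then have "\<beta> * (real d / 40) \<le> ip d u (Y i)" unfolding iu split using Yn[OF i] \<beta> by (intro mult_left_mono) auto
        then show "(T + 1) * D \<le> ip d u (Y i)" using \<beta>(2) by (simp add: \<alpha>_def algebra_simps)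
        have "(\<Sum>j\<in>{1..k} - {i}. ip d (Y j) (Y i)) \<le> (\<Sum>j\<in>{1..k} - {i}. M * D)"
          by (rule sum_mono) (use Yp i in auto)
        also have "\<dots> \<le> real n * (M * D)" using k i M D2 by (simp add: mult_right_mono)
        also have "\<dots> = (real n * M) * D" by simp
        also have "\<dots> \<le> D * D" using nD D2 by (intro mult_right_mono) auto
        finally have "(\<Sum>j\<in>{1..k}. ip d (Y j) (Y i)) \<le> 34 * real d" unfolding split using Yn(2)[OF i] DD by linarith
        then have "ip d u (Y i) \<le> \<beta> * (34 * real d)" unfolding iu using \<beta> by (intro mult_left_mono) auto
        then show "ip d u (Y i) \<le> 34 * \<alpha> * D" using \<beta>(2) by (simp add: mult.left_commute)
      qed
      \<comment> \<open>The squared norm is \<beta> times the sum of the inner products of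
        \<open>u\<close> with the earlier vectors, each at most 34 * \<alpha> * D. A push therefore
        costs at most exp (- 17 * \<alpha>^2 * n).\<close>
      have uu: "ip d u u \<le> 34 * \<alpha>\<^sup>2 * real n"
      proof -
        have "(\<Sum>j\<in>{1..k}. ip d (Y j) u) \<le> (\<Sum>j\<in>{1..k}. 34 * \<alpha> * D)"
          by (rule sum_mono) (use iuY in \<open>auto simp: ip_commute[of d _ u]\<close>)
        also have "\<dots> \<le> real n * (34 * \<alpha> * D)" using k \<alpha> D2 by (simp add: mult_right_mono)
        finally have "ip d u u \<le> \<beta> * (real n * (34 * \<alpha> * D))" unfolding iu using \<beta> by (intro mult_left_mono) auto
        also have "\<dots> = 34 * \<alpha>\<^sup>2 * real n" using D2 by (simp add: \<beta>_def power2_eq_square)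
        finally show ?thesis .
      qed
      have uu_d: "ip d u u \<le> real d / 40"
      proof -
        have "34 * \<alpha>\<^sup>2 * real n \<le> 34 * \<alpha>\<^sup>2 * (c * D)" using nd by (intro mult_left_mono) (auto simp: D_def)
        also have "\<dots> = 34 * \<alpha>\<^sup>2 * c * D" by simp
        also have "\<dots> \<le> 1/40 * D" using c\<alpha> D2 by (intro mult_right_mono) auto
        finally show ?thesis using uu Dd D2 by linarith
      qed
      \<comment> \<open>\<open>slab_prob\<close> bounds the norm only from above. The lower bound is
        added because the push acts on a later vector through the squared norms of the earlier
        ones.\<close>
      define A where "A = {x \<in> space ?G. ip d x x \<le> 16 * real d \<and> (\<forall>j\<in>{1..k}. \<bar>ip d x (Y j)\<bar> \<le> D) \<and> real d / 10 \<le> ip d x x}"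
      have A [measurable]: "A \<in> sets ?G" unfolding A_def
        by (intro sets.sets_Collect_conj sets.sets_Collect_finite_All finite_atLeastAtMost) measurable
      have sym: "vneg d x \<in> A" if "x \<in> A" for x
      proof -
        have "ip d (vneg d x) (vneg d x) = ip d x x" by (metis ip_vneg ip_commute minus_minus)
        moreover have "vneg d x \<in> space ?G" by (auto simp: vneg_def std_gaussian_def space_PiM)
        ultimately show ?thesis using that by (simp add: A_def ip_vneg)
      qed
      have pA: "exp (- (K * real n)) / 2 \<le> prob A"
      proof -
        let ?B = "{x \<in> space ?G. ip d x x \<le> 16 * real d \<and> (\<forall>j\<in>{1..k}. \<bar>ip d x (Y j)\<bar> \<le> D)}"
        have "exp (- (36 * exp (33 / 2) * (real (card {1..k}) + 1))) \<le> prob ?B"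
          by (rule slab_prob) (use Yn D2 d DD in \<open>auto simp: power2_eq_square\<close>)
        moreover have "K * (real (card {1..k}) + 1) \<le> K * real n" using k K by (intro mult_left_mono) auto
        ultimately have B: "exp (- (K * real n)) \<le> prob ?B" unfolding K_def by (smt (verit) exp_le_cancel_iff)
        have "prob ?B \<le> prob (A \<union> {x \<in> space ?G. ip d x x \<le> real d / 10})"
          by (rule finite_measure_mono) (auto simp: A_def)
        also have "\<dots> \<le> prob A + prob {x \<in> space ?G. ip d x x \<le> real d / 10}" by (rule measure_Un_le) measurable
        also have "\<dots> \<le> prob A + exp (- real d / 2)" using norm_lower_tail[of d] by simp
        finally have 1: "exp (- (K * real n)) \<le> prob A + exp (- real d / 2)" using B by linarith
        have "exp (- real d / 2) \<le> exp (- (K * real n)) / 2"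
        proof -
          have "K * real n \<le> K * (c * D)" using nd K by (intro mult_left_mono) (auto simp: D_def)
          also have "\<dots> = K * c * D" by simp
          also have "\<dots> \<le> 1/2 * D" using cK D2 by (intro mult_right_mono) auto
          finally have "1 + K * real n \<le> real d / 2" using Dd d4 by linarith
          then have "exp (- real d / 2) \<le> exp (- 1 - K * real n)" by simp
          also have "\<dots> = exp (- 1) * exp (- (K * real n))" by (simp add: mult_exp_exp)
          also have "\<dots> \<le> 1/2 * exp (- (K * real n))"
          proof (rule mult_right_mono)
            have "(2::real) \<le> exp 1" using exp_ge_add_one_self[of "1::real"] by simp
            then show "exp (- 1) \<le> (1/2 :: real)" by (simp add: exp_minus field_simps)
          qed simp
          finally show ?thesis by simp
        qed
        then show ?thesis using 1 by linarith
      qed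
      have "q \<le> exp (- ip d u u / 2) * prob A"
        unfolding q_def using uu pA by (intro mult_mono) auto
      also have "\<dots> \<le> prob {x \<in> space ?G. vlin d 1 x (- 1) u \<in> A}" by (rule cameron_martin_symmetric[OF A sym])
      also have "\<dots> \<le> prob {g \<in> S. \<forall>i\<in>{1..k}. (g, Y i) \<in> RR}"
      proof (rule finite_measure_mono)
        show "{x \<in> space ?G. vlin d 1 x (- 1) u \<in> A} \<subseteq> {g \<in> S. \<forall>i\<in>{1..k}. (g, Y i) \<in> RR}"
        proof
          fix g assume "g \<in> {x \<in> space ?G. vlin d 1 x (- 1) u \<in> A}"
          then have g: "g \<in> space ?G" and h: "vlin d 1 g (- 1) u \<in> A" by auto
          define h where "h = vlin d 1 g (- 1) u"
          have hh: "real d / 10 \<le> ip d h h" "ip d h h \<le> 16 * real d" "\<And>j. j \<in> {1..k} \<Longrightarrow> \<bar>ip d h (Y j)\<bar> \<le> D"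
            using h by (auto simp: A_def h_def)
          have hz: "ip d h z = ip d g z - ip d u z" for z by (simp add: h_def ip_vlin_left)
          have gz: "ip d g z = ip d h z + ip d u z" for z by (simp add: hz)
          have gg: "ip d g g = ip d h h + 2 * ip d h u + ip d u u"
          proof -
            have "ip d g g = ip d h g + ip d u g" by (rule gz)
            also have "ip d h g = ip d h h + ip d u h" using gz[of h] by (simp add: ip_commute)
            also have "ip d u g = ip d h u + ip d u u" using gz[of u] by (simp add: ip_commute)
            finally show ?thesis by (simp add: ip_commute)
          qed
          have "0 \<le> ip d (vlin d 1 h (- 1) u) (vlin d 1 h (- 1) u)" by simp
          then have up: "2 * ip d h u \<le> ip d h h + ip d u u"
            unfolding ip_vlin_left ip_vlin_right by (simp add: ip_commute[of d u h])
          have "0 \<le> ip d (vlin d 1 h 2 u) (vlin d 1 h 2 u)" by simp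
          then have lo: "- ip d h h - 4 * ip d u u \<le> 4 * ip d h u"
            unfolding ip_vlin_left ip_vlin_right by (simp add: ip_commute[of d u h])
          have "g \<in> S" using g gg up lo hh uu_d by (simp add: S_def)
          moreover have "(g, Y i) \<in> RR" if i: "i \<in> {1..k}" for i
          proof -
            have "T * D \<le> ip d g (Y i)" using hh(3)[OF i] iuY(1)[OF i] by (simp add: gz algebra_simps)
            moreover have "ip d g (Y i) \<le> M * D" using hh(3)[OF i] iuY(2)[OF i] by (simp add: gz M_def algebra_simps)
            ultimately show ?thesis using g Yn(3)[OF i] by (simp add: RR_def space_pair_measure)
          qed
          ultimately show "g \<in> {g \<in> S. \<forall>i\<in>{1..k}. (g, Y i) \<in> RR}" by simp
        qed
        have "{g \<in> S. \<forall>i\<in>{1..k}. (g, Y i) \<in> RR} = S \<inter> {g \<in> space ?G. \<forall>i\<in>{1..k}. T * D \<le> ip d g (Y i) \<and> ip d g (Y i) \<le> M * D}"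
          using Yn(3) by (auto simp: S_def RR_def space_pair_measure)
        also have "\<dots> \<in> sets ?G"
          by (intro sets.Int S sets.sets_Collect_finite_All finite_atLeastAtMost) measurable
        finally show "{g \<in> S. \<forall>i\<in>{1..k}. (g, Y i) \<in> RR} \<in> sets ?G" .
      qed
      finally show "q \<le> prob {g \<in> S. \<forall>i\<in>{1..k}. (g, Y i) \<in> RR}" .
    qed
    moreover have "exp (- C * (real n)\<^sup>2) \<le> q ^ n"
    proof -
      have "exp (- real n) \<le> exp (- 1 :: real)" using n by simp
      also have "exp (- 1) \<le> (1/2 :: real)"
      proof -
        have "(2::real) \<le> exp 1" using exp_ge_add_one_self[of "1::real"] by simp
        then show ?thesis by (simp add: exp_minus field_simps)
      qed
      finally have "exp (- (17 * \<alpha>\<^sup>2 * real n)) * (exp (- (K * real n)) * exp (- real n)) \<le> exp (- (17 * \<alpha>\<^sup>2 * real n)) * (exp (- (K * real n)) * (1/2))"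
        by (intro mult_left_mono) auto
      then have "exp (- (C * real n)) \<le> q" by (simp add: q_def C_def mult_exp_exp algebra_simps)
      then have "exp (- (C * real n)) ^ n \<le> q ^ n" by (intro power_mono) auto
      moreover have "exp (- (C * real n)) ^ n = exp (- C * (real n)\<^sup>2)"
        unfolding exp_of_nat_mult[symmetric] by (simp add: power2_eq_square mult_ac)
      ultimately show ?thesis by simp
    qed
    ultimately show "exp (- C * (real n)\<^sup>2) \<le> measure (gaussian_sample n d) (complete_event n d t)" by linarith
  qed
qed

text \<open>Each of the three bounds is proved for all n and d, so the minimum needs no case
  analysis. The n^2 bound is glued at n = c * sqrt d, with c supplied by the construction for small
  n, since the other construction accepts any c in (0, 1].\<close>

lemma complete_event_lower:
  assumes p: "0 < p" "p \<le> 1/2"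
  shows "\<exists>C>0. \<forall>n\<ge>2. \<forall>d\<ge>2. \<forall>t. is_threshold d p t \<longrightarrow>
    measure (gaussian_sample n d) (complete_event n d t)
      \<ge> exp (- C * min ((real n)\<^sup>2) (min (real n * sqrt (real d * ln (real n))) (real n * real d)))"
proof -
  define T where "T = sqrt 2 * (1/2 - ln p)"
  have T: "0 \<le> T"
  proof -
    have "ln p \<le> 0" using p by simp
    then show ?thesis by (simp add: T_def)
  qed
  obtain c C1 where c: "0 < c" "c \<le> 1" and C1: "0 < C1"
    and small: "\<And>n d t. 2 \<le> n \<Longrightarrow> 2 \<le> d \<Longrightarrow> real n < c * sqrt (real d) \<Longrightarrow> t \<le> T * sqrt (real d) \<Longrightarrow>
      exp (- C1 * (real n)\<^sup>2) \<le> measure (gaussian_sample n d) (complete_event n d t)"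
    using complete_event_lower_small[OF T] by blast
  obtain C2 where C2: "0 < C2"
    and quad: "\<And>n d t. 2 \<le> n \<Longrightarrow> 2 \<le> d \<Longrightarrow> c * sqrt (real d) \<le> real n \<Longrightarrow> t \<le> T * sqrt (real d) \<Longrightarrow>
      exp (- C2 * (real n)\<^sup>2) \<le> measure (gaussian_sample n d) (complete_event n d t)"
    using complete_event_lower_quadratic[OF T c] by blast
  obtain C3 where C3: "0 < C3"
    and log: "\<And>n d t. 2 \<le> n \<Longrightarrow> 2 \<le> d \<Longrightarrow> t \<le> T * sqrt (real d) \<Longrightarrow>
      exp (- C3 * (real n * sqrt (real d * ln (real n)))) \<le> measure (gaussian_sample n d) (complete_event n d t)"
    using complete_event_lower_log[OF T] by blast
  define b where "b = measure stdN {sqrt T<..<sqrt T + 1}"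
  have b: "0 < b" unfolding b_def by (rule measure_stdN_interval_pos) simp
  define C4 where "C4 = \<bar>ln b\<bar>"
  define C where "C = max (max C1 C2) (max C3 C4)"
  have C: "C1 \<le> C" "C2 \<le> C" "C3 \<le> C" "C4 \<le> C" "0 < C" using C1 by (auto simp: C_def)
  show ?thesis
  proof (intro exI[of _ C] conjI C allI impI)
    fix n d :: nat and t
    assume n: "2 \<le> n" and d: "2 \<le> d" and th: "is_threshold d p t"
    have t: "t \<le> T * sqrt (real d)" unfolding T_def by (rule threshold_upper[OF th p(1)]) (use d in simp)
    define P where "P = measure (gaussian_sample n d) (complete_event n d t)"
    have mono: "exp (- C * x) \<le> P" if "exp (- C' * x) \<le> P" "C' \<le> C" "0 \<le> x" for C' x
    proof -
      have "C' * x \<le> C * x" using that by (intro mult_right_mono) auto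
      then have "exp (- C * x) \<le> exp (- C' * x)" by simp
      then show ?thesis using that by linarith
    qed
    have 1: "exp (- C * (real n)\<^sup>2) \<le> P"
    proof (cases "real n < c * sqrt (real d)")
      case True
      show ?thesis by (rule mono[OF _ C(1)]) (use small[OF n d True t] in \<open>auto simp: P_def\<close>)
    next
      case False
      then have "c * sqrt (real d) \<le> real n" by simp
      then show ?thesis by (intro mono[OF _ C(2)]) (use quad[OF n d _ t] in \<open>auto simp: P_def\<close>)
    qed
    have 2: "exp (- C * (real n * sqrt (real d * ln (real n)))) \<le> P"
      by (rule mono[OF _ C(3)]) (use log[OF n d t] n in \<open>auto simp: P_def\<close>)
    have 3: "exp (- C * (real n * real d)) \<le> P"
    proof (rule mono[OF _ C(4)])
      have "b = exp (ln b)" using b by simp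
      have "- (C4 * (real n * real d)) \<le> real (n * d) * ln b"
        using mult_left_mono[of "- C4" "ln b" "real (n * d)"] by (simp add: C4_def mult_ac)
      then have "exp (- C4 * (real n * real d)) \<le> exp (real (n * d) * ln b)" by simp
      also have "\<dots> = b ^ (n * d)" using b by (simp only: exp_of_nat_mult exp_ln)
      also have "\<dots> \<le> P" unfolding P_def b_def by (rule complete_event_lower_box[OF t T]) (use d in simp)
      finally show "exp (- C4 * (real n * real d)) \<le> P" .
    qed simp
    show "exp (- C * min ((real n)\<^sup>2) (min (real n * sqrt (real d * ln (real n))) (real n * real d)))
       \<le> measure (gaussian_sample n d) (complete_event n d t)"
      using 1 2 3 unfolding P_def[symmetric] by (auto simp: min_def)
  qed
qed

theorem theorem2p2:
  fixes p :: real
  assumes "0 < p" and "p \<le> 1/2"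
  shows
    "(\<exists>C>0. \<forall>n\<ge>2. \<forall>d\<ge>2. \<forall>t. is_threshold d p t \<longrightarrow>
        measure (gaussian_sample n d) (complete_event n d t)
          \<ge> exp (- C * min ((real n)\<^sup>2)
                      (min (real n * sqrt (real d * ln (real n))) (real n * real d))))
     \<and>
     (\<exists>c>0. \<exists>\<epsilon> :: nat \<Rightarrow> real. \<epsilon> \<longlonglongrightarrow> 0 \<and>
        (\<forall>n\<ge>2. \<forall>d\<ge>2. \<forall>t. is_threshold d p t \<longrightarrow>
          measure (gaussian_sample n d) (complete_event n d t)
            \<le> exp (- c * min ((real n)\<^sup>2)
                        (min (real n * sqrt (real d *
                                ln (max (real n powr (1 - \<epsilon> n) / real d powr (3/4)) (exp 1))))
                             (real n * real d)))))"
proof (rule conjI[OF complete_event_lower[OF assms]])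
  obtain c where c: "c > 0" and upper: "\<And>n d t. 2 \<le> n \<Longrightarrow> 2 \<le> d \<Longrightarrow> is_threshold d p t \<Longrightarrow>
    measure (gaussian_sample n d) (complete_event n d t)
      \<le> exp (- c * min ((real n)\<^sup>2)
          (min (real n * sqrt (real d * ln (max (real n / real d powr (3/4)) (exp 1)))) (real n * real d)))"
    using complete_event_upper[OF assms] by blast
  show "\<exists>c>0. \<exists>\<epsilon> :: nat \<Rightarrow> real. \<epsilon> \<longlonglongrightarrow> 0 \<and>
        (\<forall>n\<ge>2. \<forall>d\<ge>2. \<forall>t. is_threshold d p t \<longrightarrow>
          measure (gaussian_sample n d) (complete_event n d t)
            \<le> exp (- c * min ((real n)\<^sup>2)
                        (min (real n * sqrt (real d *
                                ln (max (real n powr (1 - \<epsilon> n) / real d powr (3/4)) (exp 1))))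
                             (real n * real d))))"
    by (intro exI[of _ c] conjI c exI[of _ "\<lambda>_. 0"] tendsto_const allI impI) (use upper in simp)
qed

end
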